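(* Let $H$ be a Hilbert $\mathfrak{A}$-module over a $C^*$-algebra $\mathfrak{A}$. Let $T,A\in\mathcal{L}(H)$ have the polar decompositions $T=U_T|T|$ and $A=U_A|A|$. Suppose that $\big[|T|,A\big]=0$. For $\alpha>0$ and $\beta>0$ let $$X^{\alpha,\beta}_{T,A}=|T|^{\alpha}\cdot A\cdot U_T|T|^{\beta},\quad Y^{\alpha,\beta}_{T,A}=|T|^{\alpha}\cdot A\cdot|T^*|^{\beta},\quad W_{T,A}=U_T^*U_TU_AU_T.$$ Then, for given $\alpha>0$ and $\beta>0$, the following statements are equivalent: (i) $X^{\alpha,\beta}_{T,A}=W_{T,A}\left|X^{\alpha,\beta}_{T,A}\right|$ is the polar decomposition; (ii) $Y^{\alpha,\beta}_{T,A}=W_{T,A}U_T^*\left|Y^{\alpha,\beta}_{T,A}\right|$ is the polar decomposition; (iii) $X^{\alpha,\beta}_{T,A}=W_{T,A}\left|X^{\alpha,\beta}_{T,A}\right|$; (iv) $Y^{\alpha,\beta}_{T,A}=W_{T,A}U_T^*\left|Y^{\alpha,\beta}_{T,A}\right|$; (v) $|T|^{\alpha}\cdot|A|\cdot|T^*|^{\beta}$ is positive. If in addition $\big[|T^*|,|A|\big]=0$, and one of (i)--(v) is satisfied, then (i)--(v) are all valid when $\alpha$ and $\beta$ are replaced by any positive numbers $\alpha'$ and $\beta'$, respectively.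
   Context: $\mathcal{L}(H)$ denotes the $C^*$-algebra of adjointable operators on $H$; $\mathcal{R}(\cdot)$ denotes range; $[B,C]=BC-CB$ is the commutator; "positive" means positive as an element of $\mathcal{L}(H)$. For an adjointable operator $B$, $|B|=(B^*B)^{1/2}$. A closed submodule $M$ of $H$ is orthogonally complemented if $H=M\dotplus M^\perp$, and then $P_M$ is the projection of $H$ onto $M$. An operator $U\in\mathcal{L}(H)$ is a partial isometry if $U^*U$ is a projection. Polar decomposition: for $B\in\mathcal{L}(H)$, "$B=U|B|$ is the polar decomposition" (or "$B$ has the polar decomposition $B=U|B|$") means that $U\in\mathcal{L}(H)$ is a partial isometry such that $B=U|B|$ and $U^*U=P_{\overline{\mathcal{R}(B^* )}}$ (in particular $\overline{\mathcal{R}(B^* )}$ is orthogonally complemented). Such a $U$ is unique if it exists, but it need not exist in general. Statements (iii) and (iv) assert only the displayed operator identities. *)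

theory Defs
  imports "HOL-Analysis.Analysis" "HOL-Computational_Algebra.Polynomial"
begin

section \<open>C*-algebras\<close>

class complex_vector = real_vector +
  fixes scaleC :: "complex \<Rightarrow> 'a \<Rightarrow> 'a"  (infixr "*\<^sub>C" 75)
  assumes scaleC_add_right: "c *\<^sub>C (x + y) = c *\<^sub>C x + c *\<^sub>C y"
    and scaleC_add_left: "(c + d) *\<^sub>C x = c *\<^sub>C x + d *\<^sub>C x"
    and scaleC_scaleC: "c *\<^sub>C (d *\<^sub>C x) = (c * d) *\<^sub>C x"
    and scaleC_one: "1 *\<^sub>C x = x"
    and scaleR_scaleC: "r *\<^sub>R x = complex_of_real r *\<^sub>C x"

text \<open>Not necessarily unital; \<open>real_normed_algebra\<close> has no unit either.\<close>

class cstar_algebra = complex_vector + real_normed_algebra + banach +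
  fixes star :: "'a \<Rightarrow> 'a"
  assumes norm_scaleC: "norm (c *\<^sub>C x) = cmod c * norm x"
    and mult_scaleC_left: "(c *\<^sub>C x) * y = c *\<^sub>C (x * y)"
    and mult_scaleC_right: "x * (c *\<^sub>C y) = c *\<^sub>C (x * y)"
    and star_star: "star (star x) = x"
    and star_add: "star (x + y) = star x + star y"
    and star_scaleC: "star (c *\<^sub>C x) = cnj c *\<^sub>C star x"
    and star_mult: "star (x * y) = star y * star x"
    and cstar_identity: "norm (star x * x) = (norm x)\<^sup>2"

text \<open>
  The form \<open>b\<^sup>* b\<close> needs no unit; positivity of operators is defined below through the spectrum.
\<close>

definition cstar_positive :: "'a::cstar_algebra \<Rightarrow> bool" where
  "cstar_positive a \<longleftrightarrow> (\<exists>b. a = star b * b)"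


section \<open>Hilbert C*-modules\<close>

text \<open>
  Right modules, with inner product \<open>ip\<close> linear in the second variable. The norm of the type
  is the one induced by \<open>ip\<close>, so that the sort \<open>banach\<close> expresses completeness with respect to
  the induced norm.
\<close>

locale hilbert_module =
  fixes act :: "'h::{complex_vector, banach} \<Rightarrow> 'a::cstar_algebra \<Rightarrow> 'h"
    and ip :: "'h \<Rightarrow> 'h \<Rightarrow> 'a"
  assumes act_add_left: "act (x + y) a = act x a + act y a"
    and act_add_right: "act x (a + b) = act x a + act x b"
    and act_mult: "act x (a * b) = act (act x a) b"
    and act_scaleC_left: "act (c *\<^sub>C x) a = c *\<^sub>C act x a"
    and act_scaleC_right: "act x (c *\<^sub>C a) = c *\<^sub>C act x a"
    and ip_add_right: "ip x (y + z) = ip x y + ip x z"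
    and ip_scaleC_right: "ip x (c *\<^sub>C y) = c *\<^sub>C ip x y"
    and ip_act_right: "ip x (act y a) = ip x y * a"
    and star_ip: "star (ip x y) = ip y x"
    and ip_positive: "cstar_positive (ip x x)"
    and ip_definite: "ip x x = 0 \<Longrightarrow> x = 0"
    and norm_eq_sqrt_ip: "norm x = sqrt (norm (ip x x))"


section \<open>Adjointable operators\<close>

text \<open>
  An adjointable map of a Hilbert C*-module is automatically linear and bounded, so the
  adjointable operators are taken inside the type of bounded linear maps, whose norm is the
  operator norm. The notions below depend on the module structure only through \<open>ip\<close>.
\<close>

definition is_adjoint ::
    "('h::{complex_vector, banach} \<Rightarrow> 'h \<Rightarrow> 'a::cstar_algebra) \<Rightarrow> ('h \<Rightarrow>\<^sub>L 'h) \<Rightarrow> ('h \<Rightarrow>\<^sub>L 'h) \<Rightarrow> bool" where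
  "is_adjoint ip B C \<longleftrightarrow> (\<forall>x y. ip (blinfun_apply B x) y = ip x (blinfun_apply C y))"

definition adjointable_ops ::
    "('h::{complex_vector, banach} \<Rightarrow> 'h \<Rightarrow> 'a::cstar_algebra) \<Rightarrow> ('h \<Rightarrow>\<^sub>L 'h) set" where
  "adjointable_ops ip = {B. \<exists>C. is_adjoint ip B C}"

definition adjoint_op ::
    "('h::{complex_vector, banach} \<Rightarrow> 'h \<Rightarrow> 'a::cstar_algebra) \<Rightarrow> ('h \<Rightarrow>\<^sub>L 'h) \<Rightarrow> ('h \<Rightarrow>\<^sub>L 'h)" where
  "adjoint_op ip B = (THE C. is_adjoint ip B C)"

definition commutator ::
    "('h::real_normed_vector \<Rightarrow>\<^sub>L 'h) \<Rightarrow> ('h \<Rightarrow>\<^sub>L 'h) \<Rightarrow> ('h \<Rightarrow>\<^sub>L 'h)" where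
  "commutator B C = (B o\<^sub>L C) - (C o\<^sub>L B)"

text \<open>
  The spectrum relative to the algebra of adjointable operators: \<open>z\<close> is in the spectrum unless
  \<open>z - B\<close> has a two-sided inverse \<open>R\<close> that is again adjointable.
\<close>

definition op_spectrum ::
    "('h::{complex_vector, banach} \<Rightarrow> 'h \<Rightarrow> 'a::cstar_algebra) \<Rightarrow> ('h \<Rightarrow>\<^sub>L 'h) \<Rightarrow> complex set" where
  "op_spectrum ip B = {z. \<not> (\<exists>R\<in>adjointable_ops ip. \<forall>x.
      blinfun_apply R (z *\<^sub>C x - blinfun_apply B x) = x \<and>
      z *\<^sub>C blinfun_apply R x - blinfun_apply B (blinfun_apply R x) = x)}"

definition op_positive ::
    "('h::{complex_vector, banach} \<Rightarrow> 'h \<Rightarrow> 'a::cstar_algebra) \<Rightarrow> ('h \<Rightarrow>\<^sub>L 'h) \<Rightarrow> bool" where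
  "op_positive ip B \<longleftrightarrow>
     B \<in> adjointable_ops ip \<and> adjoint_op ip B = B \<and> op_spectrum ip B \<subseteq> complex_of_real ` {0..}"


section \<open>Real powers and absolute value\<close>

primrec op_power :: "('h::real_normed_vector \<Rightarrow>\<^sub>L 'h) \<Rightarrow> nat \<Rightarrow> ('h \<Rightarrow>\<^sub>L 'h)" where
  "op_power B 0 = id_blinfun"
| "op_power B (Suc n) = B o\<^sub>L op_power B n"

definition op_poly :: "real poly \<Rightarrow> ('h::real_normed_vector \<Rightarrow>\<^sub>L 'h) \<Rightarrow> ('h \<Rightarrow>\<^sub>L 'h)" where
  "op_poly p B = (\<Sum>i\<le>degree p. coeff p i *\<^sub>R op_power B i)"

text \<open>
  Continuous functional calculus for a self-adjoint \<open>B\<close> (whose spectrum is real) and a real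
  function \<open>f\<close> continuous on the spectrum: \<open>f(B)\<close> is the norm limit of \<open>p\<^sub>n(B)\<close> for any real
  polynomials \<open>p\<^sub>n\<close> converging to \<open>f\<close> uniformly on the spectrum.
\<close>

definition op_cfc ::
    "('h::{complex_vector, banach} \<Rightarrow> 'h \<Rightarrow> 'a::cstar_algebra) \<Rightarrow> (real \<Rightarrow> real) \<Rightarrow> ('h \<Rightarrow>\<^sub>L 'h) \<Rightarrow> ('h \<Rightarrow>\<^sub>L 'h)" where
  "op_cfc ip f B = (THE C. \<forall>p.
      uniform_limit {t. complex_of_real t \<in> op_spectrum ip B} (\<lambda>n. poly (p n)) f sequentially
      \<longrightarrow> (\<lambda>n. op_poly (p n) B) \<longlonglongrightarrow> C)"

definition op_powr ::
    "('h::{complex_vector, banach} \<Rightarrow> 'h \<Rightarrow> 'a::cstar_algebra) \<Rightarrow> ('h \<Rightarrow>\<^sub>L 'h) \<Rightarrow> real \<Rightarrow> ('h \<Rightarrow>\<^sub>L 'h)" where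
  "op_powr ip B \<alpha> = op_cfc ip (\<lambda>t. t powr \<alpha>) B"

definition op_abs ::
    "('h::{complex_vector, banach} \<Rightarrow> 'h \<Rightarrow> 'a::cstar_algebra) \<Rightarrow> ('h \<Rightarrow>\<^sub>L 'h) \<Rightarrow> ('h \<Rightarrow>\<^sub>L 'h)" where
  "op_abs ip B = op_powr ip (adjoint_op ip B o\<^sub>L B) (1/2)"


section \<open>Polar decomposition\<close>

definition op_projection ::
    "('h::{complex_vector, banach} \<Rightarrow> 'h \<Rightarrow> 'a::cstar_algebra) \<Rightarrow> ('h \<Rightarrow>\<^sub>L 'h) \<Rightarrow> bool" where
  "op_projection ip P \<longleftrightarrow> P \<in> adjointable_ops ip \<and> adjoint_op ip P = P \<and> P o\<^sub>L P = P"

definition partial_isometry ::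
    "('h::{complex_vector, banach} \<Rightarrow> 'h \<Rightarrow> 'a::cstar_algebra) \<Rightarrow> ('h \<Rightarrow>\<^sub>L 'h) \<Rightarrow> bool" where
  "partial_isometry ip U \<longleftrightarrow>
     U \<in> adjointable_ops ip \<and> op_projection ip (adjoint_op ip U o\<^sub>L U)"

definition ortho_complement ::
    "('h::{complex_vector, banach} \<Rightarrow> 'h \<Rightarrow> 'a::cstar_algebra) \<Rightarrow> 'h set \<Rightarrow> 'h set" where
  "ortho_complement ip M = {y. \<forall>x\<in>M. ip x y = 0}"

text \<open>
  These two are used only for \<open>M\<close> the closure of the range of an adjointable operator, which is
  automatically a closed submodule.
\<close>

definition ortho_complemented ::
    "('h::{complex_vector, banach} \<Rightarrow> 'h \<Rightarrow> 'a::cstar_algebra) \<Rightarrow> 'h set \<Rightarrow> bool" where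
  "ortho_complemented ip M \<longleftrightarrow>
     (\<forall>h. \<exists>x\<in>M. \<exists>y\<in>ortho_complement ip M. h = x + y) \<and> M \<inter> ortho_complement ip M = {0}"

definition ortho_proj ::
    "('h::{complex_vector, banach} \<Rightarrow> 'h \<Rightarrow> 'a::cstar_algebra) \<Rightarrow> 'h set \<Rightarrow> ('h \<Rightarrow>\<^sub>L 'h)" where
  "ortho_proj ip M = (THE P.
      (\<forall>x\<in>M. blinfun_apply P x = x) \<and> (\<forall>y\<in>ortho_complement ip M. blinfun_apply P y = 0))"

definition polar_decomposition ::
    "('h::{complex_vector, banach} \<Rightarrow> 'h \<Rightarrow> 'a::cstar_algebra) \<Rightarrow> ('h \<Rightarrow>\<^sub>L 'h) \<Rightarrow> ('h \<Rightarrow>\<^sub>L 'h) \<Rightarrow> bool" where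
  "polar_decomposition ip B U \<longleftrightarrow>
     B \<in> adjointable_ops ip \<and> partial_isometry ip U \<and> B = U o\<^sub>L op_abs ip B \<and>
     (let M = closure (range (blinfun_apply (adjoint_op ip B)))
      in ortho_complemented ip M \<and> adjoint_op ip U o\<^sub>L U = ortho_proj ip M)"

end

theory Submission
  imports Defs "HOL-Computational_Algebra.Fundamental_Theorem_Algebra"
begin

text \<open>
  Write \<open>U = U\<^sub>T\<close>, \<open>V = U\<^sub>A\<close> and \<open>Z = |T|\<^sup>\<alpha> |A| |T\<^sup>*|\<^sup>\<beta>\<close>. Since \<open>|T|\<close> commutes with \<open>A\<close>, it
  commutes with \<open>|A|\<close> and with \<open>V\<close>, so that \<open>Y = V Z\<close> and \<open>X = V Z U\<close>: all five conditions are
  statements about \<open>Z\<close>, and each of them turns out to be equivalent to positivity of \<open>Z\<close>.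

  \<^item> \<open>Z\<close> is the product of the positive operators \<open>C = |T|\<^sup>\<alpha> |A|\<close> and \<open>|T\<^sup>*|\<^sup>\<beta>\<close>, hence positive if
    and only if these commute (\<open>pos_Z_iff\<close>). In that case the projections \<open>E\<close> and \<open>U U\<^sup>*\<close> onto the
    closures of their ranges commute as well, and \<open>E U U\<^sup>*\<close> projects onto the closure of the range
    of \<open>Z\<close> (\<open>pC_pS\<close>). Squaring gives \<open>|Y| = Z\<close> and \<open>|X| = U\<^sup>* Z U\<close>; the claimed polar
    decompositions follow by comparing projections (\<open>pos_imp_polar_X\<close>, \<open>pos_imp_polar_Y\<close>).

  \<^item> Conversely, the bare identity \<open>X = W |X|\<close> reads \<open>Z U = E U |X|\<close>. Computing \<open>|X|\<^sup>2\<close> from it shows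
    that applying \<open>E\<close> to \<open>U |X|\<close> loses no norm, hence \<open>E U |X| = U |X|\<close> and \<open>Z = U |X| U\<^sup>*\<close> is
    positive (\<open>X_imp_pos\<close>). In the same way \<open>Y = W U\<^sup>* |Y|\<close> forces \<open>Z = |Y|\<close> (\<open>Y_imp_pos\<close>).

  \<^item> If \<open>|A|\<close> also commutes with \<open>|T\<^sup>*|\<close>, then positivity of \<open>Z\<close> says that \<open>|T|\<^sup>\<alpha>\<close> and \<open>|T\<^sup>*|\<^sup>\<beta>\<close>
    commute on the closure of the range of \<open>|A|\<close>, a property that survives passing to other powers
    of the two operators (\<open>polar_pair_change_exponents\<close>).

  The analytic background is built on square roots instead of spectral radii. In a C*-algebra the
  root of \<open>1 - x\<close> for self-adjoint \<open>x\<close> with \<open>\<parallel>x\<parallel> \<le> 1\<close> is the limit of an explicit sequence of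
  polynomials in \<open>x\<close>, so that positivity of \<open>a\<close>, understood as being the square of a self-adjoint
  element, becomes the norm condition \<open>\<parallel>t - a\<parallel> \<le> t\<close>. From this follow the order structure,
  positivity of \<open>t\<^sup>* t\<close> (\<open>pos_star_mult\<close>), the estimate of \<open>\<parallel>p(s)\<parallel>\<close> by the values of \<open>p\<close> on the
  spectrum (\<open>norm_poly_at_le_rspec\<close>) and with it the continuous functional calculus and real powers.
  The theory is used twice: for the C*-algebra acting on itself by multiplication, which yields the
  Cauchy-Schwarz inequality of Hilbert modules, and then for the adjointable operators on the module.
\<close>

section \<open>Bounded endomorphisms as a Banach algebra\<close>

text \<open>
  A copy of the bounded linear maps from a space to itself. The type of bounded linear maps has two
  parameters, so that composition can be the multiplication of a type class only on its diagonal.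
\<close>

typedef (overloaded) 'h endo = "UNIV :: ('h::real_normed_vector \<Rightarrow>\<^sub>L 'h) set"
  morphisms blin endo ..

setup_lifting type_definition_endo

instantiation endo :: (real_normed_vector) real_normed_vector
begin

lift_definition zero_endo :: "'a endo" is 0 .
lift_definition plus_endo :: "'a endo \<Rightarrow> 'a endo \<Rightarrow> 'a endo" is "(+)" .
lift_definition minus_endo :: "'a endo \<Rightarrow> 'a endo \<Rightarrow> 'a endo" is "(-)" .
lift_definition uminus_endo :: "'a endo \<Rightarrow> 'a endo" is uminus .
lift_definition scaleR_endo :: "real \<Rightarrow> 'a endo \<Rightarrow> 'a endo" is scaleR .
lift_definition norm_endo :: "'a endo \<Rightarrow> real" is norm .
lift_definition dist_endo :: "'a endo \<Rightarrow> 'a endo \<Rightarrow> real" is dist .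
lift_definition sgn_endo :: "'a endo \<Rightarrow> 'a endo" is sgn .

definition uniformity_endo :: "('a endo \<times> 'a endo) filter" where
  "uniformity_endo = (INF e\<in>{0<..}. principal {(x, y). dist x y < e})"

definition open_endo :: "'a endo set \<Rightarrow> bool" where
  "open_endo S = (\<forall>x\<in>S. \<forall>\<^sub>F (x', y) in uniformity. x' = x \<longrightarrow> y \<in> S)"

instance
  by (standard; (simp add: uniformity_endo_def open_endo_def; fail)?; transfer;
      simp add: algebra_simps dist_norm sgn_div_norm norm_triangle_ineq)

end

instantiation endo :: (real_normed_vector) monoid_mult
begin

lift_definition one_endo :: "'a endo" is id_blinfun .
lift_definition times_endo :: "'a endo \<Rightarrow> 'a endo \<Rightarrow> 'a endo" is "(o\<^sub>L)" .

instance
  by (intro_classes; transfer; rule blinfun_eqI; simp)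

end

instance endo :: (real_normed_vector) real_normed_algebra
  by (intro_classes; transfer; (rule norm_blinfun_compose | (rule blinfun_eqI, simp add: blinfun.bilinear_simps)))

lemma blin_lim_iff: "(\<lambda>n. blin (X n)) \<longlonglongrightarrow> blin a \<longleftrightarrow> X \<longlonglongrightarrow> a"
  by (simp add: tendsto_iff dist_endo.rep_eq)

instance endo :: (banach) banach
proof
  fix X :: "nat \<Rightarrow> 'a endo"
  assume "Cauchy X"
  then have "Cauchy (\<lambda>n. blin (X n))"
    by (simp add: Cauchy_def dist_endo.rep_eq)
  then obtain c where "(\<lambda>n. blin (X n)) \<longlonglongrightarrow> c"
    using Cauchy_convergent convergent_def by blast
  then have "X \<longlonglongrightarrow> endo c"
    by (metis blin_lim_iff UNIV_I endo_inverse)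
  then show "convergent X"
    by (auto simp: convergent_def)
qed

abbreviation ap :: "'h::real_normed_vector endo \<Rightarrow> 'h \<Rightarrow> 'h" where
  "ap a \<equiv> blinfun_apply (blin a)"

lemma blin_endo [simp]: "blin (endo b) = b"
  by (simp add: endo_inverse)

lemma endo_eqI: "(\<And>x. ap a x = ap b x) \<Longrightarrow> a = b"
  by (metis blinfun_eqI blin_inject)

lemma ap_simps [simp]:
  "ap (a * b) x = ap a (ap b x)" "ap 1 x = x" "ap 0 x = 0"
  "ap (a + b) x = ap a x + ap b x" "ap (a - b) x = ap a x - ap b x"
  "ap (- a) x = - ap a x" "ap (r *\<^sub>R a) x = r *\<^sub>R ap a x"
  by (simp_all add: times_endo.rep_eq one_endo.rep_eq zero_endo.rep_eq plus_endo.rep_eq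
      minus_endo.rep_eq uminus_endo.rep_eq scaleR_endo.rep_eq blinfun.bilinear_simps)

lemma ap_linear [simp]:
  "ap a (x + y) = ap a x + ap a y" "ap a (x - y) = ap a x - ap a y" "ap a 0 = 0"
  "ap a (- x) = - ap a x" "ap a (r *\<^sub>R x) = r *\<^sub>R ap a x"
  by (simp_all add: blinfun.bilinear_simps)

lemma norm_ap: "norm (ap a x) \<le> norm a * norm x"
  by (simp add: norm_endo.rep_eq norm_blinfun)

lemma ap_lim: "X \<longlonglongrightarrow> a \<Longrightarrow> (\<lambda>n. ap (X n) x) \<longlonglongrightarrow> ap a x"
  by (simp add: blin_lim_iff[symmetric] blinfun.tendsto)

section \<open>Real polynomials in an algebra element\<close>

text \<open>
  Evaluation at an element of a real algebra that need not be commutative; the complex numbers are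
  another instance, used to factorize real polynomials.
\<close>

definition poly_at :: "real poly \<Rightarrow> 'b::{real_normed_algebra, monoid_mult} \<Rightarrow> 'b" where
  "poly_at p b = (\<Sum>i\<le>degree p. coeff p i *\<^sub>R b ^ i)"

lemma poly_at_upto: "degree p \<le> n \<Longrightarrow> poly_at p b = (\<Sum>i\<le>n. coeff p i *\<^sub>R b ^ i)"
  unfolding poly_at_def by (rule sum.mono_neutral_left) (auto simp: coeff_eq_0)

lemma poly_at_0 [simp]: "poly_at 0 b = 0"
  by (simp add: poly_at_def)

lemma poly_at_pCons [simp]: "poly_at (pCons a p) b = a *\<^sub>R 1 + b * poly_at p b"
proof -
  have "poly_at (pCons a p) b = (\<Sum>i\<le>Suc (degree p). coeff (pCons a p) i *\<^sub>R b ^ i)"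
    by (rule poly_at_upto) (rule degree_pCons_le)
  also have "\<dots> = a *\<^sub>R 1 + (\<Sum>i\<le>degree p. coeff p i *\<^sub>R (b * b ^ i))"
    by (subst sum.atMost_Suc_shift) simp
  also have "\<dots> = a *\<^sub>R 1 + b * poly_at p b"
    by (simp add: poly_at_def sum_distrib_left)
  finally show ?thesis .
qed

lemma poly_at_add: "poly_at (p + q) b = poly_at p b + poly_at q b"
proof -
  define n where "n = max (degree p) (degree q)"
  have "degree (p + q) \<le> n" "degree p \<le> n" "degree q \<le> n"
    by (auto simp: n_def degree_add_le)
  then show ?thesis
    by (simp add: poly_at_upto[where n = n] scaleR_add_left sum.distrib)
qed

lemma poly_at_smult: "poly_at (smult c p) b = c *\<^sub>R poly_at p b"
  by (simp add: poly_at_upto[where n = "degree p"] degree_smult_le scaleR_sum_right)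

lemma poly_at_diff: "poly_at (p - q) b = poly_at p b - poly_at q b"
  using poly_at_add[of p "smult (-1) q" b] poly_at_smult[of "-1" q b] by simp

lemma poly_at_mult: "poly_at (p * q) b = poly_at p b * poly_at q b"
proof (induction p)
  case (pCons a p)
  then show ?case
    by (simp add: mult_pCons_left poly_at_add poly_at_smult distrib_right mult.assoc)
qed simp

text \<open>
  The case \<open>b = b'\<close> concerns the commutant of \<open>b\<close>. Two different elements occur when a partial
  isometry is moved past a function of \<open>|T|\<close>, which turns it into a function of \<open>|T\<^sup>*|\<close>.
\<close>

lemma poly_at_intertwine: "c * b = b' * c \<Longrightarrow> c * poly_at p b = poly_at p b' * c"
proof (induction p)
  case (pCons a p)
  have "c * (b * poly_at p b) = b' * (c * poly_at p b)"
    using pCons.prems by (simp add: mult.assoc[symmetric])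
  then show ?case
    using pCons by (simp add: distrib_left distrib_right mult.assoc)
qed simp

section \<open>The polynomials behind the square root\<close>

definition nonneg_coeffs :: "real poly \<Rightarrow> bool" where
  "nonneg_coeffs p \<longleftrightarrow> (\<forall>i. coeff p i \<ge> 0)"

lemma nonneg_coeffs_intros:
  "nonneg_coeffs p \<Longrightarrow> nonneg_coeffs q \<Longrightarrow> nonneg_coeffs (p + q)"
  "nonneg_coeffs p \<Longrightarrow> nonneg_coeffs q \<Longrightarrow> nonneg_coeffs (p * q)"
  "c \<ge> 0 \<Longrightarrow> nonneg_coeffs p \<Longrightarrow> nonneg_coeffs (smult c p)"
  "nonneg_coeffs 0" "nonneg_coeffs [:0, 1:]"
  by (auto simp: nonneg_coeffs_def coeff_mult coeff_pCons sum_nonneg split: nat.split)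

text \<open>
  The iteration \<open>y \<leftarrow> (x + y\<^sup>2) / 2\<close> for the solution \<open>y = 1 - \<surd>(1 - x)\<close> of \<open>(1 - y)\<^sup>2 = 1 - x\<close>, with
  the iterates kept as polynomials in \<open>x\<close>. Since all coefficients, and those of the increments, are
  nonnegative, norms at an element of norm at most \<open>1\<close> are bounded by values at the number \<open>1\<close>.
\<close>

primrec sqrt_poly :: "nat \<Rightarrow> real poly" where
  "sqrt_poly 0 = 0"
| "sqrt_poly (Suc n) = smult (1/2) ([:0, 1:] + sqrt_poly n * sqrt_poly n)"

lemma nonneg_sqrt_poly: "nonneg_coeffs (sqrt_poly n)"
  by (induction n) (simp_all add: nonneg_coeffs_intros del: mult_pCons_left mult_pCons_right)

text \<open>
  By induction, because \<open>p\<^sup>2 - q\<^sup>2 = (p - q) (p + q)\<close> for consecutive iterates \<open>p\<close> and \<open>q\<close>.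
\<close>

lemma nonneg_sqrt_poly_step: "nonneg_coeffs (sqrt_poly (Suc n) - sqrt_poly n)"
proof (induction n)
  case 0
  show ?case using nonneg_sqrt_poly[of 1] by simp
next
  case (Suc n)
  have "sqrt_poly (Suc (Suc n)) - sqrt_poly (Suc n) =
      smult (1/2) ((sqrt_poly (Suc n) - sqrt_poly n) * (sqrt_poly (Suc n) + sqrt_poly n))"
    unfolding sqrt_poly.simps(2)[of "Suc n"] 
    by (subst (2) sqrt_poly.simps(2)) (simp only: smult_diff_right[symmetric], simp add: algebra_simps del: sqrt_poly.simps)
  then show ?case
    by (simp only:) (intro nonneg_coeffs_intros Suc nonneg_sqrt_poly, simp)
qed

lemma nonneg_sqrt_poly_diff: "m \<le> n \<Longrightarrow> nonneg_coeffs (sqrt_poly n - sqrt_poly m)"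
proof (induction n rule: dec_induct)
  case (step n)
  have "sqrt_poly (Suc n) - sqrt_poly m = (sqrt_poly (Suc n) - sqrt_poly n) + (sqrt_poly n - sqrt_poly m)"
    by simp
  then show ?case
    using nonneg_coeffs_intros(1)[OF nonneg_sqrt_poly_step step.IH] by metis
qed (simp add: nonneg_coeffs_intros)

lemma poly_1_nonneg: "nonneg_coeffs p \<Longrightarrow> poly p 1 \<ge> 0"
  by (simp add: poly_altdef nonneg_coeffs_def sum_nonneg)

lemma sqrt_poly_le_1: "poly (sqrt_poly n) 1 \<le> 1"
proof (induction n)
  case (Suc n)
  have "poly (sqrt_poly n) 1 * poly (sqrt_poly n) 1 \<le> 1 * 1"
    using Suc poly_1_nonneg[OF nonneg_sqrt_poly] by (intro mult_mono) auto
  then show ?case by simp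
qed simp

lemma sqrt_poly_1_Cauchy: "Cauchy (\<lambda>n. poly (sqrt_poly n) 1)"
proof -
  have "incseq (\<lambda>n. poly (sqrt_poly n) 1)"
    using poly_1_nonneg[OF nonneg_sqrt_poly_step] by (intro incseq_SucI) simp
  then have "convergent (\<lambda>n. poly (sqrt_poly n) 1)"
    using incseq_convergent[of _ 1] sqrt_poly_le_1 by (metis convergent_def)
  then show ?thesis by (rule convergent_Cauchy)
qed

lemma norm_poly_at_le:
  fixes b :: "'b::{real_normed_algebra, monoid_mult}"
  assumes "nonneg_coeffs p" "norm b \<le> 1" "norm (1::'b) \<le> 1"
  shows "norm (poly_at p b) \<le> poly p 1"
proof -
  have pow: "norm (b ^ i) \<le> 1" for i
  proof (induction i)
    case (Suc i)
    have "norm (b * b ^ i) \<le> norm b * norm (b ^ i)" by (rule norm_mult_ineq)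
    also have "\<dots> \<le> 1 * 1" using Suc assms by (intro mult_mono) auto
    finally show ?case by simp
  qed (use assms in simp)
  have "norm (poly_at p b) \<le> (\<Sum>i\<le>degree p. norm (coeff p i *\<^sub>R b ^ i))"
    unfolding poly_at_def by (rule norm_sum)
  also have "\<dots> \<le> (\<Sum>i\<le>degree p. coeff p i)"
    using assms(1) pow by (intro sum_mono) (simp add: nonneg_coeffs_def mult_left_le)
  also have "\<dots> = poly p 1"
    by (simp add: poly_altdef)
  finally show ?thesis .
qed

section \<open>Star-subalgebras of Banach algebras with the C*-identity\<close>

text \<open>
  A C*-algebra given as a closed subset of a Banach algebra, as the adjointable operators are among
  the bounded ones. The ambient algebra is real, and complex scalars enter only through \<open>J\<close>, which
  stands for multiplication by the imaginary unit.
\<close>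

locale cstar_subalgebra =
  fixes L :: "'b::{real_normed_algebra, monoid_mult, banach} set"
    and st :: "'b \<Rightarrow> 'b" and J :: 'b
  assumes closed_L: "closed L"
    and one_L [simp]: "1 \<in> L"
    and add_L [simp]: "a \<in> L \<Longrightarrow> b \<in> L \<Longrightarrow> a + b \<in> L"
    and mult_L [simp]: "a \<in> L \<Longrightarrow> b \<in> L \<Longrightarrow> a * b \<in> L"
    and scaleR_L [simp]: "a \<in> L \<Longrightarrow> r *\<^sub>R a \<in> L"
    and st_L [simp]: "a \<in> L \<Longrightarrow> st a \<in> L"
    and st_st [simp]: "a \<in> L \<Longrightarrow> st (st a) = a"
    and st_add [simp]: "a \<in> L \<Longrightarrow> b \<in> L \<Longrightarrow> st (a + b) = st a + st b"
    and st_mult [simp]: "a \<in> L \<Longrightarrow> b \<in> L \<Longrightarrow> st (a * b) = st b * st a"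
    and st_scaleR [simp]: "a \<in> L \<Longrightarrow> st (r *\<^sub>R a) = r *\<^sub>R st a"
    and cstar: "a \<in> L \<Longrightarrow> norm (st a * a) = (norm a)\<^sup>2"
    and J_L [simp]: "J \<in> L"
    and J_J: "J * J = - 1"
    and st_J [simp]: "st J = - J"
    and J_comm: "a \<in> L \<Longrightarrow> J * a = a * J"
begin

lemma zero_L [simp]: "0 \<in> L"
  using scaleR_L[OF one_L, of 0] by simp

lemma minus_L [simp]: "a \<in> L \<Longrightarrow> - a \<in> L"
  using scaleR_L[of a "-1"] by simp

lemma diff_L [simp]: "a \<in> L \<Longrightarrow> b \<in> L \<Longrightarrow> a - b \<in> L"
  using add_L[of a "- b"] by simp

lemma st_minus [simp]: "a \<in> L \<Longrightarrow> st (- a) = - st a"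
  using st_scaleR[of a "-1"] by simp

lemma st_diff [simp]: "a \<in> L \<Longrightarrow> b \<in> L \<Longrightarrow> st (a - b) = st a - st b"
  using st_add[of a "- b"] by simp

lemma st_0 [simp]: "st 0 = 0"
  using st_scaleR[of 1 0] by simp

lemma st_1 [simp]: "st 1 = 1"
  by (metis mult.right_neutral one_L st_L st_mult st_st)

lemma poly_at_L [simp]: "a \<in> L \<Longrightarrow> poly_at p a \<in> L"
  by (induction p) simp_all

lemma norm_1_le: "norm (1::'b) \<le> 1"
proof -
  have "norm (1::'b) = norm (1::'b) * norm (1::'b)"
    using cstar[OF one_L] by (simp add: power2_eq_square)
  then have "norm (1::'b) = 0 \<or> norm (1::'b) = 1" by algebra
  then show ?thesis by auto
qed

lemma norm_scaleR_1_le: "norm (t *\<^sub>R (1::'b)) \<le> \<bar>t\<bar>"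
  using norm_1_le mult_left_le by fastforce

lemma norm_st [simp]: assumes "a \<in> L" shows "norm (st a) = norm a"
proof -
  have le: "norm b \<le> norm (st b)" if "b \<in> L" for b
  proof (cases "norm b = 0")
    case False
    have "norm b * norm b \<le> norm (st b) * norm b"
      using cstar[OF that] norm_mult_ineq[of "st b" b] by (simp add: power2_eq_square)
    then show ?thesis using False by simp
  qed simp
  show ?thesis using le[OF assms] le[of "st a"] assms by simp
qed

lemma lim_L: "(\<And>n. X n \<in> L) \<Longrightarrow> X \<longlonglongrightarrow> a \<Longrightarrow> a \<in> L"
  using closed_L closed_sequentially by blast

lemma lim_st: assumes "\<And>n. X n \<in> L" "X \<longlonglongrightarrow> a" shows "(\<lambda>n. st (X n)) \<longlonglongrightarrow> st a"
proof -
  have "norm (st (X n) - st a) = norm (X n - a)" for n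
    using assms lim_L norm_st[of "X n - a"] by fastforce
  then show ?thesis
    using assms(2) by (simp add: tendsto_iff dist_norm)
qed

subsection \<open>Self-adjoint elements\<close>

definition selfadj :: "'b \<Rightarrow> bool" where
  "selfadj a \<longleftrightarrow> a \<in> L \<and> st a = a"

lemma selfadjI: "a \<in> L \<Longrightarrow> st a = a \<Longrightarrow> selfadj a"
  by (simp add: selfadj_def)

lemma selfadj_L [simp]: "selfadj a \<Longrightarrow> a \<in> L" and selfadj_st [simp]: "selfadj a \<Longrightarrow> st a = a"
  by (simp_all add: selfadj_def)

lemma selfadj_intros [simp]:
  "selfadj 0" "selfadj 1" "selfadj a \<Longrightarrow> selfadj b \<Longrightarrow> selfadj (a + b)" "selfadj a \<Longrightarrow> selfadj b \<Longrightarrow> selfadj (a - b)"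
  "selfadj a \<Longrightarrow> selfadj (- a)" "selfadj a \<Longrightarrow> selfadj (r *\<^sub>R a)" "a \<in> L \<Longrightarrow> selfadj (st a * a)" "a \<in> L \<Longrightarrow> selfadj (a * st a)"
  by (auto intro!: selfadjI)

lemma selfadj_mult: "selfadj a \<Longrightarrow> selfadj b \<Longrightarrow> a * b = b * a \<Longrightarrow> selfadj (a * b)"
  by (rule selfadjI) simp_all

lemma selfadj_square [simp]: "selfadj a \<Longrightarrow> selfadj (a * a)"
  by (simp add: selfadj_mult)

lemma selfadj_conj: "selfadj a \<Longrightarrow> b \<in> L \<Longrightarrow> selfadj (st b * a * b)"
  by (rule selfadjI) (simp_all add: mult.assoc)

lemma selfadj_poly_at [simp]: assumes "selfadj a" shows "selfadj (poly_at p a)"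
proof (induction p)
  case (pCons c p)
  then show ?case
    using assms poly_at_intertwine[of a a a p] by (simp add: selfadj_mult)
qed simp

lemma lim_selfadj: "(\<And>n. selfadj (X n)) \<Longrightarrow> X \<longlonglongrightarrow> a \<Longrightarrow> selfadj a"
proof (rule selfadjI)
  assume X: "\<And>n. selfadj (X n)" "X \<longlonglongrightarrow> a"
  show "a \<in> L" using X lim_L[of X a] by simp
  have "X \<longlonglongrightarrow> st a" using lim_st[of X a] X by simp
  then show "st a = a" using X(2) by (rule LIMSEQ_unique)
qed

lemma norm_selfadj_square: "selfadj a \<Longrightarrow> norm (a * a) = (norm a)\<^sup>2"
  using cstar[of a] by simp

text \<open>
  The iterates form a Cauchy sequence since the numbers \<open>poly (sqrt_poly n) 1\<close> do. The root is a
  limit of polynomials in \<open>x\<close> and so commutes with all that commutes with \<open>x\<close>; its distance to \<open>1\<close>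
  will show that it is itself positive.
\<close>

lemma sqrt_one_minus:
  assumes x: "selfadj x" "norm x \<le> 1"
  obtains w where "selfadj w" "w * w = 1 - x" "\<And>c. c * x = x * c \<Longrightarrow> c * w = w * c" "norm (1 - w) \<le> 1"
proof -
  define Y where "Y n = poly_at (sqrt_poly n) x" for n
  have dist_le: "norm (Y n - Y m) \<le> poly (sqrt_poly n) 1 - poly (sqrt_poly m) 1" if "m \<le> n" for m n
    using norm_poly_at_le[OF nonneg_sqrt_poly_diff[OF that] x(2) norm_1_le]
    by (simp add: Y_def poly_at_diff)
  have "Cauchy Y"
  proof (rule metric_CauchyI)
    fix e :: real assume "e > 0"
    then obtain M where M: "\<And>m n. m \<ge> M \<Longrightarrow> n \<ge> M \<Longrightarrow>
        dist (poly (sqrt_poly m) 1) (poly (sqrt_poly n) 1) < e"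
      using metric_CauchyD[OF sqrt_poly_1_Cauchy] by metis
    have "dist (Y m) (Y n) < e" if "m \<ge> M" "n \<ge> M" for m n
    proof (cases "m \<le> n")
      case True
      then show ?thesis using dist_le[OF True] M[OF that] by (simp add: dist_norm norm_minus_commute)
    next
      case False
      then have "n \<le> m" by simp
      then show ?thesis using dist_le[OF \<open>n \<le> m\<close>] M[OF that] by (simp add: dist_norm)
    qed
    then show "\<exists>M. \<forall>m\<ge>M. \<forall>n\<ge>M. dist (Y m) (Y n) < e" by blast
  qed
  then obtain y where y: "Y \<longlonglongrightarrow> y"
    using Cauchy_convergent convergent_def by blast
  have "Y (Suc n) = (1/2) *\<^sub>R (x + Y n * Y n)" for n
    by (simp add: Y_def poly_at_smult poly_at_add poly_at_mult scaleR_add_right)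
  then have "(\<lambda>n. (1/2) *\<^sub>R (x + Y n * Y n)) \<longlonglongrightarrow> y"
    using LIMSEQ_Suc[OF y] by simp
  moreover have "(\<lambda>n. (1/2) *\<^sub>R (x + Y n * Y n)) \<longlonglongrightarrow> (1/2) *\<^sub>R (x + y * y)"
    by (intro tendsto_intros y)
  ultimately have eq: "y = (1/2) *\<^sub>R (x + y * y)"
    by (rule LIMSEQ_unique)
  have "2 *\<^sub>R y = x + y * y"
    by (subst eq) simp
  then have yy: "y * y = 2 *\<^sub>R y - x" by (simp add: algebra_simps)
  show thesis
  proof (rule that[of "1 - y"])
    have "selfadj y" by (rule lim_selfadj[OF _ y]) (simp add: Y_def x)
    then show "selfadj (1 - y)" by simp
    show "(1 - y) * (1 - y) = 1 - x"
      using yy by (simp add: algebra_simps scaleR_2)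
    show "c * (1 - y) = (1 - y) * c" if "c * x = x * c" for c
    proof -
      have "(\<lambda>n. c * Y n) \<longlonglongrightarrow> c * y" "(\<lambda>n. Y n * c) \<longlonglongrightarrow> y * c"
        by (intro tendsto_intros y)+
      moreover have "c * Y n = Y n * c" for n
        unfolding Y_def by (rule poly_at_intertwine[OF that])
      ultimately have "c * y = y * c"
        using LIMSEQ_unique by fastforce
      then show ?thesis by (simp add: algebra_simps)
    qed
    have "norm (Y n) \<le> 1" for n
      using norm_poly_at_le[OF nonneg_sqrt_poly x(2) norm_1_le, of n] sqrt_poly_le_1[of n]
      by (simp add: Y_def)
    then have "norm y \<le> 1"
      using Lim_bounded[OF tendsto_norm[OF y]] by blast
    then show "norm (1 - (1 - y)) \<le> 1" by simp
  qed
qed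

text \<open>
  The element \<open>c = a + J b\<close> satisfies \<open>c\<^sup>* c = a\<^sup>2 + b\<^sup>2\<close>, and the norm of its self-adjoint part \<open>a\<close> is
  at most \<open>\<parallel>c\<parallel> = \<parallel>c\<^sup>*\<parallel>\<close>.
\<close>

lemma arens:
  assumes "selfadj a" "selfadj b" "a * b = b * a"
  shows "norm (a * a) \<le> norm (a * a + b * b)"
proof -
  define c where "c = a + J * b"
  have L: "c \<in> L" using assms by (simp add: c_def)
  have sc: "st c = a - J * b" using assms J_comm[of b] by (simp add: c_def)
  have "a * (J * b) = J * b * a"
    using assms J_comm[of a] by (metis mult.assoc selfadj_L)
  moreover have "J * b * (J * b) = - (b * b)"
  proof -
    have "J * b * (J * b) = J * (b * J) * b" by (simp add: mult.assoc)
    also have "\<dots> = J * J * b * b" using J_comm[of b] assms by (simp add: mult.assoc)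
    finally show ?thesis by (simp add: J_J)
  qed
  ultimately have "st c * c = a * a + b * b"
    unfolding sc by (simp add: c_def algebra_simps mult.assoc)
  then have n: "norm (a * a + b * b) = (norm c)\<^sup>2" using cstar[OF L] by simp
  have "2 *\<^sub>R a = c + st c" unfolding sc by (simp add: c_def scaleR_2)
  then have "2 * norm a \<le> norm c + norm c"
    using norm_triangle_ineq[of c "st c"] norm_st[OF L] by (metis abs_numeral norm_scaleR)
  then have "(norm a)\<^sup>2 \<le> (norm c)\<^sup>2" by (intro power_mono) auto
  then show ?thesis using n norm_selfadj_square[OF assms(1)] by simp
qed


subsection \<open>Positive elements\<close>

text \<open>
  The definition by squares makes positivity accessible without spectral theory; agreement with
  nonnegativity of the spectrum is \<open>pos_iff_rspec\<close> below.
\<close>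

definition pos :: "'b \<Rightarrow> bool" where
  "pos a \<longleftrightarrow> (\<exists>y. selfadj y \<and> a = y * y)"

lemma pos_selfadj [simp]: "pos a \<Longrightarrow> selfadj a"
  by (auto simp: pos_def)

lemma pos_square: "selfadj y \<Longrightarrow> pos (y * y)"
  by (auto simp: pos_def)

lemma pos_0 [simp]: "pos 0" and pos_1 [simp]: "pos 1"
  using pos_square[of 0] pos_square[of 1] by simp_all

lemma pos_scaleR: assumes "pos a" "r \<ge> 0" shows "pos (r *\<^sub>R a)"
proof -
  obtain y where y: "selfadj y" "a = y * y" using assms by (auto simp: pos_def)
  have "r *\<^sub>R a = (sqrt r *\<^sub>R y) * (sqrt r *\<^sub>R y)" using y assms by simp
  then show ?thesis using y by (metis pos_square selfadj_intros(6))
qed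

text \<open>
  The norm condition says \<open>a = t (1 - x)\<close> with \<open>\<parallel>x\<parallel> \<le> 1\<close>, and \<open>1 - x\<close> has a root.
\<close>

lemma near_scalar_root:
  assumes a: "selfadj a" and t: "t > 0" and le: "norm (t *\<^sub>R 1 - a) \<le> t"
  obtains z where "selfadj z" "z * z = a" "\<And>c. c * a = a * c \<Longrightarrow> c * z = z * c"
    "norm (sqrt t *\<^sub>R 1 - z) \<le> sqrt t"
proof -
  define x where "x = 1 - (1/t) *\<^sub>R a"
  have "x = (1/t) *\<^sub>R (t *\<^sub>R 1 - a)" using t by (simp add: x_def scaleR_diff_right)
  then have "norm x = norm (t *\<^sub>R 1 - a) / t" using t by simp
  then have nx: "norm x \<le> 1" using t le by simp
  have sx: "selfadj x" using a by (simp add: x_def)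
  obtain w where w: "selfadj w" "w * w = 1 - x" "\<And>c. c * x = x * c \<Longrightarrow> c * w = w * c" "norm (1 - w) \<le> 1"
    using sqrt_one_minus[OF sx nx] by blast
  show thesis
  proof (rule that[of "sqrt t *\<^sub>R w"])
    show "selfadj (sqrt t *\<^sub>R w)" using w(1) by simp
    show "(sqrt t *\<^sub>R w) * (sqrt t *\<^sub>R w) = a" using t w(2) by (simp add: x_def)
    show "c * (sqrt t *\<^sub>R w) = (sqrt t *\<^sub>R w) * c" if "c * a = a * c" for c
    proof -
      have "c * x = x * c" using that by (simp add: x_def algebra_simps)
      then show ?thesis using w(3)[of c] by simp
    qed
    have "sqrt t *\<^sub>R 1 - sqrt t *\<^sub>R w = sqrt t *\<^sub>R (1 - w)" by (simp add: scaleR_diff_right)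
    then show "norm (sqrt t *\<^sub>R 1 - sqrt t *\<^sub>R w) \<le> sqrt t"
      using w(4) t by (simp add: mult_left_le)
  qed
qed

lemma near_scalar_pos:
  assumes "selfadj a" "norm (t *\<^sub>R 1 - a) \<le> t" shows "pos a"
proof (cases "t = 0")
  case True
  then show ?thesis using assms by simp
next
  case False
  then have "t > 0" using assms(2) norm_ge_zero[of "t *\<^sub>R 1 - a"] by linarith
  then show ?thesis using near_scalar_root[OF assms(1) _ assms(2)] pos_square by metis
qed

text \<open>
  Converse to \<open>near_scalar_pos\<close>. Scaling gives \<open>a / t = u\<^sup>2\<close> with \<open>\<parallel>u\<^sup>2\<parallel> \<le> 1\<close>, and the root \<open>w\<close> of
  \<open>1 - u\<^sup>2\<close> commutes with \<open>u\<close>, so that \<open>\<parallel>w\<^sup>2\<parallel> \<le> \<parallel>w\<^sup>2 + u\<^sup>2\<parallel> = \<parallel>1\<parallel>\<close>.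
\<close>

lemma pos_near_scalar:
  assumes "pos a" "norm a \<le> t" shows "norm (t *\<^sub>R 1 - a) \<le> t"
proof (cases "t = 0")
  case True
  then show ?thesis using assms by simp
next
  case False
  then have t: "t > 0" using assms(2) norm_ge_zero[of a] by linarith
  obtain y where y: "selfadj y" "a = y * y" using assms by (auto simp: pos_def)
  define u where "u = (1 / sqrt t) *\<^sub>R y"
  have u: "selfadj u" "u * u = (1/t) *\<^sub>R a" using y t by (simp_all add: u_def)
  have uu: "selfadj (u * u)" using u(1) by simp
  have "norm (u * u) = norm a / t" using u(2) t by simp
  then have uu2: "norm (u * u) \<le> 1" using assms(2) t by simp
  obtain w where w: "selfadj w" "w * w = 1 - u * u" "\<And>c. c * (u * u) = (u * u) * c \<Longrightarrow> c * w = w * c"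
    using sqrt_one_minus[OF uu uu2] by blast
  have "w * u = u * w" using w(3)[of u] by (simp add: mult.assoc)
  then have "norm (w * w) \<le> norm (w * w + u * u)" using arens[OF w(1) u(1)] by simp
  then have *: "norm (w * w) \<le> 1" using w(2) norm_1_le by simp
  have "t *\<^sub>R 1 - a = t *\<^sub>R (w * w)" using w(2) u(2) t by (simp add: scaleR_diff_right)
  then show ?thesis using * t by (simp add: mult_left_le)
qed

lemma pos_root:
  assumes "pos a"
  obtains z where "pos z" "z * z = a" "\<And>c. c * a = a * c \<Longrightarrow> c * z = z * c"
proof -
  \<comment> \<open>Adding \<open>1\<close> keeps the scalar strictly positive when \<open>a = 0\<close>.\<close>
  have "norm ((norm a + 1) *\<^sub>R 1 - a) \<le> norm a + 1"
    by (rule pos_near_scalar[OF assms]) simp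
  moreover have "norm a + 1 > 0" by (simp add: add_nonneg_pos)
  ultimately show thesis
    using near_scalar_root[of a "norm a + 1"] near_scalar_pos assms that by (metis pos_selfadj)
qed

text \<open>
  The norm criterion reduces the sum of two squares, which need not commute, to the triangle
  inequality.
\<close>

lemma pos_add: assumes "pos a" "pos b" shows "pos (a + b)"
proof (rule near_scalar_pos)
  show "selfadj (a + b)" using assms by simp
  have "(norm a + norm b) *\<^sub>R 1 - (a + b) = (norm a *\<^sub>R 1 - a) + (norm b *\<^sub>R 1 - b)"
    by (simp add: algebra_simps)
  then have "norm ((norm a + norm b) *\<^sub>R 1 - (a + b))
      = norm ((norm a *\<^sub>R 1 - a) + (norm b *\<^sub>R 1 - b))" by (rule arg_cong)
  then show "norm ((norm a + norm b) *\<^sub>R 1 - (a + b)) \<le> norm a + norm b"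
    using pos_near_scalar[OF assms(1) order.refl] pos_near_scalar[OF assms(2) order.refl]
      norm_triangle_ineq[of "norm a *\<^sub>R 1 - a" "norm b *\<^sub>R 1 - b"] by linarith
qed

lemma lim_pos: assumes "\<And>n. pos (X n)" "X \<longlonglongrightarrow> a" shows "pos a"
proof -
  obtain K where K: "\<And>n. norm (X n) \<le> K"
    using convergent_imp_Bseq[of X] assms(2) by (auto simp: convergent_def Bseq_def)
  have "norm (K *\<^sub>R 1 - X n) \<le> K" for n
    by (rule pos_near_scalar[OF assms(1) K])
  moreover have "(\<lambda>n. norm (K *\<^sub>R 1 - X n)) \<longlonglongrightarrow> norm (K *\<^sub>R 1 - a)"
    by (intro tendsto_intros assms(2))
  ultimately have "norm (K *\<^sub>R 1 - a) \<le> K"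
    by (meson Lim_bounded)
  moreover have "selfadj a" using lim_selfadj[OF _ assms(2)] assms(1) by simp
  ultimately show ?thesis by (metis near_scalar_pos)
qed

lemma pos_mult: assumes "pos a" "pos b" "a * b = b * a" shows "pos (a * b)"
proof -
  obtain z where z: "pos z" "z * z = a" "\<And>c. c * a = a * c \<Longrightarrow> c * z = z * c"
    using pos_root[OF assms(1)] by metis
  obtain w where w: "pos w" "w * w = b" "\<And>c. c * b = b * c \<Longrightarrow> c * w = w * c"
    using pos_root[OF assms(2)] by metis
  have "b * z = z * b" using z(3)[of b] assms(3) by simp
  then have zw: "z * w = w * z" using w(3)[of z] by simp
  then have "a * b = (z * w) * (z * w)"
    unfolding z(2)[symmetric] w(2)[symmetric] by (metis mult.assoc)
  then show ?thesis using z(1) w(1) zw by (metis pos_square pos_selfadj selfadj_mult)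
qed

lemma scalar_minus_pos: assumes "selfadj a" "norm a \<le> t" shows "pos (t *\<^sub>R 1 - a)"
  by (rule near_scalar_pos[of _ t]) (use assms in simp_all)

lemma commuting_pos_norm_le:
  assumes "pos a" "pos b" "a * b = b * a" shows "norm a \<le> norm (a + b)"
proof -
  obtain z where z: "pos z" "z * z = a" "\<And>c. c * a = a * c \<Longrightarrow> c * z = z * c"
    using pos_root[OF assms(1)] by metis
  obtain w where w: "pos w" "w * w = b" "\<And>c. c * b = b * c \<Longrightarrow> c * w = w * c"
    using pos_root[OF assms(2)] by metis
  have "b * z = z * b" using z(3)[of b] assms(3) by simp
  then have zw: "z * w = w * z" using w(3)[of z] by simp
  show ?thesis using arens[of z w] z(1,2) w(1,2) zw by simp
qed

lemma pos_norm_le_scalar: assumes "pos a" "pos (t *\<^sub>R 1 - a)" "t \<ge> 0" shows "norm a \<le> t"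
proof -
  have "norm a \<le> norm (a + (t *\<^sub>R 1 - a))"
    by (rule commuting_pos_norm_le) (simp_all add: assms algebra_simps)
  also have "\<dots> \<le> t" using norm_scaleR_1_le[of t] assms(3) by simp
  finally show ?thesis .
qed

text \<open>
  Adding \<open>\<parallel>b\<parallel> - b \<ge> 0\<close> to \<open>b - a\<close> replaces \<open>b\<close> by a scalar, which commutes with \<open>a\<close>.
\<close>

lemma pos_mono_norm: assumes "pos a" "pos (b - a)" shows "norm a \<le> norm b"
proof (rule pos_norm_le_scalar[OF assms(1)])
  have "selfadj b" using selfadj_intros(3)[of "b - a" a] assms by simp
  then have "pos (norm b *\<^sub>R 1 - b)" by (rule scalar_minus_pos) simp
  then have "pos ((norm b *\<^sub>R 1 - b) + (b - a))" using assms by (intro pos_add)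
  then show "pos (norm b *\<^sub>R 1 - a)" by simp
qed simp

subsection \<open>Invertibility\<close>

definition invertible_in :: "'b \<Rightarrow> bool" where
  "invertible_in a \<longleftrightarrow> (\<exists>r\<in>L. r * a = 1 \<and> a * r = 1)"

lemma inverse_comm: assumes "r * a = 1" "a * r = 1" "c * a = a * c" shows "c * r = r * (c::'b)"
proof -
  have "c * r = (r * a) * (c * r)" by (simp only: assms mult_1_left)
  also have "\<dots> = r * (c * a) * r" by (simp only: assms(3) mult.assoc)
  also have "\<dots> = r * c" using assms(2) by (simp add: mult.assoc)
  finally show ?thesis .
qed

lemma neumann: assumes "x \<in> L" "norm x < 1" shows "invertible_in (1 - x)"
proof -
  have pow: "norm (x ^ n) \<le> norm x ^ n" for n
  proof (induction n)
    case (Suc n)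
    have "norm (x * x ^ n) \<le> norm x * norm (x ^ n)" by (rule norm_mult_ineq)
    also have "\<dots> \<le> norm x * norm x ^ n" using Suc by (intro mult_left_mono) auto
    finally show ?case by simp
  qed (use norm_1_le in simp)
  have sm: "summable (\<lambda>n. x ^ n)"
    using summable_comparison_test'[of "\<lambda>n. norm x ^ n" 0 "\<lambda>n. x ^ n"] assms(2) pow
    by (simp add: summable_geometric)
  define r where "r = (\<Sum>n. x ^ n)"
  have xL: "x ^ n \<in> L" for n by (induction n) (simp_all add: assms)
  have "(\<Sum>i<n. x ^ i) \<in> L" for n by (induction n) (simp_all add: xL)
  then have rL: "r \<in> L"
    using lim_L[OF _ summable_LIMSEQ[OF sm]] by (simp add: r_def)
  have r1: "r = 1 + (\<Sum>n. x ^ Suc n)"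
    unfolding r_def using suminf_split_head[OF sm] by simp
  have "x * r = (\<Sum>n. x * x ^ n)"
    unfolding r_def using sm by (rule bounded_linear.suminf[OF bounded_linear_mult_right])
  then have a: "x * r = r - 1" using r1 by simp
  have "r * x = (\<Sum>n. x ^ n * x)"
    unfolding r_def using sm by (rule bounded_linear.suminf[OF bounded_linear_mult_left])
  then have b: "r * x = r - 1" using r1 by (simp add: power_commutes)
  show ?thesis
    unfolding invertible_in_def using rL a b by (intro bexI[of _ r]) (simp_all add: algebra_simps)
qed

lemma invertible_scaleR: assumes "invertible_in a" "t \<noteq> 0" shows "invertible_in (t *\<^sub>R a)"
proof -
  obtain r where "r \<in> L" "r * a = 1" "a * r = 1" using assms(1) by (auto simp: invertible_in_def)
  then show ?thesis
    unfolding invertible_in_def using assms(2) by (intro bexI[of _ "(1/t) *\<^sub>R r"]) simp_all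
qed

lemma invertible_mult: assumes "invertible_in a" "invertible_in b" shows "invertible_in (a * b)"
proof -
  obtain r where r: "r \<in> L" "r * a = 1" "a * r = 1" using assms(1) by (auto simp: invertible_in_def)
  obtain q where q: "q \<in> L" "q * b = 1" "b * q = 1" using assms(2) by (auto simp: invertible_in_def)
  have "(q * r) * (a * b) = q * (r * a) * b" "(a * b) * (q * r) = a * (b * q) * r"
    by (simp_all add: mult.assoc)
  then show ?thesis
    unfolding invertible_in_def using r q by (intro bexI[of _ "q * r"]) simp_all
qed

lemma invertible_factor:
  assumes "invertible_in (a * b)" "a * b = b * a" "a \<in> L" "b \<in> L" shows "invertible_in a"
proof -
  obtain r where r: "r \<in> L" "r * (a * b) = 1" "(a * b) * r = 1"
    using assms(1) by (auto simp: invertible_in_def)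
  have 1: "a * (b * r) = 1" using r by (simp add: mult.assoc)
  have 2: "(r * b) * a = 1" using r assms(2) by (simp add: mult.assoc)
  have "r * b = (r * b) * (a * (b * r))" using 1 by simp
  also have "\<dots> = b * r" using 2 by (simp add: mult.assoc[symmetric])
  finally show ?thesis
    unfolding invertible_in_def using r 1 2 assms by (intro bexI[of _ "b * r"]) simp_all
qed

lemma inverse_selfadj: assumes "selfadj a" "r \<in> L" "r * a = 1" "a * r = 1" shows "selfadj r"
proof (rule selfadjI)
  have "a * st r = 1" using assms st_mult[of r a] by simp
  then have "st r = r * a * st r" using assms by simp
  also have "\<dots> = r" using \<open>a * st r = 1\<close> by (simp add: mult.assoc)
  finally show "st r = r" .
qed (use assms in simp)

lemma inverse_pos: assumes "pos a" "r \<in> L" "r * a = 1" "a * r = 1" shows "pos r"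
proof -
  obtain w where w: "pos w" "w * w = a" "\<And>c. c * a = a * c \<Longrightarrow> c * w = w * c"
    using pos_root[OF assms(1)] by metis
  have sr: "selfadj r" by (rule inverse_selfadj[OF pos_selfadj[OF assms(1)] assms(2-4)])
  have wr: "w * r = r * w" using w(3)[of r] assms by simp
  have "(r * w) * (r * w) = r * (w * r) * w" by (simp add: mult.assoc)
  also have "\<dots> = r * (r * (w * w))" unfolding wr by (simp add: mult.assoc)
  also have "\<dots> = r" using w(2) assms by simp
  finally show ?thesis using pos_square[of "r * w"] selfadj_mult[of r w] sr w(1) wr by simp
qed

lemma pos_add_scalar_invertible:
  assumes "pos a" "e > 0" shows "invertible_in (e *\<^sub>R 1 + a)"
proof -
  define t where "t = e + norm a"
  have t: "t > 0" using assms by (simp add: t_def add_pos_nonneg)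
  define x where "x = (1/t) *\<^sub>R (norm a *\<^sub>R 1 - a)"
  have "norm x \<le> norm a / t"
    using pos_near_scalar[OF assms(1) order.refl] t by (simp add: x_def divide_right_mono)
  also have "\<dots> < 1" using t assms by (simp add: t_def)
  finally have "invertible_in (1 - x)" using assms by (intro neumann) (simp_all add: x_def)
  then have "invertible_in (t *\<^sub>R (1 - x))" using t by (intro invertible_scaleR) auto
  moreover have "t *\<^sub>R (1 - x) = e *\<^sub>R 1 + a"
    using t by (simp add: x_def scaleR_diff_right) (simp add: t_def scaleR_left_distrib)
  ultimately show ?thesis by simp
qed

text \<open>
  The norm of a positive element lies in its spectrum. If \<open>d = \<parallel>p\<parallel> - p\<close> had an inverse \<open>r\<close>, then
  \<open>r \<le> \<parallel>r\<parallel>\<close> would give \<open>1 \<le> \<parallel>r\<parallel> d\<close>, that is \<open>p \<le> \<parallel>p\<parallel> - 1 / \<parallel>r\<parallel>\<close>, which is too small a bound.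
\<close>

lemma pos_norm_minus_not_invertible:
  assumes "pos p" "p \<noteq> 0" shows "\<not> invertible_in (norm p *\<^sub>R 1 - p)"
proof
  define d where "d = norm p *\<^sub>R 1 - p"
  assume "invertible_in (norm p *\<^sub>R 1 - p)"
  then obtain r where r: "r \<in> L" "r * d = 1" "d * r = 1"
    by (auto simp: invertible_in_def d_def)
  have pd: "pos d" unfolding d_def using assms by (intro scalar_minus_pos) simp_all
  have pr: "pos r" using inverse_pos[OF pd] r by simp
  \<comment> \<open>The unit has norm \<open>0\<close> or \<open>1\<close>, and \<open>0\<close> would make the algebra trivial.\<close>
  have n1: "norm (1::'b) = 1"
  proof -
    have "norm (1::'b) = norm (1::'b) * norm (1::'b)"
      using cstar[OF one_L] by (simp add: power2_eq_square)
    moreover have "norm (1::'b) \<noteq> 0"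
      using assms(2) by (metis mult.right_neutral mult_zero_right norm_eq_zero)
    ultimately show ?thesis by simp
  qed
  have nd: "norm d \<le> norm p"
    unfolding d_def using assms(1) by (intro pos_near_scalar) simp_all
  have "1 \<le> norm r * norm d" using norm_mult_ineq[of r d] r n1 by simp
  also have "\<dots> \<le> norm r * norm p" using nd by (intro mult_left_mono) auto
  finally have rp: "1 \<le> norm r * norm p" .
  then have r0: "norm r > 0" by (metis mult_zero_left not_one_le_zero zero_less_norm_iff norm_zero)
  have "pos (d * (norm r *\<^sub>R 1 - r))"
  proof (rule pos_mult[OF pd])
    show "pos (norm r *\<^sub>R 1 - r)" using pr by (intro scalar_minus_pos) simp_all
    show "d * (norm r *\<^sub>R 1 - r) = (norm r *\<^sub>R 1 - r) * d" using r by (simp add: algebra_simps)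
  qed
  then have "pos ((1 / norm r) *\<^sub>R (d * (norm r *\<^sub>R 1 - r)))"
    by (intro pos_scaleR) simp_all
  moreover have "(1 / norm r) *\<^sub>R (d * (norm r *\<^sub>R 1 - r)) = (norm p - 1 / norm r) *\<^sub>R 1 - p"
    using r r0 by (simp add: d_def algebra_simps)
  ultimately have "pos ((norm p - 1 / norm r) *\<^sub>R 1 - p)" by simp
  moreover have "norm p - 1 / norm r \<ge> 0" using rp r0 by (simp add: field_simps)
  ultimately have "norm p \<le> norm p - 1 / norm r" using assms(1) by (intro pos_norm_le_scalar)
  then show False using r0 by simp
qed

subsection \<open>Absolute values, and elements with nonnegative spectrum\<close>

text \<open>
  For \<open>e > 0\<close> the quotient \<open>v = s (m + e)\<^bsup>-1\<^esup>\<close> satisfies \<open>v\<^sup>2 \<le> 1\<close>, hence \<open>\<parallel>v\<parallel> \<le> 1\<close> and \<open>1 - v \<ge> 0\<close>.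
  Multiplying by \<open>m + e\<close> gives \<open>m + e - s \<ge> 0\<close>, and \<open>e\<close> tends to \<open>0\<close>.
\<close>

lemma abs_minus_pos:
  assumes s: "selfadj s" and m: "pos m" "m * m = s * s" "m * s = s * m"
  shows "pos (m - s)"
proof -
  have *: "pos (m + e *\<^sub>R 1 - s)" if e: "e > 0" for e
  proof -
    define d where "d = e *\<^sub>R 1 + m"
    have pd: "pos d" unfolding d_def using e m by (intro pos_add pos_scaleR) simp_all
    obtain r where r: "r \<in> L" "r * d = 1" "d * r = 1"
      using pos_add_scalar_invertible[OF m(1) e] by (auto simp: invertible_in_def d_def)
    have pr: "pos r" using inverse_pos[OF pd] r by simp
    have sd: "s * d = d * s" using m(3) by (simp add: d_def algebra_simps)
    have md: "m * d = d * m" by (simp add: d_def algebra_simps)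
    have sr: "s * r = r * s" by (rule inverse_comm[OF r(2,3) sd])
    have mr: "m * r = r * m" by (rule inverse_comm[OF r(2,3) md])
    define v where "v = s * r"
    have sv: "selfadj v" unfolding v_def using s pr sr by (intro selfadj_mult) simp_all
    have vv: "v * v = s * s * (r * r)" unfolding v_def using sr by (metis mult.assoc)
    have "d * d * (r * r) = d * (d * r) * r" by (simp add: mult.assoc)
    then have dr: "d * d * (r * r) = 1" using r by simp
    have q: "d * d - s * s = (2 * e) *\<^sub>R m + (e * e) *\<^sub>R 1"
      using m(2) scaleR_left_distrib[of e e m] by (simp add: d_def distrib_left distrib_right scaleR_right_distrib)
    have "pos ((d * d - s * s) * (r * r))"
    proof (rule pos_mult)
      show "pos (d * d - s * s)" unfolding q using e m by (intro pos_add pos_scaleR) simp_all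
      show "pos (r * r)" using pr by (simp add: pos_square)
      have "m * (r * r) = r * r * m" by (metis mr mult.assoc)
      then show "(d * d - s * s) * (r * r) = r * r * (d * d - s * s)"
        unfolding q by (simp add: distrib_left distrib_right)
    qed
    then have "pos (1 *\<^sub>R 1 - v * v)" using vv dr by (simp add: left_diff_distrib)
    then have "norm (v * v) \<le> 1" using sv by (intro pos_norm_le_scalar) (simp_all add: pos_square)
    then have "(norm v)\<^sup>2 \<le> 1" using norm_selfadj_square[OF sv] by simp
    then have "norm v \<le> 1" by (simp add: power_le_one_iff abs_square_le_1)
    then have "pos (1 *\<^sub>R 1 - v)" using sv by (intro scalar_minus_pos)
    moreover have "d * v = s * (d * r)" unfolding v_def using sd by (metis mult.assoc)
    then have dv: "d * v = s" "v * d = s" unfolding v_def using r by (simp_all add: mult.assoc)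
    ultimately have "pos (d * (1 - v))" using pd by (intro pos_mult) (simp_all add: algebra_simps)
    then show ?thesis using dv by (simp add: right_diff_distrib d_def add.commute)
  qed
  have "(\<lambda>n. m + (1 / real (Suc n)) *\<^sub>R 1 - s) \<longlonglongrightarrow> m + 0 *\<^sub>R 1 - s"
    by (intro tendsto_intros LIMSEQ_Suc[OF lim_1_over_n])
  then show ?thesis
    using lim_pos[of "\<lambda>n. m + (1 / real (Suc n)) *\<^sub>R 1 - s"] * by simp
qed

lemma selfadj_abs:
  assumes "selfadj s"
  obtains m where "pos m" "m * m = s * s" "pos (m - s)" "pos (m + s)" "\<And>c. c * s = s * c \<Longrightarrow> c * m = m * c"
proof -
  obtain m where m: "pos m" "m * m = s * s" "\<And>c. c * (s * s) = s * s * c \<Longrightarrow> c * m = m * c"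
    using pos_root[OF pos_square[OF assms]] by metis
  have c: "c * m = m * c" if "c * s = s * c" for c
    by (rule m(3)) (metis that mult.assoc)
  have "m * s = s * m" using c[of s] by simp
  then have "pos (m - s)" using assms m(1,2) by (intro abs_minus_pos)
  moreover have "pos (m - (- s))"
    using assms m(1,2) \<open>m * s = s * m\<close> by (intro abs_minus_pos) simp_all
  ultimately show thesis using that[OF m(1,2) _ _ c] by simp
qed

text \<open>
  Split \<open>s = p - n\<close> into positive and negative part. As \<open>n p = 0\<close>, the product of \<open>\<parallel>n\<parallel> - n\<close> and
  \<open>\<parallel>n\<parallel> + p\<close> is \<open>\<parallel>n\<parallel> (\<parallel>n\<parallel> + s)\<close>, invertible if \<open>n \<noteq> 0\<close>; but \<open>\<parallel>n\<parallel> - n\<close> is not.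
\<close>

lemma selfadj_invertible_imp_pos:
  assumes s: "selfadj s" and inv: "\<And>e. e > 0 \<Longrightarrow> invertible_in (e *\<^sub>R 1 + s)"
  shows "pos s"
proof -
  obtain m where m: "pos m" "m * m = s * s" "pos (m - s)" "pos (m + s)"
    "\<And>c. c * s = s * c \<Longrightarrow> c * m = m * c"
    using selfadj_abs[OF s] by metis
  have ms: "m * s = s * m" using m(5)[of s] by simp
  define n where "n = (1/2) *\<^sub>R (m - s)"
  define p where "p = (1/2) *\<^sub>R (m + s)"
  have "n = 0"
  proof (rule ccontr)
    assume n0: "n \<noteq> 0"
    have "norm n > 0" using n0 by simp
    then have "invertible_in (norm n *\<^sub>R (norm n *\<^sub>R 1 + s))"
      by (intro invertible_scaleR inv) auto
    moreover have "(m - s) * (m + s) = 0" using m(2) ms by (simp add: algebra_simps)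
    then have "n * p = 0" by (simp add: n_def p_def)
    have "(m + s) * (m - s) = 0" using m(2) ms by (simp add: algebra_simps)
    then have "p * n = 0" by (simp add: n_def p_def)
    have "p - n = s" 
      by (simp add: n_def p_def algebra_simps) (metis scaleR_half_double scaleR_right_distrib)
    then have eq: "(norm n *\<^sub>R 1 - n) * (norm n *\<^sub>R 1 + p) = norm n *\<^sub>R (norm n *\<^sub>R 1 + s)"
      "(norm n *\<^sub>R 1 + p) * (norm n *\<^sub>R 1 - n) = norm n *\<^sub>R (norm n *\<^sub>R 1 + s)"
      using \<open>n * p = 0\<close> \<open>p * n = 0\<close> by (auto simp: algebra_simps)
    moreover have "n \<in> L" "p \<in> L" using m(1) s by (simp_all add: n_def p_def)
    ultimately have "invertible_in (norm n *\<^sub>R 1 - n)"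
      using invertible_factor[of "norm n *\<^sub>R 1 - n" "norm n *\<^sub>R 1 + p"] by simp
    moreover have "pos n" unfolding n_def using m(3) by (intro pos_scaleR) simp_all
    ultimately show False using pos_norm_minus_not_invertible n0 by blast
  qed
  then have "m = s" by (simp add: n_def)
  then show ?thesis using m(1) by simp
qed

subsection \<open>Kaplansky's theorem\<close>

text \<open>
  Let \<open>n\<close> be twice the negative part of \<open>s = t\<^sup>* t\<close> and \<open>R = t n\<close>. Then \<open>R\<^sup>* R = n s n = - q\<^sup>2\<close> with \<open>q\<close>
  self-adjoint, while \<open>R\<^sup>* R + R R\<^sup>*\<close> is half the sum of the squares of \<open>a = R + R\<^sup>*\<close> and
  \<open>b = J (R - R\<^sup>*)\<close>, so that \<open>R R\<^sup>*\<close> is positive. As \<open>R R\<^sup>*\<close> and \<open>R\<^sup>* R\<close> have the same nonzero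
  spectrum, \<open>e + R\<^sup>* R = e - q\<^sup>2\<close> is invertible for every \<open>e > 0\<close>; for \<open>e = \<parallel>q\<^sup>2\<parallel>\<close> this
  leaves only \<open>q\<^sup>2 = 0\<close>.
\<close>

lemma pos_star_mult: assumes t: "t \<in> L" shows "pos (st t * t)"
proof -
  define s where "s = st t * t"
  have s: "selfadj s" using t by (simp add: s_def)
  obtain m where m: "pos m" "m * m = s * s" "pos (m - s)" "pos (m + s)"
    "\<And>c. c * s = s * c \<Longrightarrow> c * m = m * c"
    using selfadj_abs[OF s] by metis
  have ms: "m * s = s * m" using m(5)[of s] by simp
  define n where "n = m - s"
  have n: "selfadj n" using m(3) by (simp add: n_def)
  have mn: "m * n = n * m" using ms by (simp add: n_def algebra_simps)
  have sn: "s * n = - (m * n)" using m(2) ms by (simp add: n_def algebra_simps)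
  obtain w where w: "pos w" "w * w = m" "\<And>c. c * m = m * c \<Longrightarrow> c * w = w * c"
    using pos_root[OF m(1)] by metis
  define q where "q = w * n"
  have wn: "w * n = n * w" using w(3)[of n] mn by simp
  have sq: "selfadj q" unfolding q_def using wn w(1) n by (intro selfadj_mult) simp_all
  define R where "R = t * n"
  have RL: "R \<in> L" using t n by (simp add: R_def)
  have "q * q = m * (n * n)"
    unfolding q_def w(2)[symmetric] using wn by (metis mult.assoc)
  moreover have "st R * R = n * (s * n)" using t n by (simp add: R_def s_def mult.assoc)
  ultimately have RR: "st R * R = - (q * q)" using sn mn by (metis mult.assoc mult_minus_right)
  define a where "a = R + st R"
  define b where "b = J * (R - st R)"
  have selfadj_a: "selfadj a" and selfadj_b: "selfadj b"
    using RL J_comm[of "R - st R"]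
    by (auto intro!: selfadjI simp: a_def b_def algebra_simps)
  have "b * b = J * J * ((R - st R) * (R - st R))"
    using J_comm[of "R - st R"] RL by (simp add: b_def mult.assoc) (metis mult.assoc)
  then have "b * b = - ((R - st R) * (R - st R))" by (simp add: J_J)
  then have "a * a + b * b = 2 *\<^sub>R (R * st R + st R * R)"
    by (simp add: a_def algebra_simps scaleR_2)
  then have "R * st R = (1/2) *\<^sub>R (a * a + b * b) + q * q" using RR by simp
  then have pRR: "pos (R * st R)"
    using selfadj_a selfadj_b sq by (auto intro!: pos_add pos_scaleR pos_square)
  have "q * q = 0"
  proof (rule ccontr)
    assume q0: "q * q \<noteq> 0"
    define e where "e = norm (q * q)"
    have e: "e > 0" using q0 by (simp add: e_def)
    obtain r where r: "r \<in> L" "r * (e *\<^sub>R 1 + R * st R) = 1" "(e *\<^sub>R 1 + R * st R) * r = 1"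
      using pos_add_scalar_invertible[OF pRR e] by (auto simp: invertible_in_def)
    \<comment> \<open>The inverse of \<open>e + R\<^sup>* R\<close> obtained from the inverse \<open>r\<close> of \<open>e + R R\<^sup>*\<close>.\<close>
    define k where "k = (1/e) *\<^sub>R (1 - st R * r * R)"
    have rR: "r * (R * st R) = 1 - e *\<^sub>R r" "(R * st R) * r = 1 - e *\<^sub>R r"
      using r(2,3) by (simp_all add: algebra_simps eq_diff_eq)
    have "st R * r * R * (st R * R) = st R * (r * (R * st R)) * R" by (simp add: mult.assoc)
    then have x: "st R * r * R * (st R * R) = st R * R - e *\<^sub>R (st R * r * R)"
      unfolding rR by (simp add: algebra_simps)
    have "st R * R * (st R * r * R) = st R * ((R * st R) * r) * R" by (simp add: mult.assoc)
    then have y: "st R * R * (st R * r * R) = st R * R - e *\<^sub>R (st R * r * R)"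
      unfolding rR by (simp add: algebra_simps)
    have "(1 - st R * r * R) * (e *\<^sub>R 1 + st R * R) = e *\<^sub>R 1"
      "(e *\<^sub>R 1 + st R * R) * (1 - st R * r * R) = e *\<^sub>R 1"
      using x y by (simp_all only: left_diff_distrib right_diff_distrib distrib_left distrib_right) simp_all
    then have "k * (e *\<^sub>R 1 + st R * R) = 1" "(e *\<^sub>R 1 + st R * R) * k = 1"
      using e by (simp_all add: k_def)
    moreover have "k \<in> L" using r RL by (simp add: k_def)
    ultimately have "invertible_in (e *\<^sub>R 1 + st R * R)" by (auto simp: invertible_in_def)
    then have "invertible_in (e *\<^sub>R 1 - q * q)" using RR by simp
    then show False
      using pos_norm_minus_not_invertible[OF pos_square[OF sq] q0] by (simp add: e_def)
  qed
  then have "R = 0" using RR cstar[OF RL] by simp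
  then have "st t * (t * n) = 0" by (simp add: R_def)
  then have "s * n = 0" by (simp add: s_def mult.assoc)
  then have "n * n = 0" using sn mn by (simp add: n_def algebra_simps)
  then have "n = 0" using norm_selfadj_square[OF n] by simp
  then show ?thesis using m(1) by (simp add: n_def s_def)
qed

lemma pos_conj: assumes "pos a" "b \<in> L" shows "pos (st b * a * b)"
proof -
  obtain y where y: "selfadj y" "a = y * y" using assms by (auto simp: pos_def)
  have "st b * a * b = st (y * b) * (y * b)" using y assms by (simp add: mult.assoc)
  then show ?thesis using pos_star_mult[of "y * b"] y assms by simp
qed

end

section \<open>Factorization and approximation by real polynomials\<close>

lemma poly_at_complex: "poly_at p z = poly (map_poly complex_of_real p) z"
proof -
  have "degree (map_poly complex_of_real p) = degree p" by (rule degree_map_poly) simp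
  then show ?thesis
    by (simp add: poly_at_def poly_altdef coeff_map_poly scaleR_conv_of_real)
qed

lemma poly_at_of_real: "poly_at p (complex_of_real t) = complex_of_real (poly p t)"
  by (induction p) (simp_all add: scaleR_conv_of_real)

text \<open>
  A complex root \<open>z\<close> is real or a root of the real quadratic with roots \<open>z\<close> and its conjugate. In the
  second case the remainder modulo the quadratic is of degree at most \<open>1\<close> with a root off the real
  line, hence zero.
\<close>

lemma real_poly_factor:
  fixes q :: "real poly"
  assumes "degree q > 0"
  obtains (linear) t k where "q = [:- t, 1:] * k"
  | (quadratic) a b k where "b \<noteq> 0" "q = [:a\<^sup>2 + b\<^sup>2, - 2 * a, 1:] * k"
proof -
  have "degree (map_poly complex_of_real q) = degree q" by (rule degree_map_poly) simp
  then have "\<not> constant (poly (map_poly complex_of_real q))"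
    using assms by (simp add: constant_degree)
  then obtain z where "poly (map_poly complex_of_real q) z = 0"
    using fundamental_theorem_of_algebra by blast
  then have z: "poly_at q z = 0" by (simp add: poly_at_complex)
  show thesis
  proof (cases "Im z = 0")
    case True
    then have "z = complex_of_real (Re z)" by (simp add: complex_eq_iff)
    then have "poly_at q (complex_of_real (Re z)) = 0" using z by simp
    then have "poly q (Re z) = 0" by (simp add: poly_at_of_real)
    then show thesis using linear by (metis dvdE poly_eq_0_iff_dvd)
  next
    case False
    define d where "d = [:(Re z)\<^sup>2 + (Im z)\<^sup>2, - 2 * Re z, 1:]"
    have dz: "poly_at d z = 0"
      by (simp add: d_def complex_eq_iff algebra_simps power2_eq_square)
    have dd: "degree d = 2" by (simp add: d_def)
    define r where "r = q mod d"
    have q: "q = d * (q div d) + r" by (simp add: r_def)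
    have "degree r < 2"
      using degree_mod_less[of d q] dd by (cases "q mod d = 0") (auto simp: r_def d_def)
    have rz: "poly_at r z = 0"
      using z dz poly_at_add[of "d * (q div d)" r z] poly_at_mult[of d "q div d" z] q by simp
    have "r = [:coeff r 0, coeff r 1:]"
      using \<open>degree r < 2\<close> by (intro poly_eqI) (auto simp: coeff_pCons coeff_eq_0 split: nat.splits)
    then have eq: "coeff r 0 *\<^sub>R 1 + z * (coeff r 1 *\<^sub>R 1) = 0"
      using rz by (metis poly_at_0 poly_at_pCons mult_zero_right add.right_neutral)
    then have c1: "coeff r 1 = 0" using False by (auto simp: complex_eq_iff)
    then have "coeff r 0 = 0" using eq by (auto simp: complex_eq_iff)
    then have "r = 0" using c1 \<open>r = [:coeff r 0, coeff r 1:]\<close> by simp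
    then have "q = d * (q div d)" using q by simp
    then show thesis using quadratic[OF False] by (simp add: d_def)
  qed
qed

lemma weierstrass_poly:
  fixes f :: "real \<Rightarrow> real"
  assumes "continuous_on {0..M} f"
  obtains p where "uniform_limit {0..M} (\<lambda>n. poly (p n)) f sequentially"
proof -
  have "\<exists>p. \<forall>x\<in>{0..M}. \<bar>f x - poly p x\<bar> < 1 / real (Suc n)" for n
  proof -
    obtain g where g: "real_polynomial_function g" "\<And>x. x \<in> {0..M} \<Longrightarrow> \<bar>f x - g x\<bar> < 1 / real (Suc n)"
      using Stone_Weierstrass_real_polynomial_function[OF compact_Icc assms, of "1 / real (Suc n)"]
      by auto
    then obtain a N where "g = (\<lambda>x. \<Sum>i\<le>N. a i * x ^ i)"
      using real_polynomial_function_iff_sum by blast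
    then have "g = poly (\<Sum>i\<le>N. monom (a i) i)"
      by (auto simp: poly_sum poly_monom)
    then show ?thesis using g by blast
  qed
  then obtain p where p: "\<And>n x. x \<in> {0..M} \<Longrightarrow> \<bar>f x - poly (p n) x\<bar> < 1 / real (Suc n)"
    by metis
  have "uniform_limit {0..M} (\<lambda>n. poly (p n)) f sequentially"
  proof (rule uniform_limitI)
    fix e :: real assume "e > 0"
    then have "\<forall>\<^sub>F n in sequentially. 1 / real (Suc n) < e"
      using order_tendstoD(2)[OF LIMSEQ_Suc[OF lim_1_over_n[where 'a = real]]] by blast
    then show "\<forall>\<^sub>F n in sequentially. \<forall>x\<in>{0..M}. dist (poly (p n) x) (f x) < e"
    proof eventually_elim
      case (elim n)
      then show ?case using p[of _ n] by (fastforce simp: dist_real_def abs_minus_commute)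
    qed
  qed
  then show thesis by (rule that)
qed

context cstar_subalgebra
begin

section \<open>Continuous functional calculus for positive elements\<close>

subsection \<open>The real spectrum\<close>

text \<open>
  The real points of the spectrum. For self-adjoint elements there are no others, by
  \<open>quadratic_invertible\<close>.
\<close>

definition rspec :: "'b \<Rightarrow> real set" where
  "rspec s = {t. \<not> invertible_in (t *\<^sub>R 1 - s)}"

lemma invertible_uminus: "invertible_in (- a) \<longleftrightarrow> invertible_in a"
  using invertible_scaleR[of a "-1"] invertible_scaleR[of "- a" "-1"] by auto

lemma pos_rspec: assumes "pos s" shows "rspec s \<subseteq> {0..norm s}"
proof
  fix t assume t: "t \<in> rspec s"
  have "t \<ge> 0"
  proof (rule ccontr)
    assume "\<not> t \<ge> 0"
    then have "invertible_in ((- t) *\<^sub>R 1 + s)" by (intro pos_add_scalar_invertible assms) simp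
    moreover have "(- t) *\<^sub>R 1 + s = - (t *\<^sub>R 1 - s)" by simp
    ultimately have "invertible_in (t *\<^sub>R 1 - s)" by (simp only: invertible_uminus)
    then show False using t by (simp add: rspec_def)
  qed
  moreover have "t \<le> norm s"
  proof (rule ccontr)
    assume "\<not> t \<le> norm s"
    then have "invertible_in ((t - norm s) *\<^sub>R 1 + (norm s *\<^sub>R 1 - s))"
      using assms by (intro pos_add_scalar_invertible scalar_minus_pos) simp_all
    then show False using t by (simp add: rspec_def scaleR_diff_left)
  qed
  ultimately show "t \<in> {0..norm s}" by simp
qed

lemma quadratic_invertible:
  assumes "selfadj s" "b \<noteq> 0"
  shows "invertible_in ((a *\<^sub>R 1 - s) * (a *\<^sub>R 1 - s) + (b\<^sup>2) *\<^sub>R 1)"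
  using pos_add_scalar_invertible[OF pos_square, of "a *\<^sub>R 1 - s" "b\<^sup>2"] assms
  by (simp add: add.commute)

text \<open>
  Linear real factors of \<open>q\<close> are invertible at \<open>s\<close> because their root is outside the spectrum, the
  remaining quadratic factors because \<open>s\<close> is self-adjoint.
\<close>

lemma poly_at_invertible:
  assumes s: "selfadj s"
  shows "q \<noteq> 0 \<Longrightarrow> (\<And>t. t \<in> rspec s \<Longrightarrow> poly q t \<noteq> 0) \<Longrightarrow> invertible_in (poly_at q s)"
proof (induction "degree q" arbitrary: q rule: less_induct)
  case less
  show ?case
  proof (cases "degree q = 0")
    case True
    then obtain c where "q = [:c:]" by (metis degree_0_id)
    moreover have "invertible_in (1::'b)" unfolding invertible_in_def by (rule bexI[of _ 1]) simp_all
    ultimately show ?thesis using less.prems(1) by (simp add: invertible_scaleR)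
  next
    case False
    then have "degree q > 0" by simp
    then show ?thesis
    proof (cases rule: real_poly_factor)
      case (linear t k)
      have k0: "k \<noteq> 0" using less.prems(1) linear by auto
      have "degree q = Suc (degree k)" using k0 unfolding linear by (subst degree_mult_eq) simp_all
      moreover have "poly k u \<noteq> 0" if "u \<in> rspec s" for u
        using less.prems(2)[OF that] linear by auto
      ultimately have "invertible_in (poly_at k s)" using less.hyps[of k] k0 by simp
      moreover have "t \<notin> rspec s" using less.prems(2)[of t] linear by auto
      then have "invertible_in (- (t *\<^sub>R 1 - s))" by (simp only: invertible_uminus) (simp add: rspec_def)
      moreover have "poly_at q s = (- (t *\<^sub>R 1 - s)) * poly_at k s"
        unfolding linear poly_at_mult by simp
      ultimately show ?thesis by (metis invertible_mult)
    next
      case (quadratic a b k)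
      have k0: "k \<noteq> 0" using less.prems(1) quadratic by auto
      have "degree q = Suc (Suc (degree k))"
        using k0 unfolding quadratic(2) by (subst degree_mult_eq) simp_all
      moreover have "poly k u \<noteq> 0" if "u \<in> rspec s" for u
        using less.prems(2)[OF that] quadratic by auto
      ultimately have "invertible_in (poly_at k s)" using less.hyps[of k] k0 by simp
      moreover have "poly_at q s = ((a *\<^sub>R 1 - s) * (a *\<^sub>R 1 - s) + (b\<^sup>2) *\<^sub>R 1) * poly_at k s"
        unfolding quadratic poly_at_mult
        by (rule arg_cong2[where f = times])
          (simp_all add: algebra_simps power2_eq_square scaleR_2[symmetric])
      ultimately show ?thesis using quadratic_invertible[OF s quadratic(1)] by (metis invertible_mult)
    qed
  qed
qed

text \<open>
  With empty spectrum, the positive element \<open>p = \<parallel>s\<parallel> - s\<close> vanishes by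
  \<open>pos_norm_minus_not_invertible\<close>; then \<open>0 = \<parallel>s\<parallel> - s\<close> is invertible, and the algebra is trivial.
\<close>

lemma rspec_nonempty: assumes "selfadj s" "rspec s = {}" shows "(1::'b) = 0"
proof -
  define p where "p = norm s *\<^sub>R 1 - s"
  have p: "pos p" unfolding p_def using assms by (intro scalar_minus_pos) simp_all
  have inv: "invertible_in (t *\<^sub>R 1 - s)" for t using assms(2) by (auto simp: rspec_def)
  have "norm p *\<^sub>R 1 - p = - ((norm s - norm p) *\<^sub>R 1 - s)" by (simp add: p_def algebra_simps)
  then have "invertible_in (norm p *\<^sub>R 1 - p)" using inv by (simp only: invertible_uminus)
  then have "p = 0" using pos_norm_minus_not_invertible[OF p] by blast
  then have "invertible_in 0" using inv[of "norm s"] by (simp add: p_def)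
  then show ?thesis by (auto simp: invertible_in_def)
qed

text \<open>
  For \<open>e > 0\<close> the polynomial \<open>e + m\<^sup>2 - p\<^sup>2\<close> has no zero in the spectrum, so it is invertible at \<open>s\<close>.
  Hence \<open>m\<^sup>2 - p(s)\<^sup>2\<close> is positive.
\<close>

lemma norm_poly_at_le_rspec:
  assumes s: "selfadj s" and le: "\<And>t. t \<in> rspec s \<Longrightarrow> \<bar>poly p t\<bar> \<le> m" and m: "m \<ge> 0"
  shows "norm (poly_at p s) \<le> m"
proof (cases "(1::'b) = 0")
  case True
  then have "poly_at p s = 0" by (metis mult.right_neutral mult_zero_right)
  then show ?thesis using m by simp
next
  case False
  \<comment> \<open>A point of the spectrum excludes that the polynomial considered below is the zero polynomial.\<close>
  then obtain t0 where t0: "t0 \<in> rspec s" using rspec_nonempty[OF s] by auto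
  define q where "q = [:m\<^sup>2:] - p * p"
  have q_s: "poly_at q s = m\<^sup>2 *\<^sub>R 1 - poly_at p s * poly_at p s"
    by (simp add: q_def poly_at_diff poly_at_mult)
  have sq: "poly p t * poly p t \<le> m\<^sup>2" if "t \<in> rspec s" for t
    using power_mono[OF le[OF that], of 2] by (simp add: power2_eq_square)
  have "pos (poly_at q s)"
  proof (rule selfadj_invertible_imp_pos)
    show "selfadj (poly_at q s)" using s by simp
    fix e :: real assume e: "e > 0"
    have gt: "poly ([:e:] + q) t > 0" if "t \<in> rspec s" for t
      using sq[OF that] e by (simp add: q_def)
    then have "[:e:] + q \<noteq> 0" using gt[OF t0] by (metis less_irrefl poly_0)
    then have "invertible_in (poly_at ([:e:] + q) s)"
      using gt by (intro poly_at_invertible s) force+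
    then show "invertible_in (e *\<^sub>R 1 + poly_at q s)" by (simp add: poly_at_add)
  qed
  then have "norm (poly_at p s * poly_at p s) \<le> m\<^sup>2"
    unfolding q_s using s by (intro pos_norm_le_scalar) (simp_all add: pos_square)
  then have "(norm (poly_at p s))\<^sup>2 \<le> m\<^sup>2" using norm_selfadj_square[of "poly_at p s"] s by simp
  then show ?thesis using m by (rule power2_le_imp_le)
qed

lemma pos_iff_rspec: "selfadj s \<Longrightarrow> pos s \<longleftrightarrow> rspec s \<subseteq> {0..}"
proof
  assume "selfadj s" "rspec s \<subseteq> {0..}"
  show "pos s"
  proof (rule selfadj_invertible_imp_pos)
    fix e :: real assume "e > 0"
    then have "- e \<notin> rspec s" using \<open>rspec s \<subseteq> {0..}\<close> by force
    then have "invertible_in (- (e *\<^sub>R 1 + s))" by (simp add: rspec_def)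
    then show "invertible_in (e *\<^sub>R 1 + s)" by (simp only: invertible_uminus)
  qed fact
qed (use pos_rspec in force)

subsection \<open>The calculus\<close>

text \<open>
  The condition that singles out the value of the calculus: one limit for all polynomial sequences
  approximating \<open>f\<close> on the spectrum.
\<close>

definition is_cfc :: "(real \<Rightarrow> real) \<Rightarrow> 'b \<Rightarrow> 'b \<Rightarrow> bool" where
  "is_cfc f s c \<longleftrightarrow> (\<forall>p. uniform_limit (rspec s) (\<lambda>n. poly (p n)) f sequentially
     \<longrightarrow> (\<lambda>n. poly_at (p n) s) \<longlonglongrightarrow> c)"

definition cfc :: "(real \<Rightarrow> real) \<Rightarrow> 'b \<Rightarrow> 'b" where
  "cfc f s = (THE c. is_cfc f s c)"

text \<open>
  With \<open>f = g\<close> and \<open>e = 0\<close> this is independence of the approximating sequence.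
\<close>

lemma norm_poly_at_limit_diff:
  assumes s: "selfadj s"
    and p: "uniform_limit (rspec s) (\<lambda>n. poly (p n)) f sequentially" "(\<lambda>n. poly_at (p n) s) \<longlonglongrightarrow> c"
    and q: "uniform_limit (rspec s) (\<lambda>n. poly (q n)) g sequentially" "(\<lambda>n. poly_at (q n) s) \<longlonglongrightarrow> d"
    and fg: "\<And>t. t \<in> rspec s \<Longrightarrow> \<bar>f t - g t\<bar> \<le> e" and e: "e \<ge> 0"
  shows "norm (c - d) \<le> e"
proof (rule field_le_epsilon)
  fix h :: real assume h: "h > 0"
  have h2: "h/2 > 0" using h by simp
  have "\<forall>\<^sub>F n in sequentially. norm (poly_at (p n) s - poly_at (q n) s) \<le> e + h"
    using uniform_limitD[OF p(1) h2] uniform_limitD[OF q(1) h2]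
  proof eventually_elim
    case (elim n)
    have "norm (poly_at (p n - q n) s) \<le> e + h"
    proof (rule norm_poly_at_le_rspec[OF s])
      fix t assume t: "t \<in> rspec s"
      have "\<bar>poly (p n) t - f t\<bar> < h/2" "\<bar>poly (q n) t - g t\<bar> < h/2"
        using elim t by (auto simp: dist_real_def)
      then show "\<bar>poly (p n - q n) t\<bar> \<le> e + h" using fg[OF t] unfolding poly_diff by linarith
    qed (use e h in simp)
    then show ?case by (simp add: poly_at_diff)
  qed
  moreover have "(\<lambda>n. norm (poly_at (p n) s - poly_at (q n) s)) \<longlonglongrightarrow> norm (c - d)"
    by (intro tendsto_intros p q)
  ultimately show "norm (c - d) \<le> e + h"
    by (metis tendsto_upperbound trivial_limit_sequentially)
qed

lemma poly_at_uniform_Cauchy: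
  assumes s: "selfadj s" and p: "uniform_limit (rspec s) (\<lambda>n. poly (p n)) f sequentially"
  shows "convergent (\<lambda>n. poly_at (p n) s)"
proof (rule Cauchy_convergent, rule metric_CauchyI)
  fix h :: real assume h: "h > 0"
  then obtain M where M: "\<And>n t. n \<ge> M \<Longrightarrow> t \<in> rspec s \<Longrightarrow> dist (poly (p n) t) (f t) < h/4"
    using uniform_limitD[OF p, of "h/4"] by (auto simp: eventually_sequentially)
  have "dist (poly_at (p m) s) (poly_at (p n) s) < h" if "m \<ge> M" "n \<ge> M" for m n
  proof -
    have "norm (poly_at (p m - p n) s) \<le> h/2"
    proof (rule norm_poly_at_le_rspec[OF s])
      fix t assume "t \<in> rspec s"
      then have "\<bar>poly (p m) t - f t\<bar> < h/4" "\<bar>poly (p n) t - f t\<bar> < h/4"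
        using M that by (auto simp: dist_real_def)
      then show "\<bar>poly (p m - p n) t\<bar> \<le> h/2" unfolding poly_diff by linarith
    qed (use h in simp)
    then show ?thesis using h by (simp add: dist_norm poly_at_diff)
  qed
  then show "\<exists>M. \<forall>m\<ge>M. \<forall>n\<ge>M. dist (poly_at (p m) s) (poly_at (p n) s) < h" by blast
qed

text \<open>
  Positive elements have their spectrum in the half-line, so continuity there serves all of them at
  once, in particular the two elements of \<open>cfc_intertwine\<close>.
\<close>

abbreviation contf :: "(real \<Rightarrow> real) \<Rightarrow> bool" where
  "contf \<equiv> continuous_on {0..}"

lemma poly_approx:
  assumes "contf f"
  obtains p where "uniform_limit {0..M} (\<lambda>n. poly (p n)) f sequentially"
proof (rule weierstrass_poly)
  show "continuous_on {0..M} f" using assms by (rule continuous_on_subset) auto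
qed

lemma uniform_limit_rspec:
  assumes "pos s" "norm s \<le> M" "uniform_limit {0..M} p f sequentially"
  shows "uniform_limit (rspec s) p f sequentially"
  using assms(3) by (rule uniform_limit_on_subset) (use pos_rspec[OF assms(1)] assms(2) in force)

lemma is_cfc_unique: assumes "pos s" "contf f" "is_cfc f s c" "is_cfc f s d" shows "c = d"
proof -
  obtain p where "uniform_limit {0..norm s} (\<lambda>n. poly (p n)) f sequentially"
    using poly_approx[OF assms(2)] by blast
  then have "uniform_limit (rspec s) (\<lambda>n. poly (p n)) f sequentially"
    using uniform_limit_rspec[OF assms(1)] by blast
  then show ?thesis using assms(3,4) LIMSEQ_unique unfolding is_cfc_def by blast
qed

lemma is_cfc_cfc: assumes "pos s" "contf f" shows "is_cfc f s (cfc f s)"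
proof -
  obtain p where "uniform_limit {0..norm s} (\<lambda>n. poly (p n)) f sequentially"
    using poly_approx[OF assms(2)] by blast
  then have p: "uniform_limit (rspec s) (\<lambda>n. poly (p n)) f sequentially"
    using uniform_limit_rspec[OF assms(1)] by blast
  obtain c where c: "(\<lambda>n. poly_at (p n) s) \<longlonglongrightarrow> c"
    using poly_at_uniform_Cauchy[OF pos_selfadj[OF assms(1)] p] by (auto simp: convergent_def)
  have "is_cfc f s c"
    unfolding is_cfc_def
  proof (intro allI impI)
    fix q assume q: "uniform_limit (rspec s) (\<lambda>n. poly (q n)) f sequentially"
    obtain d where d: "(\<lambda>n. poly_at (q n) s) \<longlonglongrightarrow> d"
      using poly_at_uniform_Cauchy[OF pos_selfadj[OF assms(1)] q] by (auto simp: convergent_def)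
    have "norm (d - c) \<le> 0"
      by (rule norm_poly_at_limit_diff[OF pos_selfadj[OF assms(1)] q d p c]) simp_all
    then show "(\<lambda>n. poly_at (q n) s) \<longlonglongrightarrow> c" using d by simp
  qed
  then show ?thesis
    unfolding cfc_def by (rule theI) (rule is_cfc_unique[OF assms _ \<open>is_cfc f s c\<close>])
qed

lemma cfc_limit:
  assumes "pos s" "contf f" "norm s \<le> M" "uniform_limit {0..M} (\<lambda>n. poly (p n)) f sequentially"
  shows "(\<lambda>n. poly_at (p n) s) \<longlonglongrightarrow> cfc f s"
  using is_cfc_cfc[OF assms(1,2)] uniform_limit_rspec[OF assms(1,3,4)] unfolding is_cfc_def by blast

lemma cfc_selfadj: assumes "pos s" "contf f" shows "selfadj (cfc f s)"
proof -
  obtain p where p: "uniform_limit {0..norm s} (\<lambda>n. poly (p n)) f sequentially"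
    using poly_approx[OF assms(2)] by blast
  show ?thesis by (rule lim_selfadj[OF _ cfc_limit[OF assms order.refl p]]) (use assms in simp)
qed

lemma cfc_norm_diff:
  assumes "pos s" "contf f" "contf g" "\<And>t. t \<in> {0..norm s} \<Longrightarrow> \<bar>f t - g t\<bar> \<le> e" "e \<ge> 0"
  shows "norm (cfc f s - cfc g s) \<le> e"
proof -
  obtain p where p: "uniform_limit {0..norm s} (\<lambda>n. poly (p n)) f sequentially"
    using poly_approx[OF assms(2)] by blast
  obtain q where q: "uniform_limit {0..norm s} (\<lambda>n. poly (q n)) g sequentially"
    using poly_approx[OF assms(3)] by blast
  show ?thesis
    by (rule norm_poly_at_limit_diff[OF pos_selfadj[OF assms(1)]
          uniform_limit_rspec[OF assms(1) order.refl p] cfc_limit[OF assms(1,2) order.refl p]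
          uniform_limit_rspec[OF assms(1) order.refl q] cfc_limit[OF assms(1,3) order.refl q] _ assms(5)])
      (use assms(4) pos_rspec[OF assms(1)] in blast)
qed

lemma cfc_cong:
  assumes "pos s" "contf f" "contf g" "\<And>t. t \<ge> 0 \<Longrightarrow> f t = g t"
  shows "cfc f s = cfc g s"
  using cfc_norm_diff[OF assms(1-3), of 0] assms(4) by simp

lemma cfc_const: assumes "pos s" shows "cfc (\<lambda>_. c) s = c *\<^sub>R 1"
proof -
  have "uniform_limit {0..norm s} (\<lambda>n. poly [:c:]) (\<lambda>_. c) sequentially"
    by (rule uniform_limitI) simp
  from LIMSEQ_unique[OF cfc_limit[OF assms _ order.refl this]] show ?thesis by force
qed

lemma cfc_id: assumes "pos s" shows "cfc (\<lambda>t. t) s = s"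
proof -
  have "uniform_limit {0..norm s} (\<lambda>n. poly [:0, 1:]) (\<lambda>t. t) sequentially"
    by (rule uniform_limitI) simp
  from LIMSEQ_unique[OF cfc_limit[OF assms _ order.refl this]] show ?thesis by force
qed

lemma bounded_contf: assumes "contf f" shows "bounded (f ` {0..M})"
  by (rule compact_imp_bounded, rule compact_continuous_image)
    (use continuous_on_subset[OF assms, of "{0..M}"] in auto)

lemma cfc_add:
  assumes "pos s" "contf f" "contf g" shows "cfc (\<lambda>t. f t + g t) s = cfc f s + cfc g s"
proof -
  obtain p where p: "uniform_limit {0..norm s} (\<lambda>n. poly (p n)) f sequentially"
    using poly_approx[OF assms(2)] by blast
  obtain q where q: "uniform_limit {0..norm s} (\<lambda>n. poly (q n)) g sequentially"
    using poly_approx[OF assms(3)] by blast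
  have c: "contf (\<lambda>t. f t + g t)" by (intro continuous_intros assms)
  have "uniform_limit {0..norm s} (\<lambda>n. poly (p n + q n)) (\<lambda>t. f t + g t) sequentially"
    using uniform_limit_add[OF p q] by (simp add: poly_add[abs_def])
  from cfc_limit[OF assms(1) c order.refl this]
  have "(\<lambda>n. poly_at (p n) s + poly_at (q n) s) \<longlonglongrightarrow> cfc (\<lambda>t. f t + g t) s" by (simp add: poly_at_add)
  moreover have "(\<lambda>n. poly_at (p n) s + poly_at (q n) s) \<longlonglongrightarrow> cfc f s + cfc g s"
    by (intro tendsto_intros cfc_limit[OF assms(1,2) order.refl p] cfc_limit[OF assms(1,3) order.refl q])
  ultimately show ?thesis by (rule LIMSEQ_unique)
qed

lemma cfc_mult:
  assumes "pos s" "contf f" "contf g" shows "cfc (\<lambda>t. f t * g t) s = cfc f s * cfc g s"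
proof -
  obtain p where p: "uniform_limit {0..norm s} (\<lambda>n. poly (p n)) f sequentially"
    using poly_approx[OF assms(2)] by blast
  obtain q where q: "uniform_limit {0..norm s} (\<lambda>n. poly (q n)) g sequentially"
    using poly_approx[OF assms(3)] by blast
  have c: "contf (\<lambda>t. f t * g t)" by (intro continuous_intros assms)
  have "uniform_limit {0..norm s} (\<lambda>n. poly (p n * q n)) (\<lambda>t. f t * g t) sequentially"
    using uniform_lim_mult[OF p q bounded_contf bounded_contf] assms by (simp add: poly_mult[abs_def])
  from cfc_limit[OF assms(1) c order.refl this]
  have "(\<lambda>n. poly_at (p n) s * poly_at (q n) s) \<longlonglongrightarrow> cfc (\<lambda>t. f t * g t) s" by (simp add: poly_at_mult)
  moreover have "(\<lambda>n. poly_at (p n) s * poly_at (q n) s) \<longlonglongrightarrow> cfc f s * cfc g s"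
    by (intro tendsto_intros cfc_limit[OF assms(1,2) order.refl p] cfc_limit[OF assms(1,3) order.refl q])
  ultimately show ?thesis by (rule LIMSEQ_unique)
qed

text \<open>
  One sequence of polynomials approximates \<open>f\<close> on an interval containing both spectra.
\<close>

lemma cfc_intertwine:
  assumes "pos s" "pos s'" "contf f" "c * s = s' * c" shows "c * cfc f s = cfc f s' * c"
proof -
  define M where "M = max (norm s) (norm s')"
  obtain p where p: "uniform_limit {0..M} (\<lambda>n. poly (p n)) f sequentially"
    using poly_approx[OF assms(3)] by blast
  have "(\<lambda>n. c * poly_at (p n) s) \<longlonglongrightarrow> c * cfc f s"
    by (intro tendsto_intros cfc_limit[OF assms(1,3) _ p]) (simp add: M_def)
  moreover have "(\<lambda>n. poly_at (p n) s' * c) \<longlonglongrightarrow> cfc f s' * c"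
    by (intro tendsto_intros cfc_limit[OF assms(2,3) _ p]) (simp add: M_def)
  moreover have "c * poly_at (p n) s = poly_at (p n) s' * c" for n
    by (rule poly_at_intertwine[OF assms(4)])
  ultimately show ?thesis using LIMSEQ_unique by fastforce
qed

lemma cfc_pos: assumes "pos s" "contf f" "\<And>t. t \<ge> 0 \<Longrightarrow> f t \<ge> 0" shows "pos (cfc f s)"
proof -
  have c: "contf (\<lambda>t. sqrt (f t))" by (intro continuous_intros assms)
  have "cfc f s = cfc (\<lambda>t. sqrt (f t) * sqrt (f t)) s"
    using assms c by (intro cfc_cong continuous_intros) simp_all
  also have "\<dots> = cfc (\<lambda>t. sqrt (f t)) s * cfc (\<lambda>t. sqrt (f t)) s"
    by (rule cfc_mult[OF assms(1) c c])
  finally show ?thesis using cfc_selfadj[OF assms(1) c] pos_square by metis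
qed

lemma cfc_poly_comp:
  assumes "pos s" "contf g" shows "cfc (\<lambda>t. poly p (g t)) s = poly_at p (cfc g s)"
proof (induction p)
  case (pCons a p)
  have c: "contf (\<lambda>t. poly p (g t))" by (intro continuous_intros assms)
  have c': "contf (\<lambda>t. g t * poly p (g t))" by (intro continuous_intros assms)
  have "cfc (\<lambda>t. poly (pCons a p) (g t)) s = cfc (\<lambda>t. a + g t * poly p (g t)) s" by simp
  also have "\<dots> = a *\<^sub>R 1 + cfc g s * cfc (\<lambda>t. poly p (g t)) s"
    using cfc_add[OF assms(1) _ c', of "\<lambda>_. a"] cfc_mult[OF assms c] cfc_const[OF assms(1)]
    by simp
  finally show ?case using pCons by simp
qed (use cfc_const[OF assms(1), of 0] in simp)

text \<open>
  By \<open>cfc_poly_comp\<close> the rule holds for polynomials, which are then made to converge to \<open>f\<close> uniformly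
  on an interval containing both the values of \<open>g\<close> and the spectrum of \<open>cfc g s\<close>.
\<close>

lemma cfc_comp:
  assumes "pos s" "contf g" "\<And>t. t \<ge> 0 \<Longrightarrow> g t \<ge> 0" "contf f"
  shows "cfc f (cfc g s) = cfc (\<lambda>t. f (g t)) s"
proof -
  obtain K where "\<forall>y\<in>g ` {0..norm s}. norm y \<le> K"
    using bounded_contf[OF assms(2), of "norm s"] unfolding bounded_iff by blast
  then have K: "\<bar>g t\<bar> \<le> K" if "t \<in> {0..norm s}" for t using that by simp
  define M where "M = max K (norm (cfc g s))"
  obtain p where p: "uniform_limit {0..M} (\<lambda>n. poly (p n)) f sequentially"
    using poly_approx[OF assms(4)] by blast
  have cfg: "contf (\<lambda>t. f (g t))"
    by (rule continuous_on_compose2[OF assms(4,2)]) (use assms(3) in auto)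
  have "(\<lambda>n. poly_at (p n) (cfc g s)) \<longlonglongrightarrow> cfc f (cfc g s)"
    by (rule cfc_limit[OF cfc_pos[OF assms(1-3)] assms(4) _ p]) (simp_all add: M_def)
  moreover have "(\<lambda>n. poly_at (p n) (cfc g s)) \<longlonglongrightarrow> cfc (\<lambda>t. f (g t)) s"
  proof (rule LIMSEQ_I)
    fix e :: real assume e: "e > 0"
    have "e/2 > 0" using e by simp
    from uniform_limitD[OF p this] obtain N where
      N: "\<And>n t. n \<ge> N \<Longrightarrow> t \<in> {0..M} \<Longrightarrow> dist (poly (p n) t) (f t) < e/2"
      unfolding eventually_sequentially by blast
    have "norm (poly_at (p n) (cfc g s) - cfc (\<lambda>t. f (g t)) s) < e" if "n \<ge> N" for n
    proof -
      have "norm (cfc (\<lambda>t. poly (p n) (g t)) s - cfc (\<lambda>t. f (g t)) s) \<le> e/2"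
      proof (rule cfc_norm_diff[OF assms(1) _ cfg])
        show "contf (\<lambda>t. poly (p n) (g t))" by (intro continuous_intros assms)
        fix t assume t: "t \<in> {0..norm s}"
        have "g t \<in> {0..M}" using K[OF t] assms(3)[of t] t by (auto simp: M_def)
        then show "\<bar>poly (p n) (g t) - f (g t)\<bar> \<le> e/2"
          using N[OF that] by (fastforce simp: dist_real_def)
      qed (use e in simp)
      then show ?thesis using e cfc_poly_comp[OF assms(1,2)] by simp
    qed
    then show "\<exists>N. \<forall>n\<ge>N. norm (poly_at (p n) (cfc g s) - cfc (\<lambda>t. f (g t)) s) < e" by blast
  qed
  ultimately show ?thesis by (rule LIMSEQ_unique)
qed

subsection \<open>Real powers\<close>

definition cpow :: "'b \<Rightarrow> real \<Rightarrow> 'b" where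
  "cpow s a = cfc (\<lambda>t. t powr a) s"

lemma contf_powr: "a > 0 \<Longrightarrow> contf (\<lambda>t. t powr a)"
  by (intro continuous_on_powr' continuous_intros) auto

lemma cpow_pos: "pos s \<Longrightarrow> a > 0 \<Longrightarrow> pos (cpow s a)"
  unfolding cpow_def by (intro cfc_pos contf_powr) simp_all

lemma cpow_1: assumes "pos s" shows "cpow s 1 = s"
proof -
  have "cpow s 1 = cfc (\<lambda>t. t) s"
    unfolding cpow_def by (intro cfc_cong contf_powr assms continuous_intros) simp_all
  then show ?thesis using cfc_id[OF assms] by simp
qed

lemma cpow_add: "pos s \<Longrightarrow> a > 0 \<Longrightarrow> b > 0 \<Longrightarrow> cpow s a * cpow s b = cpow s (a + b)"
  unfolding cpow_def by (subst cfc_mult[symmetric]) (simp_all add: contf_powr powr_add)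

lemma cpow_cpow: assumes "pos s" "a > 0" "b > 0" shows "cpow (cpow s a) b = cpow s (a * b)"
  unfolding cpow_def using assms
  by (subst cfc_comp) (simp_all add: contf_powr powr_powr)

lemma cpow_intertwine:
  "pos s \<Longrightarrow> pos s' \<Longrightarrow> a > 0 \<Longrightarrow> c * s = s' * c \<Longrightarrow> c * cpow s a = cpow s' a * c"
  unfolding cpow_def by (intro cfc_intertwine contf_powr)

lemma cpow_0: assumes "a > 0" shows "cpow 0 a = 0"
proof -
  have "norm (cfc (\<lambda>t. t powr a) 0 - cfc (\<lambda>_. 0) 0) \<le> 0"
    using assms by (intro cfc_norm_diff contf_powr continuous_intros) simp_all
  then show ?thesis using cfc_const[OF pos_0, of 0] by (simp add: cpow_def)
qed

text \<open>
  Uniqueness of positive square roots.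
\<close>

lemma cpow_half: assumes "pos d" shows "cpow (d * d) (1/2) = d"
proof -
  have "d * d = cpow d 1 * cpow d 1" using cpow_1[OF assms] by simp
  also have "\<dots> = cpow d 2" using cpow_add[OF assms, of 1 1] by simp
  finally show ?thesis using cpow_cpow[OF assms, of 2 "1/2"] cpow_1[OF assms] by simp
qed

lemma cpow_half_square: assumes "pos d" shows "cpow d (1/2) * cpow d (1/2) = d"
  using cpow_add[OF assms, of "1/2" "1/2"] cpow_1[OF assms] by simp

text \<open>
  A function vanishing at \<open>0\<close> is approximated by polynomials divisible by the variable. Hence the
  range of a power of \<open>s\<close> is contained in the closure of the range of \<open>s\<close>.
\<close>

lemma cpow_approx:
  assumes s: "pos s" and a: "a > 0"
  obtains k where "(\<lambda>n. s * k n) \<longlonglongrightarrow> cpow s a"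
proof -
  obtain p where p: "uniform_limit {0..norm s} (\<lambda>n. poly (p n)) (\<lambda>t. t powr a) sequentially"
    using poly_approx[OF contf_powr[OF a]] by blast
  have "(\<lambda>n. poly (p n) 0) \<longlonglongrightarrow> 0 powr a"
    by (rule tendsto_uniform_limitI[OF p]) simp
  then have "(\<lambda>n. coeff (p n) 0) \<longlonglongrightarrow> 0" by (simp add: poly_0_coeff_0)
  then have "(\<lambda>n. poly_at (p n) s - coeff (p n) 0 *\<^sub>R 1) \<longlonglongrightarrow> cpow s a - 0 *\<^sub>R 1"
    unfolding cpow_def by (intro tendsto_intros cfc_limit[OF s contf_powr[OF a] order.refl p])
  moreover have "poly_at (p n) s - coeff (p n) 0 *\<^sub>R 1 = s * poly_at (poly_shift 1 (p n)) s" for n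
  proof -
    have "p n = pCons (coeff (p n) 0) (poly_shift 1 (p n))"
      by (rule poly_eqI) (simp add: coeff_pCons coeff_poly_shift split: nat.split)
    then have "poly_at (p n) s = coeff (p n) 0 *\<^sub>R 1 + s * poly_at (poly_shift 1 (p n)) s"
      by (metis poly_at_pCons)
    then show ?thesis by simp
  qed
  ultimately show thesis using that by simp
qed

end

section \<open>Adjointable operators on a module with the Cauchy-Schwarz inequality\<close>

lemma scaleC_of_real: "complex_of_real r *\<^sub>C x = r *\<^sub>R (x::'v::complex_vector)"
  by (simp add: scaleR_scaleC)

lemma scaleC_Re_Im: "z *\<^sub>C x = Re z *\<^sub>R x + Im z *\<^sub>R (\<i> *\<^sub>C (x::'v::complex_vector))"
proof -
  have "z = of_real (Re z) + of_real (Im z) * \<i>" by (simp add: complex_eq_iff)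
  then have "z *\<^sub>C x = (of_real (Re z) + of_real (Im z) * \<i>) *\<^sub>C x" by (rule arg_cong)
  then show ?thesis by (simp add: scaleC_add_left scaleC_scaleC[symmetric] scaleC_of_real)
qed

lemma star_scaleR: "star (r *\<^sub>R x) = r *\<^sub>R star (x::'a::cstar_algebra)"
  using star_scaleC[of "of_real r" x] by (simp add: scaleC_of_real)

lemma norm_star: "norm (star x) = norm (x::'a::cstar_algebra)"
proof -
  have le: "norm y \<le> norm (star y)" for y :: 'a
  proof (cases "norm y = 0")
    case False
    have "norm y * norm y \<le> norm (star y) * norm y"
      using cstar_identity[of y] norm_mult_ineq[of "star y" y] by (simp add: power2_eq_square)
    then show ?thesis using False by simp
  qed simp
  show ?thesis using le[of x] le[of "star x"] by (simp add: star_star)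
qed

text \<open>
  A complex Banach space whose norm comes from an algebra-valued inner product. The Cauchy-Schwarz
  inequality takes the place of positivity of \<open>ip x x\<close> among the assumptions: for a C*-algebra with
  inner product \<open>a\<^sup>* b\<close> it is submultiplicativity of the norm, and that instance supplies the order on
  the algebra from which the inequality is proved for every Hilbert module.
\<close>

locale cs_module =
  fixes ip :: "'h::{complex_vector, banach} \<Rightarrow> 'h \<Rightarrow> 'a::cstar_algebra"
  assumes ip_add_right: "ip x (y + z) = ip x y + ip x z"
    and ip_scaleC_right: "ip x (c *\<^sub>C y) = c *\<^sub>C ip x y"
    and star_ip: "star (ip x y) = ip y x"
    and norm_eq_sqrt_ip: "norm x = sqrt (norm (ip x x))"
    and cauchy_schwarz: "norm (ip x y) \<le> norm x * norm y"
begin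

lemma ip_scaleR_right: "ip x (r *\<^sub>R y) = r *\<^sub>R ip x y"
  using ip_scaleC_right[of x "of_real r" y] by (simp add: scaleC_of_real)

lemma ip_add_left: "ip (x + y) z = ip x z + ip y z"
  by (metis star_ip star_add ip_add_right)

lemma ip_scaleC_left: "ip (c *\<^sub>C x) y = cnj c *\<^sub>C ip x y"
  by (metis star_ip star_scaleC ip_scaleC_right)

lemma ip_scaleR_left: "ip (r *\<^sub>R x) y = r *\<^sub>R ip x y"
  using ip_scaleC_left[of "of_real r" x y] by (simp add: scaleC_of_real)

sublocale ip: bounded_bilinear ip
proof
  show "\<exists>K. \<forall>a b. norm (ip a b) \<le> norm a * norm b * K"
    using cauchy_schwarz by (intro exI[of _ 1]) simp
qed (simp_all add: ip_add_left ip_add_right ip_scaleR_left ip_scaleR_right)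

lemma norm_ip_self: "norm (ip x x) = (norm x)\<^sup>2"
  by (simp add: norm_eq_sqrt_ip)

lemma ip_self_0: "ip x x = 0 \<Longrightarrow> x = 0"
  using norm_ip_self[of x] by simp

lemma ip_eqI: assumes "\<And>y. ip y x = ip y x'" shows "x = x'"
proof -
  have "ip (x - x') (x - x') = 0" using assms by (simp add: ip.diff_right)
  then show ?thesis using ip_self_0 by fastforce
qed

lemma is_adjoint_unique: "is_adjoint ip B C \<Longrightarrow> is_adjoint ip B C' \<Longrightarrow> C = C'"
  unfolding is_adjoint_def by (metis blinfun_eqI ip_eqI)

definition adjointables :: "'h endo set" where
  "adjointables = {a. blin a \<in> adjointable_ops ip}"

definition st :: "'h endo \<Rightarrow> 'h endo" where
  "st a = endo (adjoint_op ip (blin a))"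

definition im_unit :: "'h endo" where
  "im_unit = endo (Blinfun (\<lambda>x. \<i> *\<^sub>C x))"

lemma adjoint_op_eq: "is_adjoint ip B C \<Longrightarrow> adjoint_op ip B = C"
  unfolding adjoint_op_def by (rule the_equality) (auto intro: is_adjoint_unique)

lemma blin_st [simp]: "blin (st a) = adjoint_op ip (blin a)"
  by (simp add: st_def)

lemma st_eqI:
  assumes "\<And>x y. ip (ap a x) y = ip x (ap b y)"
  shows "a \<in> adjointables" "st a = b"
proof -
  have *: "is_adjoint ip (blin a) (blin b)" using assms by (simp add: is_adjoint_def)
  then show "a \<in> adjointables" by (auto simp: adjointables_def adjointable_ops_def)
  show "st a = b" by (simp add: st_def adjoint_op_eq[OF *] blin_inverse)
qed

lemma ip_ap: assumes "a \<in> adjointables" shows "ip (ap a x) y = ip x (ap (st a) y)"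
proof -
  obtain C where C: "is_adjoint ip (blin a) C"
    using assms by (auto simp: adjointables_def adjointable_ops_def)
  then show ?thesis by (simp add: adjoint_op_eq[OF C]) (simp add: is_adjoint_def)
qed

lemma ip_ap': assumes "a \<in> adjointables" shows "ip (ap (st a) x) y = ip x (ap a y)"
  by (metis assms ip_ap star_ip)

lemma ap_im_unit: "ap im_unit x = \<i> *\<^sub>C x"
proof -
  have "bounded_linear (\<lambda>x::'h. \<i> *\<^sub>C x)"
  proof (rule bounded_linear_intro[where K = 1])
    show "\<i> *\<^sub>C (r *\<^sub>R x) = r *\<^sub>R (\<i> *\<^sub>C x)" for r and x :: 'h
      by (simp add: scaleC_of_real[symmetric] scaleC_scaleC mult.commute)
    show "norm (\<i> *\<^sub>C x) \<le> norm x * 1" for x :: 'h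
      by (simp add: norm_eq_sqrt_ip ip_scaleC_left ip_scaleC_right norm_scaleC)
  qed (simp add: scaleC_add_right)
  then show ?thesis by (simp add: im_unit_def bounded_linear_Blinfun_apply)
qed

text \<open>
  The nontrivial half of the C*-identity: \<open>\<parallel>a x\<parallel>\<^sup>2 = \<parallel>\<langle>x, a\<^sup>* a x\<rangle>\<parallel>\<close>, then Cauchy-Schwarz.
\<close>

lemma norm_le_norm_st: assumes "a \<in> adjointables" shows "(norm a)\<^sup>2 \<le> norm (st a * a)"
proof -
  have "norm (ap a x) \<le> sqrt (norm (st a * a)) * norm x" for x
  proof -
    have "(norm (ap a x))\<^sup>2 = norm (ip x (ap (st a * a) x))"
      using norm_ip_self[of "ap a x"] ip_ap[OF assms] by simp
    also have "\<dots> \<le> norm x * norm (ap (st a * a) x)" by (rule cauchy_schwarz)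
    also have "\<dots> \<le> norm x * (norm (st a * a) * norm x)"
      by (intro mult_left_mono norm_ap) simp
    finally have "(norm (ap a x))\<^sup>2 \<le> (sqrt (norm (st a * a)) * norm x)\<^sup>2"
      by (simp add: power_mult_distrib power2_eq_square mult_ac)
    then show ?thesis by (rule power2_le_imp_le) simp
  qed
  then have "norm a \<le> sqrt (norm (st a * a))"
    unfolding norm_endo.rep_eq[of a] by (intro norm_blinfun_bound) simp_all
  then have "(norm a)\<^sup>2 \<le> (sqrt (norm (st a * a)))\<^sup>2" by (intro power_mono) simp_all
  then show ?thesis by simp
qed

lemma st_in: assumes "a \<in> adjointables" shows "st a \<in> adjointables" "st (st a) = a"
  using st_eqI[of "st a" a] ip_ap'[OF assms] by simp_all

lemma norm_st_le: assumes "a \<in> adjointables" shows "norm (st a) \<le> norm a"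
proof (cases "norm (st a) = 0")
  case False
  have "norm (st a) * norm (st a) \<le> norm (a * st a)"
    using norm_le_norm_st[of "st a"] st_in[OF assms] by (simp add: power2_eq_square)
  also have "\<dots> \<le> norm a * norm (st a)" by (rule norm_mult_ineq)
  finally show ?thesis using False by simp
qed simp

lemma st_arith:
  assumes "a \<in> adjointables" "b \<in> adjointables"
  shows "a + b \<in> adjointables" "st (a + b) = st a + st b"
    "a * b \<in> adjointables" "st (a * b) = st b * st a"
    "r *\<^sub>R a \<in> adjointables" "st (r *\<^sub>R a) = r *\<^sub>R st a"
  using st_eqI[of "a + b" "st a + st b"] st_eqI[of "a * b" "st b * st a"]
    st_eqI[of "r *\<^sub>R a" "r *\<^sub>R st a"] assms
  by (simp_all add: ip_ap ip_add_left ip_add_right ip_scaleR_left ip_scaleR_right)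

text \<open>
  Adjoints of a convergent sequence form a Cauchy sequence because taking adjoints does not increase
  norms; their limit is an adjoint of the limit.
\<close>

lemma closed_adjointables: "closed adjointables"
  unfolding closed_sequential_limits
proof (intro allI impI, elim conjE)
  fix X a assume X: "\<forall>n. X n \<in> adjointables" "X \<longlonglongrightarrow> a"
  have d: "norm (st (X m) - st (X n)) \<le> norm (X m - X n)" for m n
  proof -
    have "st (X m - X n) = st (X m) - st (X n)"
      using st_arith[of "X m" "(-1) *\<^sub>R X n"] st_arith(5,6)[of "X n" "X n" "-1"] X(1) by simp
    moreover have "X m - X n \<in> adjointables"
      using st_arith(1)[of "X m" "(-1) *\<^sub>R X n"] st_arith(5)[of "X n" "X n" "-1"] X(1) by simp
    ultimately show ?thesis using norm_st_le[of "X m - X n"] by simp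
  qed
  have "Cauchy (\<lambda>n. st (X n))"
  proof (rule metric_CauchyI)
    fix e :: real assume "e > 0"
    then obtain N where N: "\<And>m n. m \<ge> N \<Longrightarrow> n \<ge> N \<Longrightarrow> dist (X m) (X n) < e"
      using metric_CauchyD[OF LIMSEQ_imp_Cauchy[OF X(2)]] by blast
    have "dist (st (X m)) (st (X n)) < e" if "m \<ge> N" "n \<ge> N" for m n
      using d[of m n] N[OF that] by (simp add: dist_norm)
    then show "\<exists>N. \<forall>m\<ge>N. \<forall>n\<ge>N. dist (st (X m)) (st (X n)) < e" by blast
  qed
  then obtain b where b: "(\<lambda>n. st (X n)) \<longlonglongrightarrow> b"
    using Cauchy_convergent convergent_def by blast
  have "ip (ap a x) y = ip x (ap b y)" for x y
  proof (rule LIMSEQ_unique)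
    show "(\<lambda>n. ip (ap (X n) x) y) \<longlonglongrightarrow> ip (ap a x) y"
      by (intro ip.tendsto ap_lim X(2) tendsto_const)
    have "(\<lambda>n. ip x (ap (st (X n)) y)) \<longlonglongrightarrow> ip x (ap b y)"
      by (intro ip.tendsto ap_lim b tendsto_const)
    then show "(\<lambda>n. ip (ap (X n) x) y) \<longlonglongrightarrow> ip x (ap b y)"
      using X(1) by (simp add: ip_ap)
  qed
  then show "a \<in> adjointables" by (rule st_eqI)
qed

sublocale cstar_subalgebra adjointables st im_unit
proof
  show "closed adjointables" by (rule closed_adjointables)
  show "1 \<in> adjointables" by (rule st_eqI(1)[of 1 1]) simp
  show "norm (st a * a) = (norm a)\<^sup>2" if "a \<in> adjointables" for a
  proof (rule antisym[OF _ norm_le_norm_st[OF that]])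
    have "norm (st a * a) \<le> norm (st a) * norm a" by (rule norm_mult_ineq)
    also have "\<dots> \<le> norm a * norm a" by (intro mult_right_mono norm_st_le that) simp
    finally show "norm (st a * a) \<le> (norm a)\<^sup>2" by (simp add: power2_eq_square)
  qed
  have i: "ip (ap im_unit x) y = ip x (ap (- im_unit) y)" for x y
    by (simp add: ap_im_unit ip_scaleC_left ip_scaleC_right ip.minus_right)
      (simp add: scaleC_Re_Im[of "- \<i>"])
  show "im_unit \<in> adjointables" "st im_unit = - im_unit" by (rule st_eqI[OF i])+
  show "im_unit * im_unit = - 1"
    by (rule endo_eqI) (simp add: ap_im_unit scaleC_scaleC, simp add: scaleC_Re_Im[of "-1"])
  show "im_unit * a = a * im_unit" if "a \<in> adjointables" for a
  proof (rule endo_eqI)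
    fix x
    have "\<i> *\<^sub>C ap a x = ap a (\<i> *\<^sub>C x)"
    proof (rule ip_eqI)
      fix y
      show "ip y (\<i> *\<^sub>C ap a x) = ip y (ap a (\<i> *\<^sub>C x))"
        by (simp add: ip_ap'[OF that, symmetric] ip_scaleC_right)
    qed
    then show "ap (im_unit * a) x = ap (a * im_unit) x" by (simp add: ap_im_unit)
  qed
qed (use st_in st_arith in auto)

end

section \<open>The Cauchy-Schwarz inequality in Hilbert modules\<close>

global_interpretation self_module: cs_module "\<lambda>(a::'a::cstar_algebra) b. star a * b"
  defines self_st = "self_module.st" and self_adjointables = "self_module.adjointables"
proof
  show "norm x = sqrt (norm (star x * x))" for x :: 'a by (simp add: cstar_identity)
  show "norm (star x * y) \<le> norm x * norm y" for x y :: 'a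
    using norm_mult_ineq[of "star x" y] by (simp add: norm_star)
qed (simp_all add: distrib_left mult_scaleC_right star_mult star_star)

text \<open>
  Left multiplications embed a C*-algebra, unital or not, isometrically into the unital algebra of
  adjointable operators on it.
\<close>

definition left_mult :: "'a::cstar_algebra \<Rightarrow> 'a endo" where
  "left_mult b = endo (blinfun_mult_right b)"

lemma ap_left_mult [simp]: "ap (left_mult b) x = b * x"
  by (simp add: left_mult_def)

lemma left_mult_arith:
  "left_mult (a + b) = left_mult a + left_mult b" "left_mult (a - b) = left_mult a - left_mult b"
  "left_mult (a * b) = left_mult a * left_mult b" "left_mult (r *\<^sub>R a) = r *\<^sub>R left_mult a"
  by (rule endo_eqI, simp add: algebra_simps)+

lemma left_mult_star:
  "left_mult b \<in> self_adjointables" "self_st (left_mult b) = left_mult (star b)"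
  by (rule self_module.st_eqI[where b = "left_mult (star b)"]; simp add: star_mult mult.assoc)+

lemma norm_left_mult: "norm (left_mult b) = norm b"
proof (rule antisym)
  show "norm (left_mult b) \<le> norm b"
    unfolding norm_endo.rep_eq by (rule norm_blinfun_bound) (simp_all add: norm_mult_ineq)
  show "norm b \<le> norm (left_mult b)"
  proof (cases "b = 0")
    case False
    have "norm b * norm b = norm (b * star b)"
      using cstar_identity[of "star b"] by (simp add: star_star norm_star power2_eq_square)
    also have "\<dots> \<le> norm (left_mult b) * norm b"
      using norm_ap[of "left_mult b" "star b"] by (simp add: norm_star)
    finally show ?thesis using False by simp
  qed simp
qed

context hilbert_module
begin

lemma pos_left_mult_ip: "self_module.pos (left_mult (ip x x))"
proof -
  obtain b where "ip x x = star b * b" using ip_positive by (auto simp: cstar_positive_def)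
  then have "left_mult (ip x x) = self_st (left_mult b) * left_mult b"
    by (simp add: left_mult_arith left_mult_star)
  then show ?thesis using self_module.pos_star_mult[OF left_mult_star(1)] by metis
qed

text \<open>
  For \<open>a = \<langle>x, y\<rangle>\<close>, \<open>t = \<parallel>x\<parallel>\<^sup>2\<close> and \<open>v = x a - t y\<close> one finds
  \<open>t\<^sup>2 \<langle>y, y\<rangle> - t a\<^sup>* a = \<langle>v, v\<rangle> + a\<^sup>* (t - \<langle>x, x\<rangle>) a\<close>. Both summands are positive as left
  multiplications, so that \<open>t \<parallel>a\<parallel>\<^sup>2 \<le> t\<^sup>2 \<parallel>y\<parallel>\<^sup>2\<close>.
\<close>

lemma cauchy_schwarz: "norm (ip x y) \<le> norm x * norm y"
proof (cases "x = 0")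
  case True
  have "ip y (0 + 0) = ip y 0 + ip y 0" by (rule ip_add_right)
  then have "ip y 0 = 0" by simp
  then have "ip 0 y = 0" using star_ip[of y 0] star_scaleR[of 0 "0::'a"] by simp
  then show ?thesis using True by simp
next
  case False
  define t where "t = (norm x)\<^sup>2"
  have t: "t > 0" using False by (simp add: t_def)
  have txx: "norm (ip x x) = t" by (simp add: t_def norm_eq_sqrt_ip)
  define a where "a = ip x y"
  have R: "ip u (r *\<^sub>R v) = r *\<^sub>R ip u v" for u v r
    using ip_scaleC_right[of u "of_real r" v] by (simp add: scaleC_of_real)
  have Rl: "ip (r *\<^sub>R u) v = r *\<^sub>R ip u v" for u v r
    by (metis R star_ip star_scaleR)
  have Al: "ip (u + w) v = ip u v + ip w v" for u v w
    by (metis ip_add_right star_ip star_add)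
  have actl: "ip (act u c) v = star c * ip u v" for u c v
    by (metis ip_act_right star_ip star_mult star_star)
  define v where "v = act x a + (- t) *\<^sub>R y"
  have "ip y x = star a" by (simp add: a_def star_ip)
  then have vv: "ip v v = star a * (ip x x * a) - t *\<^sub>R (star a * a) - t *\<^sub>R (star a * a) + (t * t) *\<^sub>R ip y y"
    by (simp only: v_def Al Rl R ip_add_right actl ip_act_right a_def[symmetric])
      (simp add: scaleR_diff_right left_diff_distrib mult.assoc)
  define p where "p = self_st (left_mult a) * (t *\<^sub>R 1 - left_mult (ip x x)) * left_mult a"
  have "self_module.pos (t *\<^sub>R 1 - left_mult (ip x x))"
    using pos_left_mult_ip txx by (intro self_module.scalar_minus_pos) (simp_all add: norm_left_mult)
  then have "self_module.pos p"
    unfolding p_def by (intro self_module.pos_conj left_mult_star)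
  then have "self_module.pos (left_mult (ip v v) + p)"
    using pos_left_mult_ip by (intro self_module.pos_add)
  moreover have "left_mult (ip v v) + p = left_mult ((t * t) *\<^sub>R ip y y) - left_mult (t *\<^sub>R (star a * a))"
    unfolding vv p_def by (simp add: left_mult_arith left_mult_star algebra_simps)
  moreover have "self_module.pos (left_mult (t *\<^sub>R (star a * a)))"
    using t self_module.pos_star_mult[OF left_mult_star(1)[of a]]
    by (simp add: left_mult_arith left_mult_star self_module.pos_scaleR)
  ultimately have "norm (left_mult (t *\<^sub>R (star a * a))) \<le> norm (left_mult ((t * t) *\<^sub>R ip y y))"
    by (intro self_module.pos_mono_norm) simp_all
  then have "t * (norm a)\<^sup>2 \<le> t * (t * (norm y)\<^sup>2)"
    using t by (simp add: norm_left_mult cstar_identity norm_eq_sqrt_ip[of y] abs_mult)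
  then have "(norm a)\<^sup>2 \<le> t * (norm y)\<^sup>2" using t by simp
  then have "(norm a)\<^sup>2 \<le> (norm x * norm y)\<^sup>2" by (simp add: t_def power_mult_distrib)
  then show ?thesis unfolding a_def by (rule power2_le_imp_le) simp
qed

end

lemma hilbert_module_imp_cs_module: "hilbert_module act ip \<Longrightarrow> cs_module ip"
  unfolding cs_module_def
  by (auto intro: hilbert_module.ip_add_right hilbert_module.ip_scaleC_right hilbert_module.star_ip
      hilbert_module.norm_eq_sqrt_ip hilbert_module.cauchy_schwarz)

context cs_module
begin

section \<open>Spectra, powers and polar decompositions of operators\<close>

lemma blin_in_adjointable_ops: "blin a \<in> adjointable_ops ip \<longleftrightarrow> a \<in> adjointables"
  by (simp add: adjointables_def)

lemma op_spectrum_iff: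
  "z \<in> op_spectrum ip (blin s) \<longleftrightarrow> \<not> invertible_in (Re z *\<^sub>R 1 + Im z *\<^sub>R im_unit - s)"
proof -
  define w where "w = Re z *\<^sub>R 1 + Im z *\<^sub>R im_unit - s"
  have zx: "z *\<^sub>C x - ap s x = ap w x" for x
    using scaleC_Re_Im[of z x] by (simp add: w_def ap_im_unit)
  have "(\<exists>R\<in>adjointable_ops ip. \<forall>x. blinfun_apply R (ap w x) = x \<and> ap w (blinfun_apply R x) = x)
      \<longleftrightarrow> invertible_in w"
  proof
    assume "\<exists>R\<in>adjointable_ops ip. \<forall>x. blinfun_apply R (ap w x) = x \<and> ap w (blinfun_apply R x) = x"
    then obtain R where R: "R \<in> adjointable_ops ip"
      "\<And>x. blinfun_apply R (ap w x) = x" "\<And>x. ap w (blinfun_apply R x) = x" by blast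
    then have "endo R \<in> adjointables" "endo R * w = 1" "w * endo R = 1"
      by (auto simp: adjointables_def intro!: endo_eqI)
    then show "invertible_in w" by (auto simp: invertible_in_def)
  next
    assume "invertible_in w"
    then obtain r where r: "r \<in> adjointables" "r * w = 1" "w * r = 1" by (auto simp: invertible_in_def)
    have "ap r (ap w x) = x" "ap w (ap r x) = x" for x
      using r(2,3) by (metis ap_simps(1,2))+
    then show "\<exists>R\<in>adjointable_ops ip. \<forall>x. blinfun_apply R (ap w x) = x \<and> ap w (blinfun_apply R x) = x"
      using r(1) by (intro bexI[of _ "blin r"]) (auto simp: adjointables_def)
  qed
  then show ?thesis unfolding op_spectrum_def mem_Collect_eq w_def[symmetric] by (simp add: zx)
qed

lemma of_real_in_op_spectrum: "complex_of_real t \<in> op_spectrum ip (blin s) \<longleftrightarrow> t \<in> rspec s"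
  by (simp add: op_spectrum_iff rspec_def)

text \<open>
  Nonreal points \<open>z\<close> are excluded from the spectrum of a positive \<open>s\<close> by splitting
  \<open>z - s = A + B\<close> into its self-adjoint part \<open>A\<close> and the imaginary multiple \<open>B\<close> of the identity:
  the product of \<open>A + B\<close> and \<open>A - B\<close> is \<open>A\<^sup>2 + (Im z)\<^sup>2\<close>, which is invertible.
\<close>

lemma op_positive_iff: "op_positive ip (blin s) \<longleftrightarrow> pos s"
proof
  assume p: "op_positive ip (blin s)"
  then have "selfadj s"
    by (intro selfadjI) (simp_all add: op_positive_def adjointables_def st_def blin_inverse)
  moreover have "rspec s \<subseteq> {0..}"
  proof
    fix t assume "t \<in> rspec s"
    then have "complex_of_real t \<in> complex_of_real ` {0..}"
      using p of_real_in_op_spectrum unfolding op_positive_def by blast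
    then show "t \<in> {0..}" by auto
  qed
  ultimately show "pos s" by (simp add: pos_iff_rspec)
next
  assume s: "pos s"
  have "z \<in> complex_of_real ` {0..}" if z: "z \<in> op_spectrum ip (blin s)" for z
  proof -
    define A where "A = Re z *\<^sub>R 1 - s"
    define B where "B = Im z *\<^sub>R im_unit"
    have AL: "A \<in> adjointables" "B \<in> adjointables" using s by (simp_all add: A_def B_def)
    have AB: "A * B = B * A" unfolding B_def using J_comm[OF AL(1)] by simp
    have BB: "B * B = - ((Im z)\<^sup>2 *\<^sub>R 1)" by (simp add: B_def J_J power2_eq_square)
    have "Im z = 0"
    proof (rule ccontr)
      assume "Im z \<noteq> 0"
      then have "invertible_in (A * A + (Im z)\<^sup>2 *\<^sub>R 1)"
        unfolding A_def using s by (intro quadratic_invertible) simp_all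
      moreover have "(A + B) * (A - B) = A * A + (Im z)\<^sup>2 *\<^sub>R 1" "(A - B) * (A + B) = A * A + (Im z)\<^sup>2 *\<^sub>R 1"
        using AB BB by (simp_all add: algebra_simps)
      ultimately have "invertible_in (A + B)"
        using AL invertible_factor[of "A + B" "A - B"] by simp
      then show False using z unfolding op_spectrum_iff A_def B_def by (simp add: algebra_simps)
    qed
    then have "z = complex_of_real (Re z)" by (simp add: complex_eq_iff)
    moreover have "Re z \<in> rspec s" using z calculation of_real_in_op_spectrum by metis
    then have "Re z \<ge> 0" using pos_rspec[OF s] by auto
    ultimately show ?thesis by (metis atLeast_iff imageI)
  qed
  moreover have "st s = s" "s \<in> adjointables" using s by simp_all
  then have "adjoint_op ip (blin s) = blin s" by (metis blin_st)
  ultimately show "op_positive ip (blin s)"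
    using \<open>s \<in> adjointables\<close> by (auto simp: op_positive_def adjointables_def)
qed

lemma blin_sum: "blin (sum f S) = (\<Sum>i\<in>S. blin (f i))"
  by (induction S rule: infinite_finite_induct) (simp_all add: zero_endo.rep_eq plus_endo.rep_eq)

lemma op_poly_blin: "op_poly p (blin s) = blin (poly_at p s)"
proof -
  have "op_power (blin s) i = blin (s ^ i)" for i
    by (induction i) (simp_all add: one_endo.rep_eq times_endo.rep_eq)
  then show ?thesis by (simp add: op_poly_def poly_at_def blin_sum scaleR_endo.rep_eq)
qed

lemma op_cfc_blin:
  assumes "pos s" "contf f" shows "op_cfc ip f (blin s) = blin (cfc f s)"
proof -
  have eq: "(\<forall>p. uniform_limit {t. complex_of_real t \<in> op_spectrum ip (blin s)} (\<lambda>n. poly (p n)) f sequentially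
      \<longrightarrow> (\<lambda>n. op_poly (p n) (blin s)) \<longlonglongrightarrow> C) \<longleftrightarrow> is_cfc f s (endo C)" for C
    unfolding is_cfc_def op_poly_blin of_real_in_op_spectrum
    by (simp add: blin_lim_iff[symmetric])
  show ?thesis
    unfolding op_cfc_def eq
  proof (rule the_equality)
    show "is_cfc f s (endo (blin (cfc f s)))" using is_cfc_cfc[OF assms] by (simp add: blin_inverse)
    show "C = blin (cfc f s)" if "is_cfc f s (endo C)" for C
      using is_cfc_unique[OF assms that is_cfc_cfc[OF assms]] by (metis blin_endo)
  qed
qed

lemma op_powr_blin: "pos s \<Longrightarrow> a > 0 \<Longrightarrow> op_powr ip (blin s) a = blin (cpow s a)"
  unfolding op_powr_def cpow_def by (intro op_cfc_blin contf_powr)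

definition modulus :: "'h endo \<Rightarrow> 'h endo" where
  "modulus a = cpow (st a * a) (1/2)"

lemma op_abs_blin: "a \<in> adjointables \<Longrightarrow> op_abs ip (blin a) = blin (modulus a)"
  using op_powr_blin[of "st a * a" "1/2"] pos_star_mult[of a]
  by (simp add: op_abs_def modulus_def times_endo.rep_eq)

lemma pos_modulus: "a \<in> adjointables \<Longrightarrow> pos (modulus a)"
  unfolding modulus_def by (intro cpow_pos pos_star_mult) simp_all

lemma modulus_square: "a \<in> adjointables \<Longrightarrow> modulus a * modulus a = st a * a"
  unfolding modulus_def by (intro cpow_half_square pos_star_mult)

lemma modulus_eqI: "pos d \<Longrightarrow> d * d = st a * a \<Longrightarrow> modulus a = d"
  unfolding modulus_def using cpow_half[of d] by simp

lemma commutator_blin: "commutator (blin a) (blin b) = 0 \<longleftrightarrow> a * b = b * a"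
proof -
  have "commutator (blin a) (blin b) = blin (a * b - b * a)"
    by (simp add: commutator_def minus_endo.rep_eq times_endo.rep_eq)
  then show ?thesis by (metis blin_inject eq_iff_diff_eq_0 zero_endo.rep_eq)
qed

subsection \<open>Range projections\<close>

definition proj :: "'h endo \<Rightarrow> bool" where
  "proj e \<longleftrightarrow> selfadj e \<and> e * e = e"

definition range_proj :: "'h endo \<Rightarrow> 'h endo \<Rightarrow> bool" where
  "range_proj d e \<longleftrightarrow> proj e \<and> closure (range (ap d)) = range (ap e)"

lemma proj_selfadj [simp]: "proj e \<Longrightarrow> selfadj e" and proj_idem [simp]: "proj e \<Longrightarrow> e * e = e"
  by (simp_all add: proj_def)

lemma range_proj_proj: "range_proj d e \<Longrightarrow> proj e"
  by (simp add: range_proj_def)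

lemma range_proj_eq: assumes "proj e" shows "range (ap e) = {x. ap e x = x}"
proof -
  have "ap e (ap e x) = ap e x" for x using assms by (metis ap_simps(1) proj_idem)
  then show ?thesis by auto (metis rangeI)
qed

lemma closed_range_proj: "proj e \<Longrightarrow> closed (range (ap e))"
  unfolding range_proj_eq by (intro closed_Collect_eq continuous_intros blinfun.continuous_on)

lemma range_proj_left: assumes "range_proj d e" shows "e * d = d"
proof (rule endo_eqI)
  fix x
  have "ap d x \<in> closure (range (ap d))" by (rule subsetD[OF closure_subset]) simp
  then have "ap d x \<in> range (ap e)" using assms by (simp add: range_proj_def)
  then show "ap (e * d) x = ap d x" using range_proj_eq[OF range_proj_proj[OF assms]] by simp
qed

lemma range_proj_approx: assumes "range_proj d e" "h > 0" obtains y where "norm (ap d y - ap e x) < h"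
proof -
  have "ap e x \<in> closure (range (ap d))" using assms by (simp add: range_proj_def)
  then obtain z where "z \<in> range (ap d)" "dist z (ap e x) < h"
    using assms(2) unfolding closure_approachable by blast
  then show thesis using that by (auto simp: dist_norm)
qed

lemma range_projI:
  assumes "proj e" "e * d = d" "\<And>x h. h > 0 \<Longrightarrow> \<exists>y. norm (ap d y - ap e x) < h"
  shows "range_proj d e"
proof -
  have "range (ap d) \<subseteq> range (ap e)" using assms(2) by (metis ap_simps(1) image_subsetI rangeI)
  then have "closure (range (ap d)) \<subseteq> range (ap e)"
    using closed_range_proj[OF assms(1)] by (rule closure_minimal)
  moreover have "ap e x \<in> closure (range (ap d))" for x
    unfolding closure_approachable
  proof (intro allI impI)
    fix h :: real assume "h > 0"
    then obtain y where "norm (ap d y - ap e x) < h" using assms(3) by blast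
    then show "\<exists>z\<in>range (ap d). dist z (ap e x) < h" by (auto simp: dist_norm)
  qed
  ultimately show ?thesis using assms(1) by (auto simp: range_proj_def)
qed

text \<open>
  Identities between bounded operators extend from the range of \<open>d\<close> to its closure.
\<close>

lemma range_proj_kill: assumes "range_proj d e" "k * d = 0" shows "k * e = 0"
proof (rule endo_eqI)
  fix x
  have "norm (ap k (ap e x)) \<le> 0"
  proof (rule field_le_epsilon)
    fix h :: real assume h: "h > 0"
    define c where "c = norm k + 1"
    have c: "c > 0" by (simp add: c_def add_nonneg_pos)
    obtain y where y: "norm (ap d y - ap e x) < h / c"
      using range_proj_approx[OF assms(1), of "h / c" x] h c by (meson divide_pos_pos)
    have kd: "ap k (ap d y) = 0" using assms(2) by (metis ap_simps(1,3))
    have "norm (ap k (ap e x)) = norm (ap k (ap d y - ap e x))" using kd by simp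
    also have "\<dots> \<le> norm k * norm (ap d y - ap e x)" by (rule norm_ap)
    also have "\<dots> \<le> c * (h / c)" using y c by (intro mult_mono) (simp_all add: c_def)
    finally show "norm (ap k (ap e x)) \<le> 0 + h" using c by simp
  qed
  then show "ap (k * e) x = ap 0 x" by simp
qed

lemma range_proj_kill': assumes "range_proj d e" "selfadj d" "d * k = 0" "k \<in> adjointables" shows "e * k = 0"
proof -
  have e: "selfadj e" using range_proj_proj[OF assms(1)] by simp
  have "st k * d = 0" using assms st_mult[of d k] by simp
  then have "st k * e = 0" by (rule range_proj_kill[OF assms(1)])
  then have "st (st k * e) = 0" by simp
  then show ?thesis using assms(4) e by simp
qed

text \<open>
  Since \<open>c\<close> and its adjoint both leave the range of \<open>d\<close> invariant, its closure is a reducing subspace.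
\<close>

lemma range_proj_comm:
  assumes "range_proj d e" "c * d = d * c" "st c * d = d * st c" "c \<in> adjointables"
  shows "c * e = e * c"
proof -
  have e: "selfadj e" "e * e = e" using range_proj_proj[OF assms(1)] by simp_all
  have *: "e * b * e = b * e" if "b * d = d * b" for b
  proof -
    have "(e * b - b) * d = e * (b * d) - b * d" by (simp add: left_diff_distrib mult.assoc)
    also have "\<dots> = (e * d) * b - d * b" by (simp add: that mult.assoc)
    also have "\<dots> = 0" using range_proj_left[OF assms(1)] by simp
    finally have "(e * b - b) * e = 0" by (rule range_proj_kill[OF assms(1)])
    then show ?thesis by (simp add: left_diff_distrib)
  qed
  have "e * st c * e = st c * e" by (rule *) fact
  then have "st (e * st c * e) = st (st c * e)" by simp
  then have "e * (c * e) = e * c" using e assms(4) by simp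
  then show ?thesis using *[OF assms(2)] by (simp add: mult.assoc)
qed

text \<open>
  An element of the range of \<open>e g\<close> has the form \<open>g (e x)\<close>. Approximate \<open>e x\<close> by \<open>d y\<close>, move \<open>g\<close> past
  \<open>d\<close>, and approximate \<open>g y\<close> by a value of \<open>f\<close>.
\<close>

lemma range_proj_mult:
  assumes d: "range_proj d e" and f: "range_proj f g" and eg: "e * g = g * e"
    and gd: "g * d = d * g"
  shows "range_proj (d * f) (e * g)"
proof (rule range_projI)
  have e: "selfadj e" "e * e = e" and g: "selfadj g" "g * g = g"
    using range_proj_proj[OF d] range_proj_proj[OF f] by simp_all
  have "e * g * (e * g) = (e * e) * (g * g)" by (metis eg mult.assoc)
  then have "e * g * (e * g) = e * g" by (simp only: e g)
  then show "proj (e * g)" unfolding proj_def using selfadj_mult[OF e(1) g(1) eg] by blast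
  have "e * g * (d * f) = (e * d) * (g * f)" by (metis gd mult.assoc)
  then show "e * g * (d * f) = d * f" by (simp add: range_proj_left[OF d] range_proj_left[OF f])
  fix x and h :: real assume h: "h > 0"
  \<comment> \<open>Tolerances with \<open>norm + 1\<close> make sense also if \<open>g\<close> or \<open>d\<close> vanishes.\<close>
  obtain y where y: "norm (ap d y - ap e x) < h / (2 * (norm g + 1))"
    using range_proj_approx[OF d] h by (meson add_nonneg_pos divide_pos_pos mult_pos_pos norm_ge_zero zero_less_numeral zero_less_one)
  obtain z where z: "norm (ap f z - ap g y) < h / (2 * (norm d + 1))"
    using range_proj_approx[OF f] h by (meson add_nonneg_pos divide_pos_pos mult_pos_pos norm_ge_zero zero_less_numeral zero_less_one)
  have bound: "norm (ap k v) < h/2" if "norm v < h / (2 * (norm k + 1))" for k v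
  proof -
    have k: "norm k + 1 > 0" by (simp add: add_nonneg_pos)
    have "norm (ap k v) \<le> norm k * norm v" by (rule norm_ap)
    also have "\<dots> \<le> (norm k + 1) * norm v" by (intro mult_right_mono) simp_all
    also have "\<dots> < (norm k + 1) * (h / (2 * (norm k + 1)))" using that k by (intro mult_strict_left_mono)
    also have "\<dots> = h / 2"
    proof -
      have "c * (h / (2 * c)) = h / 2" if "c > 0" for c :: real using that by simp
      from this[OF k] show ?thesis .
    qed
    finally show ?thesis .
  qed
  have gdy: "ap d (ap g y) = ap g (ap d y)" using gd by (metis ap_simps(1))
  have "ap (e * g) x = ap g (ap e x)" using eg by (metis ap_simps(1))
  then have "ap (d * f) z - ap (e * g) x = ap d (ap f z - ap g y) + ap g (ap d y - ap e x)"
    using gdy by simp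
  then have "norm (ap (d * f) z - ap (e * g) x) \<le> norm (ap d (ap f z - ap g y)) + norm (ap g (ap d y - ap e x))"
    by (metis norm_triangle_ineq)
  also have "\<dots> < h" using bound[OF y] bound[OF z] by simp
  finally show "\<exists>z. norm (ap (d * f) z - ap (e * g) x) < h" by blast
qed

lemma cpow_range: assumes "pos s" "a > 0" shows "range (ap (cpow s a)) \<subseteq> closure (range (ap s))"
proof
  fix y assume "y \<in> range (ap (cpow s a))"
  then obtain x where y: "y = ap (cpow s a) x" by blast
  obtain k where "(\<lambda>n. s * k n) \<longlonglongrightarrow> cpow s a" using cpow_approx[OF assms] by blast
  then have "(\<lambda>n. ap (s * k n) x) \<longlonglongrightarrow> ap (cpow s a) x" by (rule ap_lim)
  then show "y \<in> closure (range (ap s))" unfolding y closure_sequential by (auto intro!: exI)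
qed

text \<open>
  Both inclusions come from \<open>cpow_range\<close>, as \<open>s\<close> is in turn a power of each of its powers.
\<close>

lemma range_proj_cpow: assumes "pos s" "a > 0" "range_proj s e" shows "range_proj (cpow s a) e"
proof -
  have "s = cpow (cpow s a) (1/a)" using assms by (simp add: cpow_cpow cpow_1)
  then have "range (ap s) \<subseteq> closure (range (ap (cpow s a)))"
    using cpow_range[OF cpow_pos[OF assms(1,2)], of "1/a"] assms(2) by simp
  then have "closure (range (ap s)) = closure (range (ap (cpow s a)))"
    using cpow_range[OF assms(1,2)] by (intro antisym closure_minimal closed_closure)
  then show ?thesis using assms(3) by (simp add: range_proj_def)
qed

lemma selfadj_square_right_unit:
  assumes "selfadj k" "proj p" "p * (k * k) = k * k" shows "k * p = k" "p * k = k"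
proof -
  define r where "r = k - k * p"
  have rL: "r \<in> adjointables" using assms by (simp add: r_def)
  have "st r * r = (k - p * k) * (k - k * p)" using assms by (simp add: r_def)
  also have "\<dots> = (k * k - p * (k * k)) - (k * k - p * (k * k)) * p"
    by (simp add: algebra_simps)
  finally have "st r * r = 0" using assms(3) by simp
  then have "r = 0" using cstar[OF rL] by simp
  then show kp: "k * p = k" by (simp add: r_def)
  then have "st (k * p) = st k" by simp
  then show "p * k = k" using assms by simp
qed

subsection \<open>Polar decompositions\<close>

text \<open>
  Polar decompositions with the complemented closure of the range expressed through the operator
  \<open>st u * u\<close> itself; see \<open>polar_decomposition_iff\<close>.
\<close>

definition polar :: "'h endo \<Rightarrow> 'h endo \<Rightarrow> bool" where
  "polar b u \<longleftrightarrow> b \<in> adjointables \<and> u \<in> adjointables \<and> b = u * modulus b \<and> range_proj (st b) (st u * u)"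

lemma tendsto_in_closure: "g \<longlonglongrightarrow> l \<Longrightarrow> (\<And>n. g n \<in> S) \<Longrightarrow> l \<in> closure S" for S :: "'h set"
  unfolding closure_sequential by blast

lemma subspace_closure_range: "subspace (closure (range (ap a)))" for a :: "'h endo"
proof (rule subspaceI)
  show "0 \<in> closure (range (ap a))" using closure_subset by (metis ap_linear(3) rangeI subsetD)
  fix x y and c :: real assume x: "x \<in> closure (range (ap a))"
  then obtain f where f: "\<And>n. f n \<in> range (ap a)" "f \<longlonglongrightarrow> x" unfolding closure_sequential by blast
  have t1: "(\<lambda>n. c *\<^sub>R f n) \<longlonglongrightarrow> c *\<^sub>R x" by (intro tendsto_intros f)
  have t2: "c *\<^sub>R f n \<in> range (ap a)" for n
  proof -
    obtain z where "f n = ap a z" using f(1)[of n] by blast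
    then have "c *\<^sub>R f n = ap a (c *\<^sub>R z)" by simp
    then show ?thesis by blast
  qed
  show "c *\<^sub>R x \<in> closure (range (ap a))" by (rule tendsto_in_closure, rule t1, rule t2)
  assume "y \<in> closure (range (ap a))"
  then obtain g where g: "\<And>n. g n \<in> range (ap a)" "g \<longlonglongrightarrow> y" unfolding closure_sequential by blast
  have t3: "(\<lambda>n. f n + g n) \<longlonglongrightarrow> x + y" by (intro tendsto_intros f g)
  have t4: "f n + g n \<in> range (ap a)" for n
  proof -
    obtain z where "f n = ap a z" using f(1)[of n] by blast
    moreover obtain w where "g n = ap a w" using g(1)[of n] by blast
    ultimately have "f n + g n = ap a (z + w)" by simp
    then show ?thesis by blast
  qed
  show "x + y \<in> closure (range (ap a))" by (rule tendsto_in_closure, rule t3, rule t4)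
qed

lemma ortho_complement_proj: "proj e \<Longrightarrow> ortho_complement ip (range (ap e)) = {y. ap e y = 0}"
proof (intro set_eqI iffI)
  fix y assume e: "proj e" and "y \<in> ortho_complement ip (range (ap e))"
  then have "ip (ap e (ap e y)) y = 0" by (simp add: ortho_complement_def)
  then have "ip (ap e y) (ap e y) = 0" using e ip_ap[of e "ap e y" y] by simp
  then show "y \<in> {y. ap e y = 0}" using ip_self_0 by blast
next
  fix y assume e: "proj e" and "y \<in> {y. ap e y = 0}"
  then show "y \<in> ortho_complement ip (range (ap e))"
    using ip_ap[of e _ y] by (auto simp: ortho_complement_def ip.zero_right)
qed

text \<open>
  That \<open>M\<close> is complemented entails that the operator described by \<open>ortho_proj\<close> exists: the component
  of a vector in \<open>M\<close> is unique, hence depends linearly on the vector, and Cauchy-Schwarz bounds it.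
\<close>

lemma ortho_proj_iff:
  fixes M :: "'h set"
  assumes M: "subspace M" and e: "proj e"
  shows "ortho_complemented ip M \<and> blin e = ortho_proj ip M \<longleftrightarrow> M = range (ap e)"
proof
  assume M_eq: "M = range (ap e)"
  have C: "ortho_complement ip M = {y. ap e y = 0}" unfolding M_eq by (rule ortho_complement_proj[OF e])
  have ee: "ap e (ap e x) = ap e x" for x using e by (metis ap_simps(1) proj_idem)
  have "\<exists>x\<in>M. \<exists>y\<in>ortho_complement ip M. h = x + y" for h
    unfolding C unfolding M_eq
    by (rule bexI[of _ "ap e h"], rule bexI[of _ "h - ap e h"]) (simp_all add: ee)
  moreover have "M \<inter> ortho_complement ip M = {0}"
    unfolding C unfolding M_eq range_proj_eq[OF e] by auto
  ultimately have "ortho_complemented ip M" by (simp add: ortho_complemented_def)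
  moreover have "ortho_proj ip M = blin e"
    unfolding ortho_proj_def
  proof (rule the_equality)
    show "(\<forall>x\<in>M. ap e x = x) \<and> (\<forall>y\<in>ortho_complement ip M. ap e y = 0)"
      unfolding C unfolding M_eq by (auto simp: ee)
    fix P assume P: "(\<forall>x\<in>M. blinfun_apply P x = x) \<and> (\<forall>y\<in>ortho_complement ip M. blinfun_apply P y = 0)"
    show "P = blin e"
    proof (rule blinfun_eqI)
      fix h
      have "blinfun_apply P (h - ap e h) = 0" using P by (simp add: C ee)
      moreover have "blinfun_apply P (ap e h) = ap e h" using P by (simp add: M_eq)
      ultimately show "blinfun_apply P h = ap e h" by (simp add: blinfun.diff_right)
    qed
  qed
  ultimately show "ortho_complemented ip M \<and> blin e = ortho_proj ip M" by simp
next
  assume "ortho_complemented ip M \<and> blin e = ortho_proj ip M"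
  then have dec: "\<And>h. \<exists>x\<in>M. \<exists>y\<in>ortho_complement ip M. h = x + y"
    and int: "M \<inter> ortho_complement ip M = {0}" and eP: "blin e = ortho_proj ip M"
    by (auto simp: ortho_complemented_def)
  define N where "N = ortho_complement ip M"
  have N: "subspace N"
    by (rule subspaceI) (simp_all add: N_def ortho_complement_def ip_add_right ip_scaleR_right ip.zero_right)
  obtain p where p: "\<And>h. p h \<in> M" "\<And>h. h - p h \<in> N"
    using dec unfolding N_def[symmetric] by (metis add_diff_cancel_left')
  have p_eqI: "p h = x" if "x \<in> M" "h - x \<in> N" for h x
  proof -
    have "p h - x \<in> M" using subspace_diff[OF M] p that by blast
    moreover have "(h - x) - (h - p h) \<in> N" using subspace_diff[OF N] p that by blast
    ultimately have "p h - x \<in> M \<inter> N" by simp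
    then show ?thesis using int by (simp add: N_def)
  qed
  have "bounded_linear p"
  proof (rule bounded_linear_intro[where K = 1])
    show "p (x + y) = p x + p y" for x y
    proof (rule p_eqI)
      show "p x + p y \<in> M" using subspace_add[OF M] p by blast
      have "(x - p x) + (y - p y) \<in> N" using subspace_add[OF N] p by blast
      then show "x + y - (p x + p y) \<in> N" by (simp add: algebra_simps)
    qed
    show "p (r *\<^sub>R x) = r *\<^sub>R p x" for r x
    proof (rule p_eqI)
      show "r *\<^sub>R p x \<in> M" using subspace_scale[OF M] p by blast
      have "r *\<^sub>R (x - p x) \<in> N" using subspace_scale[OF N] p by blast
      then show "r *\<^sub>R x - r *\<^sub>R p x \<in> N" by (simp add: scaleR_diff_right)
    qed
    show "norm (p x) \<le> norm x * 1" for x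
    proof (cases "norm (p x) = 0")
      case False
      have "ip (p x) (x - p x) = 0" using p by (simp add: N_def ortho_complement_def)
      then have "ip (p x) (p x) = ip (p x) x" by (simp add: ip.diff_right)
      then have "norm (p x) * norm (p x) \<le> norm (p x) * norm x"
        using cauchy_schwarz[of "p x" x] norm_ip_self[of "p x"] by (simp add: power2_eq_square)
      then show ?thesis using False by simp
    qed simp
  qed
  then have pB: "blinfun_apply (Blinfun p) = p" by (rule bounded_linear_Blinfun_apply)
  have "ortho_proj ip M = Blinfun p"
    unfolding ortho_proj_def N_def[symmetric]
  proof (rule the_equality)
    show "(\<forall>x\<in>M. blinfun_apply (Blinfun p) x = x) \<and> (\<forall>y\<in>N. blinfun_apply (Blinfun p) y = 0)"
      unfolding pB using p_eqI subspace_0[OF M] subspace_0[OF N] by auto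
    fix P assume P: "(\<forall>x\<in>M. blinfun_apply P x = x) \<and> (\<forall>y\<in>N. blinfun_apply P y = 0)"
    show "P = Blinfun p"
    proof (rule blinfun_eqI)
      fix h
      have "blinfun_apply P (h - p h) = 0" "blinfun_apply P (p h) = p h" using P p by auto
      then show "blinfun_apply P h = blinfun_apply (Blinfun p) h" by (simp add: pB blinfun.diff_right)
    qed
  qed
  then have ap_e: "ap e = p" using eP pB by simp
  show "M = range (ap e)"
    unfolding ap_e using p p_eqI subspace_0[OF N] by (auto simp: image_iff) (metis diff_self)
qed

lemma polar_decomposition_iff: "polar_decomposition ip (blin b) (blin u) \<longleftrightarrow> polar b u"
proof (cases "b \<in> adjointables \<and> u \<in> adjointables \<and> proj (st u * u)")
  case True
  then have L: "b \<in> adjointables" "u \<in> adjointables" and p: "proj (st u * u)" by auto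
  have E: "blin (st u * u) = adjoint_op ip (blin u) o\<^sub>L blin u" by (simp add: times_endo.rep_eq)
  have "adjoint_op ip (blin (st u * u)) = blin (st u * u)"
    using p proj_selfadj selfadj_st blin_st by metis
  moreover have "blin (st u * u) o\<^sub>L blin (st u * u) = blin (st u * u)"
    using proj_idem[OF p] by (metis times_endo.rep_eq)
  moreover have "blin (st u * u) \<in> adjointable_ops ip" using L by (simp add: blin_in_adjointable_ops)
  ultimately have "partial_isometry ip (blin u)"
    using L by (simp add: partial_isometry_def op_projection_def E[symmetric] blin_in_adjointable_ops)
  moreover have "blin b = blin u o\<^sub>L op_abs ip (blin b) \<longleftrightarrow> b = u * modulus b"
    using L by (simp add: op_abs_blin times_endo.rep_eq[symmetric] blin_inject)
  ultimately show ?thesis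
    using L p ortho_proj_iff[OF subspace_closure_range p, of "st b"]
    by (simp add: polar_decomposition_def polar_def range_proj_def Let_def blin_in_adjointable_ops E)
next
  case False
  have "proj (st u * u)" if u: "u \<in> adjointables" and q: "op_projection ip (adjoint_op ip (blin u) o\<^sub>L blin u)"
  proof -
    have "adjoint_op ip (blin u) o\<^sub>L blin u = blin (st u * u)" by (simp add: times_endo.rep_eq)
    then have "blin (st u * u) o\<^sub>L blin (st u * u) = blin (st u * u)" using q by (simp add: op_projection_def)
    then have "st u * u * (st u * u) = st u * u" by (metis blin_inject times_endo.rep_eq)
    then show ?thesis using selfadj_intros(7)[OF u] unfolding proj_def by blast
  qed
  then show ?thesis
    using False by (auto simp: polar_decomposition_def polar_def range_proj_def partial_isometry_def blin_in_adjointable_ops)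
qed

end

subsection \<open>Moduli and ranges in a polar decomposition\<close>

lemma mult_left_rewrite: "a * b = c \<Longrightarrow> a * (b * x) = c * (x :: 'b::semigroup_mult)"
  by (simp add: mult.assoc[symmetric])

context cs_module
begin

text \<open>
  The range of \<open>b\<^sup>*\<close> equals the range of \<open>|b|\<close>, as \<open>b\<^sup>* = |b| u\<^sup>*\<close> and \<open>|b| = u\<^sup>* b = b\<^sup>* u\<close>.
\<close>

lemma polarD:
  assumes "polar b u"
  shows "b \<in> adjointables" "u \<in> adjointables" "u * modulus b = b" "proj (st u * u)"
    "st u * u * modulus b = modulus b" "modulus b * (st u * u) = modulus b"
    "range_proj (modulus b) (st u * u)" "u * (st u * u) = u" "st u * u * st u = st u"
proof -
  show L: "b \<in> adjointables" "u \<in> adjointables" and b: "u * modulus b = b"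
    using assms by (auto simp: polar_def)
  have r: "range_proj (st b) (st u * u)" using assms by (simp add: polar_def)
  show p: "proj (st u * u)" by (rule range_proj_proj[OF r])
  have selfadj_modulus: "selfadj (modulus b)" using pos_modulus[OF L(1)] by simp
  have pb: "st u * u * st b = st b" by (rule range_proj_left[OF r])
  have "st u * u * (modulus b * modulus b) = modulus b * modulus b"
    unfolding modulus_square[OF L(1)] using pb by (simp add: mult.assoc[symmetric])
  then show k: "modulus b * (st u * u) = modulus b" "st u * u * modulus b = modulus b"
    using selfadj_square_right_unit[OF selfadj_modulus p] by simp_all
  have ub: "st u * b = modulus b" using b k(2) by (metis mult.assoc)
  have "st b = modulus b * st u" using b L selfadj_modulus by (metis st_mult selfadj_L selfadj_st)
  then have 1: "range (ap (st b)) \<subseteq> range (ap (modulus b))" by auto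
  have "modulus b = st b * u" using ub L selfadj_modulus by (metis st_mult st_L st_st selfadj_st)
  then have 2: "range (ap (modulus b)) \<subseteq> range (ap (st b))" by (metis ap_simps(1) image_subsetI rangeI)
  have "range (ap (st b)) = range (ap (modulus b))" using 1 2 by (rule antisym)
  then show "range_proj (modulus b) (st u * u)" using r unfolding range_proj_def by (simp only:)
  define k where "k = u - u * (st u * u)"
  have kL: "k \<in> adjointables" using L by (simp add: k_def)
  have "st k * k = st u * u - st u * u * (st u * u) - (st u * u * (st u * u) - st u * u * (st u * u) * (st u * u))"
    using L by (simp add: k_def algebra_simps)
  then have "st k * k = 0" using proj_idem[OF p] by simp
  then have "k = 0" using cstar[OF kL] by simp
  then show uu: "u * (st u * u) = u" by (simp add: k_def)
  then have "st (u * (st u * u)) = st u" by simp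
  then show "st u * u * st u = st u" using L by (simp add: mult.assoc)
qed

lemma polarI:
  assumes L: "b \<in> adjointables" "w \<in> adjointables" and b: "b = w * modulus b"
    and r: "range_proj (modulus b) (st w * w)"
  shows "polar b w"
proof -
  have selfadj_modulus: "selfadj (modulus b)" using pos_modulus[OF L(1)] by simp
  have "st w * b = modulus b" using range_proj_left[OF r] b by (metis mult.assoc)
  then have "modulus b = st b * w" using L selfadj_modulus by (metis st_mult st_L st_st selfadj_st)
  then have 1: "range (ap (modulus b)) \<subseteq> range (ap (st b))" by (metis ap_simps(1) image_subsetI rangeI)
  have "st b = modulus b * st w" using b L selfadj_modulus by (metis st_mult selfadj_L selfadj_st)
  then have 2: "range (ap (st b)) \<subseteq> range (ap (modulus b))" by (metis ap_simps(1) image_subsetI rangeI)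
  have "range (ap (modulus b)) = range (ap (st b))" using 1 2 by (rule antisym)
  then show ?thesis using L b r unfolding polar_def range_proj_def by (simp only:)
qed

lemma cpow_proj:
  assumes "pos s" "r > 0" "proj p" "p * s = s"
  shows "p * cpow s r = cpow s r" "cpow s r * p = cpow s r"
proof -
  \<comment> \<open>As powers of \<open>0\<close> vanish, intertwining \<open>s\<close> with \<open>0\<close> shows that \<open>1 - p\<close> annihilates powers of \<open>s\<close>.\<close>
  have "(1 - p) * s = 0 * (1 - p)" using assms(4) by (simp add: left_diff_distrib)
  then have "(1 - p) * cpow s r = cpow 0 r * (1 - p)" using assms by (intro cpow_intertwine) simp_all
  then show 1: "p * cpow s r = cpow s r" using cpow_0[OF assms(2)] by (simp add: left_diff_distrib)
  have "selfadj (cpow s r)" using cpow_pos assms by simp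
  then have "st (p * cpow s r) = cpow s r * p" using assms by simp
  then show "cpow s r * p = cpow s r" using 1 \<open>selfadj (cpow s r)\<close> by simp
qed

text \<open>
  The operator \<open>u |b| u\<^sup>*\<close> is positive and has square \<open>b b\<^sup>*\<close>, so it is the modulus of \<open>b\<^sup>*\<close>.
\<close>

lemma polar_star:
  assumes "polar b u"
  shows "modulus (st b) = u * modulus b * st u" "proj (u * st u)" "range_proj (modulus (st b)) (u * st u)"
    "u * modulus b = modulus (st b) * u"
proof -
  note p = polarD[OF assms]
  have m: "pos (modulus b)" by (rule pos_modulus[OF p(1)])
  show n: "modulus (st b) = u * modulus b * st u"
  proof (rule modulus_eqI)
    show "pos (u * modulus b * st u)" using pos_conj[OF m, of "st u"] p by simp
    have sb: "st b = modulus b * st u" using p(2,3) m by (metis st_mult pos_selfadj selfadj_L selfadj_st)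
    have "u * modulus b * st u * (u * modulus b * st u) = u * modulus b * (st u * u * modulus b) * st u"
      by (simp add: mult.assoc)
    also have "\<dots> = (u * modulus b) * (modulus b * st u)" unfolding p(5) by (simp add: mult.assoc)
    also have "\<dots> = st (st b) * st b" unfolding p(3) sb[symmetric] using p(1) by simp
    finally show "u * modulus b * st u * (u * modulus b * st u) = st (st b) * st b" .
  qed
  have "u * st u * (u * st u) = (u * (st u * u)) * st u" by (simp add: mult.assoc)
  then show q: "proj (u * st u)" unfolding proj_def using p(2,8) selfadj_intros(8)[OF p(2)] by metis
  have "modulus (st b) * u = u * (modulus b * (st u * u))" unfolding n by (simp add: mult.assoc)
  then show inter: "u * modulus b = modulus (st b) * u" unfolding p(6) by simp
  show "range_proj (modulus (st b)) (u * st u)"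
  proof (rule range_projI[OF q])
    have "u * st u * modulus (st b) = (u * (st u * u)) * modulus b * st u" unfolding n by (simp add: mult.assoc)
    then show "u * st u * modulus (st b) = modulus (st b)" unfolding p(8) n .
    fix x and h :: real assume h: "h > 0"
    define k where "k = norm u + 1"
    have k: "k > 0" by (simp add: k_def add_nonneg_pos)
    obtain y where y: "norm (ap (modulus b) y - ap (st u * u) (ap (st u) x)) < h / k"
      using range_proj_approx[OF p(7), of "h / k" "ap (st u) x"] h k by (meson divide_pos_pos)
    have 1: "ap (modulus (st b)) (ap u y) = ap u (ap (modulus b) y)" using inter by (metis ap_simps(1))
    have 2: "ap (u * st u) x = ap u (ap (st u * u) (ap (st u) x))" using p(8) by (metis ap_simps(1))
    have "norm (ap (modulus (st b)) (ap u y) - ap (u * st u) x)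
        = norm (ap u (ap (modulus b) y - ap (st u * u) (ap (st u) x)))"
      unfolding 1 2 by (simp only: ap_linear)
    also have "\<dots> \<le> norm u * norm (ap (modulus b) y - ap (st u * u) (ap (st u) x))" by (rule norm_ap)
    also have "\<dots> \<le> k * norm (ap (modulus b) y - ap (st u * u) (ap (st u) x))"
      by (intro mult_right_mono) (simp_all add: k_def)
    also have "\<dots> < k * (h / k)" using y k by (intro mult_strict_left_mono)
    also have "\<dots> = h" using k by simp
    finally show "\<exists>y. norm (ap (modulus (st b)) y - ap (u * st u) x) < h" by blast
  qed
qed

lemma proj_idem_left [simp]: "proj e \<Longrightarrow> e * (e * x) = e * x"
  by (simp add: mult.assoc[symmetric])

end

section \<open>A pair of operators with commuting modulus\<close>

text \<open>
  In the names below, \<open>T\<close>, \<open>A\<close> and \<open>S\<close> refer to the operators \<open>t\<close>, \<open>a\<close> and \<open>t\<^sup>*\<close>; the prefix \<open>m\<close> marks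
  the modulus, \<open>p\<close> the projection onto the closure of its range, and the suffixes \<open>a\<close> and \<open>b\<close> its
  powers with exponents \<open>\<alpha>\<close> and \<open>\<beta>\<close>. The operator \<open>Z\<close> is kept as the product of \<open>C\<close>, positive
  because its factors commute, and \<open>Sb\<close>.
\<close>

locale polar_pair = cs_module ip
  for ip :: "'h::{complex_vector, banach} \<Rightarrow> 'h \<Rightarrow> 'a::cstar_algebra" +
  fixes t a u v :: "'h endo" and \<alpha> \<beta> :: real
  assumes polar_t: "polar t u" and polar_a: "polar a v"
    and comm: "modulus t * a = a * modulus t"
    and exponents: "\<alpha> > 0" "\<beta> > 0"
begin

definition "mT = modulus t"
definition "mA = modulus a"
definition "mS = modulus (st t)"
definition "pT = st u * u"
definition "pA = st v * v"
definition "pS = u * st u"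
definition "Ta = cpow mT \<alpha>"
definition "Tb = cpow mT \<beta>"
definition "Sb = cpow mS \<beta>"
definition "C = Ta * mA"
definition "pC = pA * pT"
definition "Z = C * Sb"
definition "Y = Ta * a * Sb"
definition "X = Ta * a * u * Tb"
definition "W = pT * v * u"

lemma adj [simp]: "t \<in> adjointables" "a \<in> adjointables" "u \<in> adjointables" "v \<in> adjointables"
  using polarD[OF polar_t] polarD[OF polar_a] by simp_all

lemma pos_m [simp]: "pos mT" "pos mA" "pos mS"
  by (simp_all add: mT_def mA_def mS_def pos_modulus)

lemma proj_p [simp]: "proj pT" "proj pA" "proj pS"
  using polarD(4)[OF polar_t] polarD(4)[OF polar_a] polar_star(2)[OF polar_t]
  by (simp_all add: pT_def pA_def pS_def)

lemma st_p [simp]: "st pT = pT" "st pA = pA" "st pS = pS"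
  using proj_selfadj[OF proj_p(1)] proj_selfadj[OF proj_p(2)] proj_selfadj[OF proj_p(3)] by (blast intro: selfadj_st)+

lemma p_adj [simp]: "pT \<in> adjointables" "pA \<in> adjointables" "pS \<in> adjointables"
  by (simp_all add: pT_def pA_def pS_def)

lemma u_rules: "st u * u = pT" "u * st u = pS" "u * pT = u" "pT * st u = st u" "pS * u = u" "st u * pS = st u"
  using polarD(8,9)[OF polar_t] by (simp_all add: pT_def pS_def mult.assoc)

lemma v_rules: "st v * v = pA" "v * pA = v" "pA * st v = st v"
  using polarD(8,9)[OF polar_a] by (simp_all add: pA_def mult.assoc)

lemma m_rules: "pT * mT = mT" "mT * pT = mT" "pA * mA = mA" "mA * pA = mA" "v * mA = a"
  using polarD(3,5,6)[OF polar_t] polarD(3,5,6)[OF polar_a]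
  by (simp_all add: pT_def pA_def mT_def mA_def)

lemma ranges: "range_proj mT pT" "range_proj mA pA" "range_proj mS pS"
  using polarD(7)[OF polar_t] polarD(7)[OF polar_a] polar_star(3)[OF polar_t]
  by (simp_all add: pT_def pA_def mT_def mA_def mS_def pS_def)

lemma mT_a: "mT * a = a * mT" "mT * st a = st a * mT"
proof -
  show 1: "mT * a = a * mT" using comm by (simp add: mT_def)
  have "st (mT * a) = st (a * mT)" using 1 by simp
  then show "mT * st a = st a * mT" by (simp add: pos_selfadj)
qed

lemma mT_mA: "mT * mA = mA * mT"
  unfolding mA_def modulus_def
proof (rule cpow_intertwine)
  show "mT * (st a * a) = st a * a * mT" using mT_a by (metis mult.assoc)
qed (simp_all add: pos_star_mult)

lemma pA_mT: "pA * mT = mT * pA"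
  using range_proj_comm[OF ranges(2) mT_mA] mT_mA by simp

text \<open>
  Both sides agree after multiplication by \<open>mA\<close>, since \<open>v |a| = a\<close> commutes with \<open>|t|\<close>, hence on the
  closure of the range of \<open>mA\<close>; on its complement both vanish.
\<close>

lemma mT_v: "mT * v = v * mT" "mT * st v = st v * mT"
proof -
  have "(mT * v - v * mT) * mA = mT * (v * mA) - v * (mT * mA)"
    by (simp add: left_diff_distrib mult.assoc)
  also have "\<dots> = mT * a - (v * mA) * mT" unfolding mT_mA
    by (simp add: m_rules(5) mult_left_rewrite[OF m_rules(5)] mult.assoc)
  also have "\<dots> = 0" by (simp add: m_rules mT_a)
  finally have "(mT * v - v * mT) * pA = 0" by (rule range_proj_kill[OF ranges(2)])
  then have "mT * (v * pA) = v * (mT * pA)" by (simp add: left_diff_distrib mult.assoc)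
  also have "\<dots> = (v * pA) * mT" using pA_mT by (simp add: mult.assoc)
  finally show 1: "mT * v = v * mT" by (simp add: v_rules)
  have "st (mT * v) = st (v * mT)" using 1 by simp
  then show "mT * st v = st v * mT" by (simp add: pos_selfadj)
qed

lemma pT_comm: "pT * v = v * pT" "pT * st v = st v * pT" "pT * mA = mA * pT" "pT * pA = pA * pT"
proof -
  have 1: "v * pT = pT * v" by (rule range_proj_comm[OF ranges(1)]) (simp_all add: mT_v)
  have 2: "st v * pT = pT * st v" by (rule range_proj_comm[OF ranges(1)]) (simp_all add: mT_v)
  have 3: "mA * pT = pT * mA" by (rule range_proj_comm[OF ranges(1)]) (simp_all add: mT_mA pos_selfadj)
  show "pT * v = v * pT" "pT * st v = st v * pT" "pT * mA = mA * pT" using 1 2 3 by simp_all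
  show "pT * pA = pA * pT" unfolding pA_def using 1 2 by (metis mult.assoc)
qed

lemma pos_pow [simp]: "pos Ta" "pos Tb" "pos Sb"
  using exponents by (simp_all add: Ta_def Tb_def Sb_def cpow_pos)

lemma Ta_comm: "v * Ta = Ta * v" "mA * Ta = Ta * mA" "pA * Ta = Ta * pA"
  unfolding Ta_def using exponents
  by (auto intro!: cpow_intertwine simp: mT_v mT_mA pA_mT)

lemma pow_rules: "pT * Ta = Ta" "Ta * pT = Ta" "pT * Tb = Tb" "Tb * pT = Tb" "pS * Sb = Sb" "Sb * pS = Sb"
  "u * Tb = Sb * u"
proof -
  show "pT * Ta = Ta" "Ta * pT = Ta" "pT * Tb = Tb" "Tb * pT = Tb"
    unfolding Ta_def Tb_def using exponents by (simp_all add: cpow_proj m_rules)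
  have "pS * mS = mS" by (rule range_proj_left[OF ranges(3)])
  then show "pS * Sb = Sb" "Sb * pS = Sb" unfolding Sb_def using exponents by (simp_all add: cpow_proj)
  show "u * Tb = Sb * u"
    unfolding Tb_def Sb_def using exponents polar_star(4)[OF polar_t]
    by (intro cpow_intertwine) (simp_all add: mT_def mS_def pos_modulus)
qed

lemma pos_C [simp]: "pos C"
  unfolding C_def by (rule pos_mult) (simp_all add: Ta_comm)

lemma C_rules: "pT * C = C" "pA * C = C"
proof -
  show "pT * C = C" unfolding C_def using pow_rules(1) by (metis mult.assoc)
  show "pA * C = C" unfolding C_def using Ta_comm(3) m_rules(3) by (metis mult.assoc)
qed

lemma range_C: "range_proj C pC"
proof -
  have "range_proj (mA * Ta) (pA * pT)"
  proof (rule range_proj_mult[OF ranges(2)])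
    show "range_proj Ta pT" unfolding Ta_def using exponents ranges by (intro range_proj_cpow) simp_all
  qed (simp_all add: pT_comm)
  then show ?thesis by (simp add: C_def pC_def Ta_comm)
qed

lemma proj_pC [simp]: "proj pC" and pC_adj [simp]: "pC \<in> adjointables" and st_pC [simp]: "st pC = pC"
  using range_proj_proj[OF range_C] proj_selfadj selfadj_st selfadj_L by blast+

lemma range_Sb: "range_proj Sb pS"
  unfolding Sb_def using exponents ranges by (intro range_proj_cpow) simp_all

lemma C_adj [simp]: "C \<in> adjointables" "Sb \<in> adjointables" "st C = C" "st Sb = Sb"
  by (simp_all add: pos_selfadj)

lemma Z_rules: "pT * Z = Z" "pA * Z = Z" "pC * Z = Z" "Z * pS = Z"
proof -
  show 1: "pT * Z = Z" and 2: "pA * Z = Z" and "Z * pS = Z"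
    unfolding Z_def using C_rules pow_rules(6) by (metis mult.assoc)+
  show "pC * Z = Z" unfolding pC_def using 1 2 by (simp add: mult.assoc)
qed

lemma Z_adj [simp]: "Z \<in> adjointables"
  by (simp add: Z_def)

lemma Y_eq: "Y = v * Z"
proof -
  have "Y = Ta * v * mA * Sb" unfolding Y_def by (simp add: m_rules mult.assoc)
  also have "\<dots> = v * Z" unfolding Z_def C_def Ta_comm(1)[symmetric] by (simp add: mult.assoc)
  finally show ?thesis .
qed

lemma X_eq: "X = v * Z * u"
proof -
  have "X = Y * u" unfolding X_def Y_def using pow_rules(7) by (simp add: mult.assoc)
  then show ?thesis by (simp add: Y_eq)
qed

lemma W_adj [simp]: "W \<in> adjointables" "Y \<in> adjointables" "X \<in> adjointables"
  by (simp_all add: W_def Y_eq X_eq)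

lemma Y_star_Y: "st Y * Y = st Z * Z"
  unfolding Y_eq using Z_rules(2) by (simp add: mult.assoc) (metis mult.assoc v_rules(1))

lemma X_star_X: "st X * X = st (Z * u) * (Z * u)"
proof -
  have "X = Y * u" by (simp add: X_eq Y_eq)
  then have "st X * X = st u * (st Y * Y) * u" by (simp add: mult.assoc)
  then show ?thesis unfolding Y_star_Y by (simp add: mult.assoc)
qed

lemma W_star_W: "st W * W = st u * pC * u"
proof -
  have "st W * W = st u * (st v * (pT * pT) * v) * u" by (simp add: W_def mult.assoc)
  also have "st v * (pT * pT) * v = st v * v * pT" using pT_comm(1) by (simp add: mult.assoc)
  finally show ?thesis by (simp add: v_rules pC_def)
qed

subsection \<open>Consequences of positivity\<close>

lemma pos_Z_iff: "pos Z \<longleftrightarrow> C * Sb = Sb * C"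
proof
  assume "pos Z"
  then have "st Z = Z" by (simp add: pos_selfadj)
  then show "C * Sb = Sb * C" by (simp add: Z_def)
next
  assume "C * Sb = Sb * C"
  then show "pos Z" unfolding Z_def by (intro pos_mult) simp_all
qed

text \<open>
  Commuting positive operators have commuting range projections, and their product has the product
  of these as its range projection.
\<close>

lemma pC_pS: assumes "pos Z" shows "pC * pS = pS * pC" "range_proj Z (pC * pS)"
proof -
  have c: "C * Sb = Sb * C" using assms pos_Z_iff by simp
  have "Sb * pC = pC * Sb" by (rule range_proj_comm[OF range_C]) (simp_all add: c)
  then show 1: "pC * pS = pS * pC" by (intro range_proj_comm[OF range_Sb]) simp_all
  have "C * pS = pS * C" by (rule range_proj_comm[OF range_Sb]) (simp_all add: c)
  then show "range_proj Z (pC * pS)"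
    unfolding Z_def by (intro range_proj_mult[OF range_C range_Sb 1]) simp
qed

lemma pS_Z: assumes "pos Z" shows "pS * Z = Z"
proof -
  have "Z = Sb * C" unfolding Z_def using assms pos_Z_iff by simp
  then show ?thesis using pow_rules(5) by (metis mult.assoc)
qed

lemma modulus_Y: assumes "pos Z" shows "modulus Y = Z"
  using assms by (intro modulus_eqI) (simp_all add: Y_star_Y pos_selfadj)

lemma modulus_X: assumes "pos Z" shows "modulus X = st u * Z * u"
proof (rule modulus_eqI)
  show "pos (st u * Z * u)" by (rule pos_conj[OF assms]) simp
  have "st u * Z * u * (st u * Z * u) = st u * (Z * pS) * Z * u"
    unfolding u_rules(2)[symmetric] by (simp add: mult.assoc)
  also have "\<dots> = st X * X" unfolding X_star_X Z_rules using assms by (simp add: pos_selfadj mult.assoc)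
  finally show "st u * Z * u * (st u * Z * u) = st X * X" .
qed

lemma pos_imp_X: assumes "pos Z" shows "X = W * modulus X"
proof -
  have "W * modulus X = pT * v * (u * st u) * Z * u" unfolding modulus_X[OF assms] W_def by (simp add: mult.assoc)
  also have "\<dots> = v * pT * (pS * Z) * u" unfolding u_rules(2) pT_comm(1) by (simp add: mult.assoc)
  also have "\<dots> = v * (pT * Z) * u" unfolding pS_Z[OF assms] by (simp add: mult.assoc)
  finally show ?thesis by (simp add: Z_rules X_eq)
qed

lemma pos_imp_Y: assumes "pos Z" shows "Y = W * st u * modulus Y"
proof -
  have "W * st u * modulus Y = pT * v * (u * st u) * Z" unfolding modulus_Y[OF assms] W_def by (simp add: mult.assoc)
  also have "\<dots> = v * pT * (pS * Z)" unfolding u_rules(2) pT_comm(1) by (simp add: mult.assoc)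
  also have "\<dots> = v * (pT * Z)" unfolding pS_Z[OF assms] by (simp add: mult.assoc)
  finally show ?thesis by (simp add: Z_rules Y_eq)
qed

lemma pos_imp_polar_Y: assumes "pos Z" shows "polar Y (W * st u)"
proof (rule polarI)
  have "st (W * st u) * (W * st u) = u * (st W * W) * st u" by (simp add: mult.assoc)
  also have "\<dots> = pS * pC * pS" unfolding W_star_W pS_def by (simp add: mult.assoc)
  also have "\<dots> = pC * pS" using pC_pS(1)[OF assms] proj_idem[OF proj_p(3)] by (metis mult.assoc)
  finally show "range_proj (modulus Y) (st (W * st u) * (W * st u))"
    using pC_pS(2)[OF assms] modulus_Y[OF assms] by simp
qed (use pos_imp_Y[OF assms] in simp_all)

text \<open>
  The candidate projection is \<open>W\<^sup>* W = u\<^sup>* pC u\<close>. It is idempotent as \<open>pC\<close> commutes with \<open>u u\<^sup>*\<close>, and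
  vectors \<open>u\<^sup>* pC u x\<close> are approximated by \<open>u\<^sup>* Z y = (u\<^sup>* Z u) u\<^sup>* y\<close>, in the range of \<open>|X|\<close>.
\<close>

lemma pos_imp_polar_X: assumes "pos Z" shows "polar X W"
proof (rule polarI)
  have c: "pC * pS = pS * pC" by (rule pC_pS[OF assms])
  have e: "pC * pC = pC" by simp
  show "range_proj (modulus X) (st W * W)"
    unfolding modulus_X[OF assms] W_star_W
  proof (rule range_projI)
    have "st u * pC * u * (st u * pC * u) = st u * (pC * pS) * pC * u"
      unfolding pS_def by (simp add: mult.assoc)
    also have "\<dots> = (st u * pS) * (pC * pC) * u" unfolding c by (simp add: mult.assoc)
    finally have "st u * pC * u * (st u * pC * u) = st u * pC * u" unfolding u_rules e .
    moreover have "selfadj (st u * pC * u)" by (rule selfadj_conj) simp_all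
    ultimately show "proj (st u * pC * u)" by (simp only: proj_def)
    have "st u * pC * u * (st u * Z * u) = st u * pC * (pS * Z) * u"
      unfolding pS_def by (simp add: mult.assoc)
    also have "\<dots> = st u * (pC * Z) * u" unfolding pS_Z[OF assms] by (simp add: mult.assoc)
    finally show "st u * pC * u * (st u * Z * u) = st u * Z * u" unfolding Z_rules .
    fix x and h :: real assume h: "h > 0"
    define k where "k = norm (st u) + 1"
    have k: "k > 0" by (simp add: k_def add_nonneg_pos)
    obtain y where y: "norm (ap Z y - ap (pC * pS) (ap u x)) < h / k"
      using range_proj_approx[OF pC_pS(2)[OF assms], of "h / k" "ap u x"] h k by (meson divide_pos_pos)
    have "st u * Z * u * st u = st u * (Z * pS)" unfolding pS_def by (simp add: mult.assoc)
    then have 1: "ap (st u * Z * u) (ap (st u) y) = ap (st u) (ap Z y)"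
      unfolding Z_rules by (metis ap_simps(1))
    have "st u * pC * u = st u * (pC * pS) * u" using u_rules(5) by (simp add: mult.assoc)
    then have 2: "ap (st u * pC * u) x = ap (st u) (ap (pC * pS) (ap u x))" by (metis ap_simps(1))
    have "norm (ap (st u * Z * u) (ap (st u) y) - ap (st u * pC * u) x)
        = norm (ap (st u) (ap Z y - ap (pC * pS) (ap u x)))"
      unfolding 1 2 by (simp only: ap_linear)
    also have "\<dots> \<le> norm (st u) * norm (ap Z y - ap (pC * pS) (ap u x))" by (rule norm_ap)
    also have "\<dots> \<le> k * norm (ap Z y - ap (pC * pS) (ap u x))"
      by (intro mult_right_mono) (simp_all add: k_def)
    also have "\<dots> < k * (h / k)" using y k by (intro mult_strict_left_mono)
    also have "\<dots> = h" using k by simp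
    finally show "\<exists>y. norm (ap (st u * Z * u) y - ap (st u * pC * u) x) < h" by blast
  qed
qed (use pos_imp_X[OF assms] in simp_all)

subsection \<open>Recovering positivity\<close>

lemma star_mult_0: assumes "r \<in> adjointables" "st r * r = 0" shows "r = 0"
  using cstar[OF assms(1)] assms(2) by simp

text \<open>
  Multiplying the identity by \<open>v\<^sup>*\<close> gives \<open>Z u = pC u k\<close> for \<open>k = |X|\<close>. As \<open>(Z u)\<^sup>* (Z u) = k\<^sup>2 = (u k)\<^sup>* (u k)\<close>,
  the part \<open>r = (1 - pC) u k\<close> satisfies \<open>r\<^sup>* r = 0\<close>, so \<open>Z u = u k\<close> and \<open>Z = u k u\<^sup>*\<close>.
\<close>

lemma X_imp_pos: assumes X: "X = W * modulus X" shows "pos Z"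
proof -
  define k where "k = modulus X"
  have k: "pos k" by (simp add: k_def pos_modulus)
  have sk: "selfadj k" using k by simp
  have kL: "k \<in> adjointables" "st k = k" using sk by simp_all
  have XpT: "X * pT = X" unfolding X_def using pow_rules(4) by (simp add: mult.assoc)
  have kk: "k * k = st X * X" by (simp add: k_def modulus_square)
  have "pT * st X = st X" using arg_cong[OF XpT, of st] by simp
  then have "pT * (k * k) = k * k" unfolding kk by (metis mult.assoc)
  then have pk: "pT * k = k" using selfadj_square_right_unit[OF sk] by simp
  have "st v * X = pA * Z * u" unfolding X_eq v_rules(1)[symmetric] by (simp add: mult.assoc)
  then have "Z * u = st v * X" by (simp add: Z_rules)
  also have "\<dots> = st v * (pT * v) * u * k" using X by (simp add: W_def k_def mult.assoc)
  also have "\<dots> = pC * u * k" unfolding pT_comm(1) pC_def v_rules(1)[symmetric] by (simp add: mult.assoc)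
  finally have K: "Z * u = pC * (u * k)" by (simp add: mult.assoc)
  define r where "r = u * k - pC * (u * k)"
  have "st r * r = k * (st u * u) * k - k * st u * pC * u * k - (k * st u * pC * u * k - k * st u * (pC * pC) * u * k)"
    using kL by (simp add: r_def algebra_simps)
  also have "\<dots> = k * (pT * k) - k * st u * (pC * pC) * u * k" unfolding u_rules by (simp add: mult.assoc)
  also have "k * st u * (pC * pC) * u * k = st (Z * u) * (Z * u)"
    unfolding K using kL by (simp add: mult.assoc)
  finally have "st r * r = 0" using X_star_X kk pk by simp
  moreover have "r \<in> adjointables" using kL by (simp add: r_def)
  ultimately have "r = 0" using star_mult_0 by blast
  then have Zu: "Z * u = u * k" using K by (simp add: r_def)
  have "Z = Z * u * st u" using Z_rules(4) by (simp add: pS_def mult.assoc)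
  then have "Z = u * k * st u" unfolding Zu .
  then show ?thesis using pos_conj[OF k, of "st u"] by simp
qed

text \<open>
  Here \<open>Z = pC pS k\<close> for \<open>k = |Y|\<close>, and \<open>k\<^sup>2 = Z\<^sup>* Z\<close>. The parts \<open>r\<close> and \<open>s\<close> that the two projections
  remove satisfy \<open>r\<^sup>* r + s\<^sup>* s = k\<^sup>2 - Z\<^sup>* Z = 0\<close>, so both vanish and \<open>Z = k\<close>.
\<close>

lemma Y_imp_pos: assumes Y: "Y = W * st u * modulus Y" shows "pos Z"
proof -
  define k where "k = modulus Y"
  have k: "pos k" by (simp add: k_def pos_modulus)
  have kL: "k \<in> adjointables" "st k = k" using k by (simp_all add: pos_selfadj)
  have kk: "k * k = st Z * Z" by (simp add: k_def modulus_square Y_star_Y)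
  have "Z = st v * Y" unfolding Y_eq using Z_rules(2) v_rules(1) by (metis mult.assoc)
  also have "\<dots> = st v * (pT * v) * (u * st u) * k" using Y by (simp add: W_def k_def mult.assoc)
  also have "\<dots> = pC * pS * k"
    unfolding pT_comm(1) pC_def v_rules(1)[symmetric] pS_def by (simp add: mult.assoc)
  finally have Z: "Z = pC * (pS * k)" by (simp add: mult.assoc)
  define r where "r = k - pS * k"
  define s where "s = pS * k - pC * (pS * k)"
  have rsL: "r \<in> adjointables" "s \<in> adjointables" using kL by (simp_all add: r_def s_def)
  have rr: "st r * r = k * k - k * pS * k"
  proof -
    have "st r * r = k * k - k * pS * k - (k * pS * k - k * (pS * pS) * k)"
      using kL by (simp add: r_def algebra_simps)
    then show ?thesis by simp
  qed
  have ss: "st s * s = k * pS * k - st Z * Z"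
  proof -
    have "st s * s = k * (pS * pS) * k - k * pS * pC * pS * k - (k * pS * pC * pS * k - k * pS * (pC * pC) * pS * k)"
      using kL by (simp add: s_def algebra_simps)
    moreover have "k * pS * (pC * pC) * pS * k = st Z * Z" unfolding Z using kL by (simp add: mult.assoc)
    ultimately show ?thesis by simp
  qed
  have "st r * r + st s * s = 0" unfolding rr ss kk by simp
  then have "st s * s = 0 - st r * r" by (simp add: eq_neg_iff_add_eq_0 add.commute)
  then have "pos (0 - st r * r)" using pos_star_mult[OF rsL(2)] by (simp only:)
  then have "norm (st r * r) \<le> norm (0::'h endo)" by (rule pos_mono_norm[OF pos_star_mult[OF rsL(1)]])
  then have r0: "st r * r = 0" by simp
  then have "st s * s = 0" using \<open>st r * r + st s * s = 0\<close> by simp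
  then have s0: "s = 0" by (rule star_mult_0[OF rsL(2)])
  have "r = 0" by (rule star_mult_0[OF rsL(1) r0])
  then have "Z = k" using Z s0 by (simp add: r_def s_def)
  then show ?thesis using k by simp
qed

lemma equivalences:
  "polar X W \<longleftrightarrow> pos Z" "polar Y (W * st u) \<longleftrightarrow> pos Z"
  "X = W * modulus X \<longleftrightarrow> pos Z" "Y = W * st u * modulus Y \<longleftrightarrow> pos Z"
proof -
  show "polar X W \<longleftrightarrow> pos Z"
    using X_imp_pos[OF polarD(3)[symmetric]] pos_imp_polar_X by blast
  show "polar Y (W * st u) \<longleftrightarrow> pos Z"
    using Y_imp_pos[OF polarD(3)[symmetric]] pos_imp_polar_Y by blast
  show "X = W * modulus X \<longleftrightarrow> pos Z" using X_imp_pos pos_imp_X by blast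
  show "Y = W * st u * modulus Y \<longleftrightarrow> pos Z" using Y_imp_pos pos_imp_Y by blast
qed

end

subsection \<open>Changing the exponents\<close>

context cs_module
begin

text \<open>
  As \<open>|a|\<close> commutes with \<open>|t|\<close> and \<open>|t\<^sup>*|\<close>, \<open>C\<close> and \<open>|t\<^sup>*|\<^sup>\<beta>\<close> commute if and only if \<open>|t|\<^sup>\<alpha>\<close> and \<open>|t\<^sup>*|\<^sup>\<beta>\<close>
  commute after multiplication by the projection \<open>pA\<close>. Then \<open>pA |t\<^sup>*|\<^sup>\<beta>\<close> commutes with \<open>|t|\<^sup>\<alpha>\<close> and
  therefore with its power \<open>|t|\<^bsup>\<alpha>'\<^esup>\<close>, and in a second step \<open>pA |t|\<^bsup>\<alpha>'\<^esup>\<close> commutes with \<open>|t\<^sup>*|\<^bsup>\<beta>'\<^esup>\<close>.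
\<close>

lemma polar_pair_change_exponents:
  assumes pair: "polar_pair ip t a u v \<alpha> \<beta>" "polar_pair ip t a u v \<alpha>' \<beta>'"
    and comm: "modulus (st t) * modulus a = modulus a * modulus (st t)"
    and Z: "pos (polar_pair.Z ip t a \<alpha> \<beta>)"
  shows "pos (polar_pair.Z ip t a \<alpha>' \<beta>')"
proof -
  interpret o: polar_pair ip t a u v \<alpha> \<beta> by (rule pair(1))
  interpret n: polar_pair ip t a u v \<alpha>' \<beta>' by (rule pair(2))
  have \<alpha>: "\<alpha> > 0" "\<alpha>' > 0" and \<beta>: "\<beta> > 0" "\<beta>' > 0" using o.exponents n.exponents by simp_all
  have hS: "o.mA * o.mS = o.mS * o.mA" using comm by (simp add: o.mA_def o.mS_def)
  have hD: "o.mA * o.Sb = o.Sb * o.mA" and hD': "o.mA * n.Sb = n.Sb * o.mA"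
    unfolding o.Sb_def n.Sb_def using hS \<beta> by (intro cpow_intertwine; simp)+
  have qD: "o.pA * o.Sb = o.Sb * o.pA"
    using range_proj_comm[OF o.ranges(2), of o.Sb] hD by simp
  have "o.mA * (o.Ta * o.Sb - o.Sb * o.Ta) = o.C * o.Sb - o.Sb * o.C"
  proof -
    have "o.mA * (o.Ta * o.Sb) = o.C * o.Sb" unfolding o.C_def o.Ta_comm(2)[symmetric] by (simp add: mult.assoc)
    moreover have "o.mA * (o.Sb * o.Ta) = o.Sb * o.C"
      unfolding o.C_def o.Ta_comm(2)[symmetric] using hD by (metis mult.assoc)
    ultimately show ?thesis by (simp add: right_diff_distrib)
  qed
  also have "\<dots> = 0" using Z o.pos_Z_iff by simp
  finally have "o.pA * (o.Ta * o.Sb - o.Sb * o.Ta) = 0"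
    by (intro range_proj_kill'[OF o.ranges(2)]) (simp_all add: o.pos_pow)
  then have qAD: "o.pA * (o.Ta * o.Sb) = o.pA * (o.Sb * o.Ta)" by (simp add: right_diff_distrib)
  have "o.pA * o.Sb * o.Ta = o.Ta * (o.pA * o.Sb)"
    using qAD o.Ta_comm(3) by (metis mult.assoc)
  then have "o.pA * o.Sb * cpow o.Ta (\<alpha>' / \<alpha>) = cpow o.Ta (\<alpha>' / \<alpha>) * (o.pA * o.Sb)"
    using \<alpha> by (intro cpow_intertwine) simp_all
  moreover have "cpow o.Ta (\<alpha>' / \<alpha>) = n.Ta"
    unfolding o.Ta_def n.Ta_def using \<alpha> by (subst cpow_cpow) simp_all
  ultimately have gA: "o.pA * o.Sb * n.Ta = n.Ta * (o.pA * o.Sb)" by simp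
  have qA: "o.pA * n.Ta = n.Ta * o.pA" by (rule n.Ta_comm(3))
  have "o.pA * n.Ta * o.Sb = n.Ta * (o.pA * o.Sb)" unfolding qA by (simp add: mult.assoc)
  also have "\<dots> = o.Sb * (o.pA * n.Ta)" using gA qD by (metis mult.assoc)
  finally have "o.pA * n.Ta * o.Sb = o.Sb * (o.pA * n.Ta)" .
  then have "o.pA * n.Ta * cpow o.Sb (\<beta>' / \<beta>) = cpow o.Sb (\<beta>' / \<beta>) * (o.pA * n.Ta)"
    using \<beta> by (intro cpow_intertwine) simp_all
  moreover have "cpow o.Sb (\<beta>' / \<beta>) = n.Sb"
    unfolding o.Sb_def n.Sb_def using \<beta> by (subst cpow_cpow) simp_all
  ultimately have gD: "o.pA * n.Ta * n.Sb = n.Sb * (o.pA * n.Ta)" by simp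
  have C: "n.C = o.mA * (o.pA * n.Ta)"
    unfolding n.C_def using n.Ta_comm(2) o.m_rules(4) by (metis mult.assoc)
  have "n.C * n.Sb = o.mA * (n.Sb * (o.pA * n.Ta))" unfolding C gD[symmetric] by (simp add: mult.assoc)
  also have "\<dots> = n.Sb * n.C" unfolding C using hD' by (metis mult.assoc)
  finally show ?thesis using n.pos_Z_iff by simp
qed

end

section \<open>Equivalence of the five conditions\<close>

theorem corollary4p9:
  fixes act :: "'h::{complex_vector, banach} \<Rightarrow> 'a::cstar_algebra \<Rightarrow> 'h"
    and ip :: "'h \<Rightarrow> 'h \<Rightarrow> 'a"
    and T A U\<^sub>T U\<^sub>A W :: "'h \<Rightarrow>\<^sub>L 'h"
    and X Y Z :: "real \<Rightarrow> real \<Rightarrow> 'h \<Rightarrow>\<^sub>L 'h"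
    and i ii iii iv v :: "real \<Rightarrow> real \<Rightarrow> bool"
    and \<alpha> \<beta> :: real
  assumes "hilbert_module act ip"
    and "polar_decomposition ip T U\<^sub>T"
    and "polar_decomposition ip A U\<^sub>A"
    and "commutator (op_abs ip T) A = 0"
  defines "X \<equiv> \<lambda>a b. op_powr ip (op_abs ip T) a o\<^sub>L A o\<^sub>L U\<^sub>T o\<^sub>L op_powr ip (op_abs ip T) b"
    and "Y \<equiv> \<lambda>a b. op_powr ip (op_abs ip T) a o\<^sub>L A o\<^sub>L op_powr ip (op_abs ip (adjoint_op ip T)) b"
    and "Z \<equiv> \<lambda>a b. op_powr ip (op_abs ip T) a o\<^sub>L op_abs ip A
                      o\<^sub>L op_powr ip (op_abs ip (adjoint_op ip T)) b"
    and "W \<equiv> adjoint_op ip U\<^sub>T o\<^sub>L U\<^sub>T o\<^sub>L U\<^sub>A o\<^sub>L U\<^sub>T"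
  defines "i \<equiv> \<lambda>a b. polar_decomposition ip (X a b) W"
    and "ii \<equiv> \<lambda>a b. polar_decomposition ip (Y a b) (W o\<^sub>L adjoint_op ip U\<^sub>T)"
    and "iii \<equiv> \<lambda>a b. X a b = W o\<^sub>L op_abs ip (X a b)"
    and "iv \<equiv> \<lambda>a b. Y a b = W o\<^sub>L adjoint_op ip U\<^sub>T o\<^sub>L op_abs ip (Y a b)"
    and "v \<equiv> \<lambda>a b. op_positive ip (Z a b)"
  assumes "\<alpha> > 0" and "\<beta> > 0"
  shows "(i \<alpha> \<beta> \<longleftrightarrow> ii \<alpha> \<beta>) \<and> (i \<alpha> \<beta> \<longleftrightarrow> iii \<alpha> \<beta>) \<and> (i \<alpha> \<beta> \<longleftrightarrow> iv \<alpha> \<beta>) \<and> (i \<alpha> \<beta> \<longleftrightarrow> v \<alpha> \<beta>) \<and>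
    (commutator (op_abs ip (adjoint_op ip T)) (op_abs ip A) = 0 \<and>
       (i \<alpha> \<beta> \<or> ii \<alpha> \<beta> \<or> iii \<alpha> \<beta> \<or> iv \<alpha> \<beta> \<or> v \<alpha> \<beta>) \<longrightarrow>
     (\<forall>\<alpha>'>0. \<forall>\<beta>'>0. i \<alpha>' \<beta>' \<and> ii \<alpha>' \<beta>' \<and> iii \<alpha>' \<beta>' \<and> iv \<alpha>' \<beta>' \<and> v \<alpha>' \<beta>'))"
proof -
  interpret cs_module ip by (rule hilbert_module_imp_cs_module) fact
  define tt aa uu vv where "tt = endo T" and "aa = endo A" and "uu = endo U\<^sub>T" and "vv = endo U\<^sub>A"
  have blin: "T = blin tt" "A = blin aa" "U\<^sub>T = blin uu" "U\<^sub>A = blin vv"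
    by (simp_all add: tt_def aa_def uu_def vv_def)
  have tu: "polar tt uu" and av: "polar aa vv"
    using assms(2,3) unfolding blin polar_decomposition_iff .
  have adj: "tt \<in> adjointables" "aa \<in> adjointables" "uu \<in> adjointables" "vv \<in> adjointables"
    using polarD(1,2)[OF tu] polarD(1,2)[OF av] by simp_all
  have abs: "op_abs ip T = blin (modulus tt)" "op_abs ip A = blin (modulus aa)"
    "op_abs ip (adjoint_op ip T) = blin (modulus (st tt))"
    using adj op_abs_blin[of "st tt"] by (simp_all add: blin op_abs_blin)
  have comm: "modulus tt * aa = aa * modulus tt"
    using assms(4) unfolding abs by (simp add: blin commutator_blin)
  have pair: "polar_pair ip tt aa uu vv r s" if "r > 0" "s > 0" for r s
    by unfold_locales (fact tu av comm that)+
  have key: "(i r s \<longleftrightarrow> pos (polar_pair.Z ip tt aa r s)) \<and> (ii r s \<longleftrightarrow> pos (polar_pair.Z ip tt aa r s)) \<and>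
      (iii r s \<longleftrightarrow> pos (polar_pair.Z ip tt aa r s)) \<and> (iv r s \<longleftrightarrow> pos (polar_pair.Z ip tt aa r s)) \<and>
      (v r s \<longleftrightarrow> pos (polar_pair.Z ip tt aa r s))" if "r > 0" "s > 0" for r s
  proof -
    interpret p: polar_pair ip tt aa uu vv r s by (rule pair[OF that])
    have powers: "op_powr ip (op_abs ip T) r = blin p.Ta" "op_powr ip (op_abs ip T) s = blin p.Tb"
      "op_powr ip (op_abs ip (adjoint_op ip T)) s = blin p.Sb"
      unfolding abs p.Ta_def p.Tb_def p.Sb_def p.mT_def p.mS_def
      using that adj by (simp_all add: op_powr_blin pos_modulus)
    have X: "X r s = blin p.X" and Y: "Y r s = blin p.Y" and Z: "Z r s = blin p.Z"
      unfolding X_def Y_def Z_def powers abs(2)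
      by (simp_all add: blin p.X_def p.Y_def p.Z_def p.C_def p.mA_def times_endo.rep_eq)
    have W: "W = blin p.W" and WU: "W o\<^sub>L adjoint_op ip U\<^sub>T = blin (p.W * st uu)"
      by (simp_all add: W_def blin p.W_def p.pT_def times_endo.rep_eq)
    have "i r s \<longleftrightarrow> pos p.Z"
      unfolding i_def X W polar_decomposition_iff by (rule p.equivalences)
    moreover have "ii r s \<longleftrightarrow> pos p.Z"
      unfolding ii_def Y WU polar_decomposition_iff by (rule p.equivalences)
    moreover have "iii r s \<longleftrightarrow> pos p.Z"
      unfolding iii_def X W op_abs_blin[OF p.W_adj(3)] times_endo.rep_eq[symmetric] blin_inject
      by (rule p.equivalences)
    moreover have "iv r s \<longleftrightarrow> pos p.Z"
      unfolding iv_def Y WU op_abs_blin[OF p.W_adj(2)] times_endo.rep_eq[symmetric] blin_inject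
      by (rule p.equivalences)
    moreover have "v r s \<longleftrightarrow> pos p.Z"
      unfolding v_def Z by (rule op_positive_iff)
    ultimately show ?thesis by blast
  qed
  have "pos (polar_pair.Z ip tt aa r s)"
    if "commutator (op_abs ip (adjoint_op ip T)) (op_abs ip A) = 0"
      "pos (polar_pair.Z ip tt aa \<alpha> \<beta>)" "r > 0" "s > 0" for r s
  proof (rule polar_pair_change_exponents[OF pair pair _ that(2)])
    show "modulus (st tt) * modulus aa = modulus aa * modulus (st tt)"
      using that(1) unfolding abs by (simp add: commutator_blin)
  qed (use that(3,4) \<open>\<alpha> > 0\<close> \<open>\<beta> > 0\<close> in simp_all)
  then show ?thesis using key \<open>\<alpha> > 0\<close> \<open>\<beta> > 0\<close> by metis
qed

end
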